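(* Let $Y_1,Y_2,\dots$ be independent $\mathbb{R}_+$-valued random variables with common distribution $\xi$ such that $\Lambda_\xi(\alpha)<\infty$ for every $\alpha>0$ and $\Lambda_\xi^*(0)=\infty$ (equivalently $\mathbb{P}(Y_1=0)=0$). For $n\ge1$ and $1\le i\le n$ let $$W_i^n=\frac{Y_i}{\frac1n\sum_{j=1}^nY_j}.$$ Then the sequence $\left(\mathcal{S}^n=\frac1n\sum_{i=1}^n\delta_{W_i^n}\right)_{n\ge1}$ satisfies an LDP on $M_1^1(\mathbb{R}_+)$ endowed with the $W_{1,|\cdot|}$ distance with good rate function $$I^W(\rho)=\inf_{m>0}\left\{H\big(\mathcal{G}(\rho,\tfrac1m)\,\big|\,\xi\big)\right\}.$$
   Context: $\Lambda_\xi(\alpha)=\log\int_{\mathbb{R}_+}e^{\alpha x}\xi(dx)$ and $\Lambda_\xi^*(x)=\sup_{\alpha\in\mathbb{R}}\{\alpha x-\Lambda_\xi(\alpha)\}$. $\mathcal{W}^1(\mathbb{R}_+)$ is the set of Borel probability measures on $\mathbb{R}_+$ with finite first moment and $M_1^1(\mathbb{R}_+)$ the subset of those with $\int x\,\rho(dx)=1$; $W_{1,|\cdot|}(\rho,\gamma)=\inf_\pi\int|x-y|\,\pi(dx,dy)$ over couplings $\pi$ of $\rho,\gamma$. For $\rho\in\mathcal{W}^1(\mathbb{R}_+)$ and $m>0$, $\mathcal{G}(\rho,m)\in\mathcal{W}^1(\mathbb{R}_+)$ is defined by $\mathcal{G}(\rho,m)(A)=\rho(mA)$ for Borel $A\subset\mathbb{R}_+$,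 where $mA=\{my:y\in A\}$. $H(\nu|\rho)=\int\log\frac{d\nu}{d\rho}d\nu$ if $\nu\ll\rho$, $+\infty$ otherwise. LDP: a sequence of Borel probability measures $(P^n)$ on a topological space satisfies an LDP with rate function $I$ if $I$ is nonnegative, lower semicontinuous and, for every measurable $A$, $-\inf_{A^o}I\le\liminf_n\frac1n\log P^n(A)\le\limsup_n\frac1n\log P^n(A)\le-\inf_{\bar A}I$; $I$ is good if its level sets $\{I\le\alpha\}$, $\alpha<\infty$, are compact. A sequence of random variables satisfies an LDP if their laws do. *)

theory Defs
  imports "HOL-Probability.Probability"
begin

text \<open>Logarithm and integral with values in the extended reals, as both \<open>\<Lambda>\<close> and the relative
  entropy may be infinite (the library's real-valued integral would return the value 0).\<close>

definition elog :: "ennreal \<Rightarrow> ereal" where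
  "elog x = (if x = 0 then -\<infinity> else if x = \<infinity> then \<infinity> else ereal (ln (enn2real x)))"

definition eintegral :: "'a measure \<Rightarrow> ('a \<Rightarrow> real) \<Rightarrow> ereal" where
  "eintegral M f =
     enn2ereal (\<integral>\<^sup>+x. ennreal (f x) \<partial>M) - enn2ereal (\<integral>\<^sup>+x. ennreal (- f x) \<partial>M)"

abbreviation Rplus :: "real measure" where
  "Rplus \<equiv> restrict_space borel {0..}"

definition cumulant :: "real measure \<Rightarrow> real \<Rightarrow> ereal" where
  "cumulant \<xi> \<alpha> = elog (\<integral>\<^sup>+x. ennreal (exp (\<alpha> * x)) \<partial>\<xi>)"

definition cumulant_conj :: "real measure \<Rightarrow> real \<Rightarrow> ereal" where
  "cumulant_conj \<xi> x = (SUP \<alpha>::real. ereal (\<alpha> * x) - cumulant \<xi> \<alpha>)"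

text \<open>Where \<open>\<nu>\<close> is absolutely continuous with respect to \<open>\<rho>\<close>, the negative part of
  \<open>log d\<nu>/d\<rho>\<close> has \<open>\<nu>\<close>-integral at most \<open>1/e\<close>, so the difference in \<open>eintegral\<close> is never
  \<open>\<infinity> - \<infinity>\<close> for probability measures.\<close>

definition rel_entropy :: "'a measure \<Rightarrow> 'a measure \<Rightarrow> ereal" where
  "rel_entropy \<nu> \<rho> =
     (if absolutely_continuous \<rho> \<nu>
      then eintegral \<nu> (\<lambda>x. ln (enn2real (RN_deriv \<rho> \<nu> x)))
      else \<infinity>)"

definition W1_space :: "real measure set" where
  "W1_space = {\<rho> \<in> space (prob_algebra Rplus). integrable \<rho> (\<lambda>x. x)}"

definition M11 :: "real measure set" where
  "M11 = {\<rho> \<in> W1_space. (\<integral>x. x \<partial>\<rho>) = 1}"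

definition couplings :: "real measure \<Rightarrow> real measure \<Rightarrow> (real \<times> real) measure set" where
  "couplings \<rho> \<gamma> =
     {\<pi> \<in> space (prob_algebra (Rplus \<Otimes>\<^sub>M Rplus)). distr \<pi> Rplus fst = \<rho> \<and> distr \<pi> Rplus snd = \<gamma>}"

text \<open>The infimum is finite on \<open>W1_space\<close>, so \<open>enn2real\<close> loses nothing there.\<close>

definition W1_dist :: "real measure \<Rightarrow> real measure \<Rightarrow> real" where
  "W1_dist \<rho> \<gamma> = enn2real (INF \<pi> \<in> couplings \<rho> \<gamma>. \<integral>\<^sup>+p. ennreal \<bar>fst p - snd p\<bar> \<partial>\<pi>)"

abbreviation M11_topology :: "real measure topology" where
  "M11_topology \<equiv> Metric_space.mtopology M11 W1_dist"

definition G_scale :: "real measure \<Rightarrow> real \<Rightarrow> real measure" where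
  "G_scale \<rho> m = distr \<rho> Rplus (\<lambda>x. x / m)"

lemma emeasure_G_scale:
  assumes "sets \<rho> = sets Rplus" "m > 0" "A \<in> sets Rplus"
  shows "emeasure (G_scale \<rho> m) A = emeasure \<rho> ((\<lambda>y. m * y) ` A)"
proof -
  have sp: "space \<rho> = {0..}"
    using sets_eq_imp_space_eq[OF assms(1)] by (simp add: space_restrict_space)
  have "(\<lambda>x. x / m) \<in> measurable Rplus Rplus"
    using assms(2) by (intro measurable_restrict_space3) auto
  then have meas: "(\<lambda>x. x / m) \<in> measurable \<rho> Rplus"
    using measurable_cong_sets[OF assms(1) refl] by blast
  have "A \<subseteq> {0..}"
    using sets.sets_into_space[OF assms(3)] by (simp add: space_restrict_space)
  then have "(\<lambda>x. x / m) -` A \<inter> space \<rho> = (\<lambda>y. m * y) ` A"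
    using assms(2) by (force simp: sp image_iff)
  then show ?thesis
    unfolding G_scale_def using emeasure_distr[OF meas assms(3)] by simp
qed

definition empirical_measure :: "nat \<Rightarrow> (nat \<Rightarrow> real) \<Rightarrow> real measure" where
  "empirical_measure n w =
     measure_of (space Rplus) (sets Rplus)
       (\<lambda>A. ennreal (1 / real n) * (\<Sum>i = 1..n. emeasure (return Rplus (w i)) A))"

lemma emeasure_empirical_measure:
  assumes "A \<in> sets Rplus"
  shows "emeasure (empirical_measure n w) A =
           ennreal (1 / real n) * (\<Sum>i = 1..n. indicator A (w i))"
proof -
  let ?\<mu> = "\<lambda>A. ennreal (1 / real n) * (\<Sum>i = 1..n. emeasure (return Rplus (w i)) A)"
  have "countably_additive (sets Rplus) ?\<mu>"
  proof (rule countably_additiveI)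
    fix B :: "nat \<Rightarrow> real set"
    assume B: "range B \<subseteq> sets Rplus" "disjoint_family B"
    have "(\<Sum>k. emeasure (return Rplus (w i)) (B k)) = emeasure (return Rplus (w i)) (\<Union>k. B k)"
      for i
      using B by (intro suminf_emeasure) auto
    then show "(\<Sum>k. ?\<mu> (B k)) = ?\<mu> (\<Union>k. B k)"
      by (simp add: suminf_sum)
  qed
  then have "emeasure (empirical_measure n w) A = ?\<mu> A"
    unfolding empirical_measure_def
    by (intro emeasure_measure_of_sigma sets.sigma_algebra_axioms assms) (auto simp: positive_def)
  then show ?thesis
    using assms by simp
qed

definition borel_of :: "'a topology \<Rightarrow> 'a measure" where
  "borel_of T = sigma (topspace T) {U. openin T U}"

definition rate_function :: "'a topology \<Rightarrow> ('a \<Rightarrow> ereal) \<Rightarrow> bool" where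
  "rate_function T I \<longleftrightarrow>
     (\<forall>x\<in>topspace T. 0 \<le> I x) \<and> (\<forall>a. openin T {x \<in> topspace T. a < I x})"

definition good_rate_function :: "'a topology \<Rightarrow> ('a \<Rightarrow> ereal) \<Rightarrow> bool" where
  "good_rate_function T I \<longleftrightarrow>
     rate_function T I \<and> (\<forall>\<alpha>::real. compactin T {x \<in> topspace T. I x \<le> ereal \<alpha>})"

text \<open>Sequences are indexed by \<open>n \<ge> 1\<close>; the entry at 0 is irrelevant.\<close>

definition LDP :: "'a topology \<Rightarrow> (nat \<Rightarrow> 'a measure) \<Rightarrow> ('a \<Rightarrow> ereal) \<Rightarrow> bool" where
  "LDP T P I \<longleftrightarrow>
     (\<forall>n\<ge>1. prob_space (P n) \<and> sets (P n) = sets (borel_of T)) \<and>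
     rate_function T I \<and>
     (\<forall>A\<in>sets (borel_of T).
        - (INF x \<in> T interior_of A. I x) \<le> liminf (\<lambda>n. ereal (1 / real n) * elog (emeasure (P n) A)) \<and>
        liminf (\<lambda>n. ereal (1 / real n) * elog (emeasure (P n) A))
          \<le> limsup (\<lambda>n. ereal (1 / real n) * elog (emeasure (P n) A)) \<and>
        limsup (\<lambda>n. ereal (1 / real n) * elog (emeasure (P n) A)) \<le> - (INF x \<in> T closure_of A. I x))"

text \<open>A random element of \<open>T\<close> may leave \<open>topspace T\<close> on a null event: for the empirical measures
  of normalized samples this happens when all samples vanish, since then the normalization divides
  by 0. The pushforward is still the law, a probability measure on \<open>topspace T\<close>.\<close>

definition random_element :: "'b measure \<Rightarrow> 'a topology \<Rightarrow> ('b \<Rightarrow> 'a) \<Rightarrow> bool" where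
  "random_element M T X \<longleftrightarrow>
     (AE \<omega> in M. X \<omega> \<in> topspace T) \<and> (\<forall>A\<in>sets (borel_of T). X -` A \<inter> space M \<in> sets M)"

definition LDP_rv :: "'b measure \<Rightarrow> 'a topology \<Rightarrow> (nat \<Rightarrow> 'b \<Rightarrow> 'a) \<Rightarrow> ('a \<Rightarrow> ereal) \<Rightarrow> bool" where
  "LDP_rv M T X I \<longleftrightarrow>
     (\<forall>n\<ge>1. random_element M T (X n)) \<and> LDP T (\<lambda>n. distr M (borel_of T) (X n)) I"

lemma emeasure_law_random_element:
  assumes "random_element M T X" "A \<in> sets (borel_of T)"
  shows "emeasure (distr M (borel_of T) X) A = emeasure M {\<omega> \<in> space M. X \<omega> \<in> A}"
proof -
  let ?\<mu> = "\<lambda>A. emeasure M (X -` A \<inter> space M)"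
  have ms: "X -` B \<inter> space M \<in> sets M" if "B \<in> sets (borel_of T)" for B
    using assms(1) that by (simp add: random_element_def)
  have "countably_additive (sets (borel_of T)) ?\<mu>"
  proof (rule countably_additiveI)
    fix B :: "nat \<Rightarrow> 'b set"
    assume B: "range B \<subseteq> sets (borel_of T)" "disjoint_family B"
    have "(\<Sum>k. ?\<mu> (B k)) = emeasure M (\<Union>k. X -` B k \<inter> space M)"
      using B ms by (intro suminf_emeasure) (auto simp: disjoint_family_on_def)
    also have "(\<Union>k. X -` B k \<inter> space M) = X -` (\<Union>k. B k) \<inter> space M"
      by auto
    finally show "(\<Sum>k. ?\<mu> (B k)) = ?\<mu> (\<Union>k. B k)" .
  qed
  then have "emeasure (distr M (borel_of T) X) A = ?\<mu> A"
    unfolding distr_def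
    by (intro emeasure_measure_of_sigma sets.sigma_algebra_axioms assms(2)) (auto simp: positive_def)
  also have "X -` A \<inter> space M = {\<omega> \<in> space M. X \<omega> \<in> A}"
    by auto
  finally show ?thesis .
qed

definition normalized_sample :: "(nat \<Rightarrow> 'b \<Rightarrow> real) \<Rightarrow> nat \<Rightarrow> nat \<Rightarrow> 'b \<Rightarrow> real" where
  "normalized_sample Y n i \<omega> = Y i \<omega> / ((1 / real n) * (\<Sum>j = 1..n. Y j \<omega>))"

definition rate_W :: "real measure \<Rightarrow> real measure \<Rightarrow> ereal" where
  "rate_W \<xi> \<rho> = (INF m \<in> {0<..}. rel_entropy (G_scale \<rho> (1 / m)) \<xi>)"

end

theory Submission
  imports Defs "HOL-Real_Asymp.Real_Asymp"
begin

text \<open>On the half-line the Wasserstein distance is the \<open>L\<^sup>1\<close> distance of distribution functions, and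
  \<open>\<nu> \<mapsto> \<G>(\<nu>, mean \<nu>)\<close> is continuous away from \<open>\<delta>\<^sub>0\<close> and maps the empirical measure \<open>L\<^sub>n\<close> of the sample
  to that of the normalized sample. The theorem is thus the contraction of Sanov's theorem in the
  Wasserstein topology under this map.

  Upper bound: \<open>H(\<cdot>|\<xi>)\<close> is a supremum of \<open>\<integral>g d\<nu> - log \<integral>e\<^sup>g d\<xi>\<close> over bounded Lipschitz \<open>g\<close>, each of which is
  continuous in \<open>\<nu>\<close>, so Chernoff's inequality bounds the probability that \<open>L\<^sub>n\<close> lies in a compact set.
  All exponential moments being finite, \<open>L\<^sub>n\<close> lies in a Wasserstein compact set up to an exponentially
  small probability; since \<open>\<xi>{0} = 0\<close>, that set can be kept away from \<open>\<delta>\<^sub>0\<close>.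

  Lower bound: under the product law \<open>\<nu>\<^sup>n\<close> the expected distance of \<open>L\<^sub>n\<close> to \<open>\<nu>\<close> tends to 0, and the
  variational inequality for \<open>\<nu>\<^sup>n\<close> and \<open>\<xi>\<^sup>n\<close> applied to a multiple of an indicator function gives
  \<open>\<nu>\<^sup>n(E) log (1/\<xi>\<^sup>n(E)) \<le> n H(\<nu>|\<xi>) + log 2\<close>.\<close>

section \<open>The Wasserstein metric on the half-line\<close>

text \<open>The contraction principle cannot be quoted as it stands: the Lipschitz estimate for
  normalization degenerates like 1 / mean near the Dirac measure at 0. All compactness arguments
  therefore take place in \<open>tight_set\<close>, one of whose constraints bounds the mean from
  below. The rate function has its form because the laws that normalize to \<rho> are exactly the
  \<open>G_scale \<rho> (1 / m)\<close> with m > 0, so the infimum over m is an infimum of the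
  entropy over a fibre. The same test functions, multiples of the excess over a cutoff and of -x,
  serve twice: in the variational inequality they put entropy sublevels into
  \<open>tight_set\<close>, in Chernoff's inequality they put the empirical measures there. The
  supremum in the variational formula is approached by the log-density, which need be neither
  bounded nor continuous. It is truncated and then approximated by Lipschitz functions in the L^1
  spaces of both laws at once. The expected distance to \<nu> is accessible because the L^1 formula
  for the distance allows the expectation to be taken separately at each level t.\<close>

lemma W1_spaceD:
  assumes "\<nu> \<in> W1_space"
  shows "sets \<nu> = sets Rplus" "space \<nu> = {0..}" "prob_space \<nu>" "integrable \<nu> (\<lambda>x. x)"
  using assms sets_eq_imp_space_eq[of \<nu> Rplus]
  by (auto simp: W1_space_def space_prob_algebra space_restrict_space)

lemma W1_spaceI:
  assumes "sets \<nu> = sets Rplus" "prob_space \<nu>" "integrable \<nu> (\<lambda>x. x)"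
  shows "\<nu> \<in> W1_space"
  using assms by (simp add: W1_space_def space_prob_algebra)

lemma space_Rplus_cong: "sets \<nu> = sets Rplus \<Longrightarrow> space \<nu> = {0..}"
  using sets_eq_imp_space_eq[of \<nu> Rplus] by (auto simp: space_restrict_space)

lemma borel_measurable_Rplus:
  fixes f :: "real \<Rightarrow> 'a::topological_space"
  assumes "sets \<nu> = sets Rplus" "f \<in> borel_measurable borel"
  shows "f \<in> borel_measurable \<nu>"
  using assms measurable_restrict_space1[OF assms(2)] by (simp cong: measurable_cong_sets)

lemma borel_measurable_of_Rplus:
  fixes f :: "'a \<Rightarrow> real"
  shows "f \<in> measurable M Rplus \<Longrightarrow> f \<in> borel_measurable M"
  by (simp add: measurable_restrict_space2_iff)

lemma measurable_RplusI:
  assumes "f \<in> borel_measurable M" "\<And>x. x \<in> space M \<Longrightarrow> 0 \<le> f x"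
  shows "f \<in> measurable M Rplus"
  using assms by (auto simp: measurable_restrict_space2_iff)

text \<open>Distribution functions belong to Borel measures on the whole line, so a law on the
  half-line is first pushed forward along the inclusion.\<close>

abbreviation cdfp :: "real measure \<Rightarrow> real \<Rightarrow> real" where
  "cdfp \<nu> \<equiv> cdf (distr \<nu> borel (\<lambda>x. x))"

lemma real_distribution_distr_id:
  assumes "prob_space \<nu>" "sets \<nu> = sets Rplus"
  shows "real_distribution (distr \<nu> borel (\<lambda>x. x))"
  by (rule prob_space.real_distribution_distr[OF assms(1) borel_measurable_Rplus[OF assms(2)]]) simp

lemma distr_id_distr_Rplus:
  assumes "f \<in> measurable M Rplus"
  shows "distr (distr M Rplus f) borel (\<lambda>x. x) = distr M borel f"
proof -
  have "(\<lambda>x::real. x) \<in> borel_measurable Rplus" by (rule borel_measurable_Rplus) auto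
  then show ?thesis using assms by (simp add: distr_distr comp_def)
qed

lemma cdfp_distr:
  assumes "f \<in> measurable M Rplus"
  shows "cdfp (distr M Rplus f) = cdf (distr M borel f)"
  using distr_id_distr_Rplus[OF assms] by simp

text \<open>The step functions are the distribution functions of the Dirac measures at x and y.
  Integrated over a coupling, this identity turns transport cost into an L^1 distance of
  distribution functions.\<close>

lemma nn_integral_step_diff:
  fixes x y :: real
  shows "(\<integral>\<^sup>+t. ennreal \<bar>indicator {x..} t - indicator {y..} t\<bar> \<partial>lborel) = ennreal \<bar>x - y\<bar>"
proof -
  have *: "(\<integral>\<^sup>+t. ennreal \<bar>indicator {x..} t - indicator {y..} t\<bar> \<partial>lborel) = ennreal (y - x)"
    if "x \<le> y" for x y :: real
  proof -
    have "(\<integral>\<^sup>+t. ennreal \<bar>indicator {x..} t - indicator {y..} t\<bar> \<partial>lborel)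
        = (\<integral>\<^sup>+t. indicator {x..<y} t \<partial>lborel)"
      using that by (intro nn_integral_cong) (auto simp: indicator_def)
    then show ?thesis using that by simp
  qed
  show ?thesis
  proof (cases "x \<le> y")
    case True then show ?thesis using *[OF True] by simp
  next
    case False
    then have "y \<le> x" by simp
    from *[OF this] show ?thesis using False by (subst abs_minus_commute) simp
  qed
qed

lemma cdf_distr_eq_expectation:
  assumes "prob_space M" and [measurable]: "X \<in> borel_measurable M"
  shows "cdf (distr M borel X) t = (\<integral>\<omega>. indicator {X \<omega>..} t \<partial>M)"
proof -
  interpret prob_space M by fact
  have "cdf (distr M borel X) t = measure M {\<omega> \<in> space M. X \<omega> \<le> t}"
    by (auto simp: cdf_def measure_distr intro!: arg_cong[where f="measure M"])
  also have "\<dots> = (\<integral>\<omega>. indicator {\<omega> \<in> space M. X \<omega> \<le> t} \<omega> \<partial>M)"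
    by simp
  also have "\<dots> = (\<integral>\<omega>. indicator {X \<omega>..} t \<partial>M)"
    by (intro Bochner_Integration.integral_cong) (auto simp: indicator_def)
  finally show ?thesis .
qed

lemma measurable_step [measurable]:
  fixes X Y :: "'a \<Rightarrow> real"
  assumes [measurable]: "X \<in> borel_measurable M" "Y \<in> borel_measurable M"
  shows "(\<lambda>\<omega>. indicator {X \<omega>..} (Y \<omega>) :: real) \<in> borel_measurable M"
proof -
  have *: "(\<lambda>\<omega>. indicator {X \<omega>..} (Y \<omega>) :: real) = (\<lambda>\<omega>. if X \<omega> \<le> Y \<omega> then 1 else 0)"
    by (auto simp: indicator_def)
  show ?thesis unfolding * by measurable
qed

text \<open>At each level t the distribution functions differ by the expectation of a difference of
  steps. Moving the absolute value inside and exchanging the integrals shows that no coupling is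
  cheaper than the L^1 distance.\<close>

lemma nn_integral_cdf_diff_le:
  assumes "prob_space M" and [measurable]: "X \<in> borel_measurable M" "Y \<in> borel_measurable M"
  shows "(\<integral>\<^sup>+t. ennreal \<bar>cdf (distr M borel X) t - cdf (distr M borel Y) t\<bar> \<partial>lborel)
          \<le> (\<integral>\<^sup>+\<omega>. ennreal \<bar>X \<omega> - Y \<omega>\<bar> \<partial>M)"
proof -
  interpret prob_space M by fact
  interpret P: pair_sigma_finite M lborel by standard
  have int: "integrable M (\<lambda>\<omega>. indicator {Z \<omega>..} t :: real)" 
    if [measurable]: "Z \<in> borel_measurable M" for Z :: "_ \<Rightarrow> real" and t
    by (rule integrable_const_bound[where B=1]) (use measurable_step[OF that, of "\<lambda>_. t"] in auto)
  have "(\<integral>\<^sup>+t. ennreal \<bar>cdf (distr M borel X) t - cdf (distr M borel Y) t\<bar> \<partial>lborel)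
      \<le> (\<integral>\<^sup>+t. (\<integral>\<^sup>+\<omega>. ennreal \<bar>indicator {X \<omega>..} t - indicator {Y \<omega>..} t\<bar> \<partial>M) \<partial>lborel)"
  proof (intro nn_integral_mono)
    fix t :: real
    have "\<bar>cdf (distr M borel X) t - cdf (distr M borel Y) t\<bar>
        = \<bar>\<integral>\<omega>. indicator {X \<omega>..} t - indicator {Y \<omega>..} t \<partial>M\<bar>"
      by (simp add: cdf_distr_eq_expectation prob_space_axioms int)
    also have "\<dots> \<le> (\<integral>\<omega>. \<bar>indicator {X \<omega>..} t - indicator {Y \<omega>..} t\<bar> \<partial>M)"
      by (rule integral_abs_bound)
    finally show "ennreal \<bar>cdf (distr M borel X) t - cdf (distr M borel Y) t\<bar>
       \<le> (\<integral>\<^sup>+\<omega>. ennreal \<bar>indicator {X \<omega>..} t - indicator {Y \<omega>..} t\<bar> \<partial>M)"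
      by (subst nn_integral_eq_integral) (auto intro!: integrable_abs Bochner_Integration.integrable_diff int ennreal_leI)
  qed
  also have "\<dots> = (\<integral>\<^sup>+\<omega>. (\<integral>\<^sup>+t. ennreal \<bar>indicator {X \<omega>..} t - indicator {Y \<omega>..} t\<bar> \<partial>lborel) \<partial>M)"
    by (rule P.Fubini') measurable
  finally show ?thesis by (simp add: nn_integral_step_diff)
qed

lemma (in cdf_distribution) measurable_I_unit:
  "I \<in> borel_measurable (restrict_space lborel {0<..<1})"
  using measurable_CI by (simp cong: measurable_cong_sets add: sets_restrict_space)

text \<open>By the Galois connection between quantile and distribution function, the two steps at
  level t differ exactly for those \<omega> that lie between the two values of the distribution
  functions, so the exchange of integrals loses nothing here.\<close>

lemma nn_integral_quantile_diff:
  assumes "real_distribution \<rho>" "real_distribution \<gamma>"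
  shows "(\<integral>\<^sup>+\<omega>. ennreal \<bar>right_continuous_mono.I (cdf \<rho>) \<omega> - right_continuous_mono.I (cdf \<gamma>) \<omega>\<bar>
            \<partial>restrict_space lborel {0<..<1})
      = (\<integral>\<^sup>+t. ennreal \<bar>cdf \<rho> t - cdf \<gamma> t\<bar> \<partial>lborel)"
proof -
  interpret R: cdf_distribution \<rho> using assms(1) by (simp add: cdf_distribution_def)
  interpret G: cdf_distribution \<gamma> using assms(2) by (simp add: cdf_distribution_def)
  let ?\<Omega> = "restrict_space lborel {0<..<1}::real measure"
  interpret \<Omega>: prob_space ?\<Omega>
    by (auto simp add: emeasure_restrict_space space_restrict_space intro!: prob_spaceI)
  interpret P: pair_sigma_finite ?\<Omega> lborel by standard
  note [measurable] = R.measurable_I_unit G.measurable_I_unit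
  have "(\<integral>\<^sup>+\<omega>. ennreal \<bar>R.I \<omega> - G.I \<omega>\<bar> \<partial>?\<Omega>)
      = (\<integral>\<^sup>+\<omega>. (\<integral>\<^sup>+t. ennreal \<bar>indicator {R.I \<omega>..} t - indicator {G.I \<omega>..} t\<bar> \<partial>lborel) \<partial>?\<Omega>)"
    by (simp add: nn_integral_step_diff)
  also have "\<dots> = (\<integral>\<^sup>+t. (\<integral>\<^sup>+\<omega>. ennreal \<bar>indicator {R.I \<omega>..} t - indicator {G.I \<omega>..} t\<bar> \<partial>?\<Omega>) \<partial>lborel)"
    by (rule P.Fubini'[symmetric]) measurable
  also have "\<dots> = (\<integral>\<^sup>+t. ennreal \<bar>cdf \<rho> t - cdf \<gamma> t\<bar> \<partial>lborel)"
  proof (intro nn_integral_cong)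
    fix t :: real
    have "(\<integral>\<^sup>+\<omega>. ennreal \<bar>indicator {R.I \<omega>..} t - indicator {G.I \<omega>..} t\<bar> \<partial>?\<Omega>)
       = (\<integral>\<^sup>+\<omega>. indicator {min (R.C t) (G.C t)<..max (R.C t) (G.C t)} \<omega> * indicator {0<..<1} \<omega> \<partial>lborel)"
      apply (subst nn_integral_restrict_space)
       apply simp
      apply (intro nn_integral_cong)
      apply (auto simp: indicator_def R.pseudoinverse[symmetric] G.pseudoinverse[symmetric] min_def max_def)
      done
    also have "\<dots> = (\<integral>\<^sup>+\<omega>. indicator ({min (R.C t) (G.C t)<..max (R.C t) (G.C t)} \<inter> {0<..<1}) \<omega> \<partial>lborel)"
      by (intro nn_integral_cong) (auto simp: indicator_def)
    also have "\<dots> = emeasure lborel ({min (R.C t) (G.C t)<..max (R.C t) (G.C t)} \<inter> {0<..<1})"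
      by simp
    \<comment> \<open>Both values lie in [0, 1] and the interval is open on the left, so
      intersecting with the open unit interval removes at most the point 1.\<close>
    also have "\<dots> = emeasure lborel {min (R.C t) (G.C t)<..max (R.C t) (G.C t)}"
      using R.cdf_bounded_prob[of t] G.cdf_bounded_prob[of t] R.cdf_nonneg[of t] G.cdf_nonneg[of t]
        AE_lborel_singleton[of "1::real"]
      by (intro emeasure_eq_AE) (auto elim!: eventually_mono)
    also have "\<dots> = ennreal \<bar>cdf \<rho> t - cdf \<gamma> t\<bar>"
      by (auto simp: min_def max_def)
    finally show "(\<integral>\<^sup>+\<omega>. ennreal \<bar>indicator {R.I \<omega>..} t - indicator {G.I \<omega>..} t\<bar> \<partial>?\<Omega>) = ennreal \<bar>cdf \<rho> t - cdf \<gamma> t\<bar>" .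
  qed
  finally show ?thesis .
qed

text \<open>\<open>max 0\<close> is a measurable retraction of the line onto the half-line; it
  undoes the push-forward that is built into \<open>cdfp\<close>.\<close>

lemma distr_max0_distr_id:
  assumes "sets \<nu> = sets Rplus"
  shows "distr (distr \<nu> borel (\<lambda>x. x)) Rplus (max 0) = \<nu>"
proof -
  have m: "max 0 \<in> measurable borel Rplus" by (rule measurable_RplusI) auto
  have "distr (distr \<nu> borel (\<lambda>x. x)) Rplus (max 0) = distr \<nu> Rplus (max 0)"
    using m borel_measurable_Rplus[OF assms, of "\<lambda>x. x"] by (simp add: distr_distr comp_def)
  also have "\<dots> = distr \<nu> \<nu> (\<lambda>x. x)"
    using assms by (intro distr_cong) (auto simp: space_Rplus_cong)
  finally show ?thesis by (simp add: distr_id)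
qed

definition unit_space :: "real measure" where
  "unit_space = restrict_space lborel {0<..<1}"

lemma prob_space_unit_space: "prob_space unit_space"
  by (auto simp add: unit_space_def emeasure_restrict_space space_restrict_space intro!: prob_spaceI)

lemma quantile_coupling:
  assumes "prob_space \<rho>" "sets \<rho> = sets Rplus" "prob_space \<gamma>" "sets \<gamma> = sets Rplus"
  obtains X Y where "X \<in> measurable unit_space Rplus" "Y \<in> measurable unit_space Rplus"
    "distr unit_space Rplus X = \<rho>" "distr unit_space Rplus Y = \<gamma>"
    "(\<integral>\<^sup>+\<omega>. ennreal \<bar>X \<omega> - Y \<omega>\<bar> \<partial>unit_space) = (\<integral>\<^sup>+t. ennreal \<bar>cdfp \<rho> t - cdfp \<gamma> t\<bar> \<partial>lborel)"
proof -
  note rd = real_distribution_distr_id[OF assms(1,2)] real_distribution_distr_id[OF assms(3,4)]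
  interpret R: cdf_distribution "distr \<rho> borel (\<lambda>x. x)" using rd by (simp add: cdf_distribution_def)
  interpret G: cdf_distribution "distr \<gamma> borel (\<lambda>x. x)" using rd by (simp add: cdf_distribution_def)
  have max0: "max 0 \<in> measurable borel Rplus" by (rule measurable_RplusI) auto
  \<comment> \<open>The clipping forces values in the half-line at every point. Being 1-Lipschitz it
    cannot raise the cost, and the bound valid for all couplings shows that it does not lower it
    either.\<close>
  define X where "X \<omega> = max 0 (R.I \<omega>)" for \<omega>
  define Y where "Y \<omega> = max 0 (G.I \<omega>)" for \<omega>
  have RI: "R.I \<in> borel_measurable unit_space" and GI: "G.I \<in> borel_measurable unit_space"
    using R.measurable_I_unit G.measurable_I_unit by (auto simp: unit_space_def)
  have X: "X \<in> measurable unit_space Rplus" and Y: "Y \<in> measurable unit_space Rplus"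
    using measurable_compose[OF RI max0] measurable_compose[OF GI max0] by (auto simp: X_def[abs_def] Y_def[abs_def])
  have dX: "distr unit_space Rplus X = \<rho>"
  proof -
    have "distr unit_space Rplus X = distr (distr unit_space borel R.I) Rplus (max 0)"
      using max0 RI by (simp add: distr_distr comp_def X_def[abs_def])
    then show ?thesis using R.distr_I_eq_M distr_max0_distr_id[OF assms(2)] by (simp add: unit_space_def)
  qed
  have dY: "distr unit_space Rplus Y = \<gamma>"
  proof -
    have "distr unit_space Rplus Y = distr (distr unit_space borel G.I) Rplus (max 0)"
      using max0 GI by (simp add: distr_distr comp_def Y_def[abs_def])
    then show ?thesis using G.distr_I_eq_M distr_max0_distr_id[OF assms(4)] by (simp add: unit_space_def)
  qed
  have "(\<integral>\<^sup>+\<omega>. ennreal \<bar>X \<omega> - Y \<omega>\<bar> \<partial>unit_space) \<le> (\<integral>\<^sup>+\<omega>. ennreal \<bar>R.I \<omega> - G.I \<omega>\<bar> \<partial>unit_space)"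
    by (intro nn_integral_mono ennreal_leI) (auto simp: X_def Y_def)
  also have "\<dots> = (\<integral>\<^sup>+t. ennreal \<bar>cdfp \<rho> t - cdfp \<gamma> t\<bar> \<partial>lborel)"
    unfolding unit_space_def by (rule nn_integral_quantile_diff[OF rd])
  finally have le: "(\<integral>\<^sup>+\<omega>. ennreal \<bar>X \<omega> - Y \<omega>\<bar> \<partial>unit_space) \<le> (\<integral>\<^sup>+t. ennreal \<bar>cdfp \<rho> t - cdfp \<gamma> t\<bar> \<partial>lborel)" .
  have ge: "(\<integral>\<^sup>+t. ennreal \<bar>cdfp \<rho> t - cdfp \<gamma> t\<bar> \<partial>lborel) \<le> (\<integral>\<^sup>+\<omega>. ennreal \<bar>X \<omega> - Y \<omega>\<bar> \<partial>unit_space)"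
    using nn_integral_cdf_diff_le[OF prob_space_unit_space borel_measurable_of_Rplus[OF X] borel_measurable_of_Rplus[OF Y]]
    by (simp add: cdfp_distr[symmetric] X Y dX dY)
  show ?thesis by (rule that[OF X Y dX dY antisym[OF le ge]])
qed

text \<open>The quantile coupling attains the lower bound that holds for every coupling. Both sides
  may be infinite, so no moment assumption enters.\<close>

lemma W1_INF_eq:
  assumes "prob_space \<rho>" "sets \<rho> = sets Rplus" "prob_space \<gamma>" "sets \<gamma> = sets Rplus"
  shows "(INF \<pi> \<in> couplings \<rho> \<gamma>. \<integral>\<^sup>+p. ennreal \<bar>fst p - snd p\<bar> \<partial>\<pi>)
      = (\<integral>\<^sup>+t. ennreal \<bar>cdfp \<rho> t - cdfp \<gamma> t\<bar> \<partial>lborel)"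
proof (rule antisym)
  obtain X Y where XY: "X \<in> measurable unit_space Rplus" "Y \<in> measurable unit_space Rplus"
    "distr unit_space Rplus X = \<rho>" "distr unit_space Rplus Y = \<gamma>"
    "(\<integral>\<^sup>+\<omega>. ennreal \<bar>X \<omega> - Y \<omega>\<bar> \<partial>unit_space) = (\<integral>\<^sup>+t. ennreal \<bar>cdfp \<rho> t - cdfp \<gamma> t\<bar> \<partial>lborel)"
    using quantile_coupling[OF assms] by blast
  define \<pi> where "\<pi> = distr unit_space (Rplus \<Otimes>\<^sub>M Rplus) (\<lambda>\<omega>. (X \<omega>, Y \<omega>))"
  have mXY: "(\<lambda>\<omega>. (X \<omega>, Y \<omega>)) \<in> measurable unit_space (Rplus \<Otimes>\<^sub>M Rplus)"
    using XY by measurable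
  have fs: "fst \<in> measurable (Rplus \<Otimes>\<^sub>M Rplus) Rplus" "snd \<in> measurable (Rplus \<Otimes>\<^sub>M Rplus) Rplus"
    by simp_all
  have "\<pi> \<in> couplings \<rho> \<gamma>"
    using XY(3,4) mXY fs prob_space.prob_space_distr[OF prob_space_unit_space mXY]
    by (auto simp: couplings_def \<pi>_def space_prob_algebra distr_distr comp_def)
  moreover have "(\<integral>\<^sup>+p. ennreal \<bar>fst p - snd p\<bar> \<partial>\<pi>) = (\<integral>\<^sup>+t. ennreal \<bar>cdfp \<rho> t - cdfp \<gamma> t\<bar> \<partial>lborel)"
    unfolding \<pi>_def
    using fs[THEN borel_measurable_of_Rplus] by (subst nn_integral_distr[OF mXY]) (auto simp: XY(5))
  ultimately show "(INF \<pi> \<in> couplings \<rho> \<gamma>. \<integral>\<^sup>+p. ennreal \<bar>fst p - snd p\<bar> \<partial>\<pi>)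
      \<le> (\<integral>\<^sup>+t. ennreal \<bar>cdfp \<rho> t - cdfp \<gamma> t\<bar> \<partial>lborel)"
    by (metis (no_types, lifting) INF_lower)
next
  show "(\<integral>\<^sup>+t. ennreal \<bar>cdfp \<rho> t - cdfp \<gamma> t\<bar> \<partial>lborel)
     \<le> (INF \<pi> \<in> couplings \<rho> \<gamma>. \<integral>\<^sup>+p. ennreal \<bar>fst p - snd p\<bar> \<partial>\<pi>)"
  proof (rule INF_greatest)
    fix \<pi> assume "\<pi> \<in> couplings \<rho> \<gamma>"
    then have \<pi>: "prob_space \<pi>" "sets \<pi> = sets (Rplus \<Otimes>\<^sub>M Rplus)" 
      "distr \<pi> Rplus fst = \<rho>" "distr \<pi> Rplus snd = \<gamma>"
      by (auto simp: couplings_def space_prob_algebra)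
    have fs: "fst \<in> measurable \<pi> Rplus" "snd \<in> measurable \<pi> Rplus"
      using \<pi>(2) by (simp_all cong: measurable_cong_sets)
    show "(\<integral>\<^sup>+t. ennreal \<bar>cdfp \<rho> t - cdfp \<gamma> t\<bar> \<partial>lborel) \<le> (\<integral>\<^sup>+p. ennreal \<bar>fst p - snd p\<bar> \<partial>\<pi>)"
      using nn_integral_cdf_diff_le[OF \<pi>(1) fs[THEN borel_measurable_of_Rplus]]
      unfolding \<pi>(3,4)[symmetric] by (simp add: cdfp_distr fs)
  qed
qed

lemma distr_in_W1_space:
  assumes "prob_space M" "X \<in> measurable M Rplus" "integrable M X"
  shows "distr M Rplus X \<in> W1_space"
proof (rule W1_spaceI)
  show "prob_space (distr M Rplus X)" using assms by (simp add: prob_space.prob_space_distr)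
  show "integrable (distr M Rplus X) (\<lambda>x. x)"
    using assms by (subst integrable_distr_eq) (auto intro: borel_measurable_Rplus[OF refl])
qed simp

text \<open>Both laws are compared with the Dirac measure at 0, whose distribution function is
  \<open>indicator {0..}\<close>; the distance to it is at most the first moment.\<close>

lemma nn_integral_cdfp_diff_finite:
  assumes "\<rho> \<in> W1_space" "\<gamma> \<in> W1_space"
  shows "(\<integral>\<^sup>+t. ennreal \<bar>cdfp \<rho> t - cdfp \<gamma> t\<bar> \<partial>lborel) < \<infinity>"
proof -
  have fin: "(\<integral>\<^sup>+t. ennreal \<bar>cdfp \<nu> t - indicator {0..} t\<bar> \<partial>lborel) < \<infinity>"
    and meas: "cdfp \<nu> \<in> borel_measurable borel" if \<nu>: "\<nu> \<in> W1_space" for \<nu>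
  proof -
    note D = W1_spaceD[OF \<nu>]
    have m: "(\<lambda>x. x) \<in> borel_measurable \<nu>" using borel_measurable_Rplus[OF D(1), of "\<lambda>x. x"] by simp
    interpret N: prob_space \<nu> by fact
    interpret N': cdf_distribution "distr \<nu> borel (\<lambda>x. x)"
      using real_distribution_distr_id[OF D(3,1)] by (simp add: cdf_distribution_def)
    show "cdfp \<nu> \<in> borel_measurable borel" by (rule N'.measurable_C)
    have "(\<integral>\<^sup>+t. ennreal \<bar>cdfp \<nu> t - indicator {0..} t\<bar> \<partial>lborel)
        = (\<integral>\<^sup>+t. ennreal \<bar>cdfp \<nu> t - cdf (distr \<nu> borel (\<lambda>_. 0)) t\<bar> \<partial>lborel)"
      by (subst cdf_distr_eq_expectation[OF D(3)]) (simp_all add: N.prob_space)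
    also have "\<dots> \<le> (\<integral>\<^sup>+x. ennreal \<bar>x - 0\<bar> \<partial>\<nu>)"
      by (rule nn_integral_cdf_diff_le[OF D(3) m]) simp
    also have "\<dots> < \<infinity>"
      using D(4) by (simp add: integrable_iff_bounded)
    finally show "(\<integral>\<^sup>+t. ennreal \<bar>cdfp \<nu> t - indicator {0..} t\<bar> \<partial>lborel) < \<infinity>" .
  qed
  note [measurable] = meas[OF assms(1)] meas[OF assms(2)]
  have "(\<integral>\<^sup>+t. ennreal \<bar>cdfp \<rho> t - cdfp \<gamma> t\<bar> \<partial>lborel)
      \<le> (\<integral>\<^sup>+t. ennreal \<bar>cdfp \<rho> t - indicator {0..} t\<bar> + ennreal \<bar>cdfp \<gamma> t - indicator {0..} t\<bar> \<partial>lborel)"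
    by (intro nn_integral_mono) (auto simp: ennreal_plus[symmetric] simp del: ennreal_plus intro!: ennreal_leI)
  also have "\<dots> = (\<integral>\<^sup>+t. ennreal \<bar>cdfp \<rho> t - indicator {0..} t\<bar> \<partial>lborel)
       + (\<integral>\<^sup>+t. ennreal \<bar>cdfp \<gamma> t - indicator {0..} t\<bar> \<partial>lborel)"
    by (intro nn_integral_add) measurable
  also have "\<dots> < \<infinity>" using fin assms by simp
  finally show ?thesis .
qed

lemma ennreal_W1_dist:
  assumes "\<rho> \<in> W1_space" "\<gamma> \<in> W1_space"
  shows "ennreal (W1_dist \<rho> \<gamma>) = (\<integral>\<^sup>+t. ennreal \<bar>cdfp \<rho> t - cdfp \<gamma> t\<bar> \<partial>lborel)"
  unfolding W1_dist_def
  using W1_INF_eq[of \<rho> \<gamma>] W1_spaceD[OF assms(1)] W1_spaceD[OF assms(2)] nn_integral_cdfp_diff_finite[OF assms]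
  by simp

lemma optimal_coupling:
  assumes "\<rho> \<in> W1_space" "\<gamma> \<in> W1_space"
  obtains X Y where "X \<in> measurable unit_space Rplus" "Y \<in> measurable unit_space Rplus"
    "distr unit_space Rplus X = \<rho>" "distr unit_space Rplus Y = \<gamma>"
    "integrable unit_space X" "integrable unit_space Y"
    "W1_dist \<rho> \<gamma> = (\<integral>\<omega>. \<bar>X \<omega> - Y \<omega>\<bar> \<partial>unit_space)"
proof -
  note R = W1_spaceD[OF assms(1)] and G = W1_spaceD[OF assms(2)]
  obtain X Y where XY: "X \<in> measurable unit_space Rplus" "Y \<in> measurable unit_space Rplus"
    "distr unit_space Rplus X = \<rho>" "distr unit_space Rplus Y = \<gamma>"
    "(\<integral>\<^sup>+\<omega>. ennreal \<bar>X \<omega> - Y \<omega>\<bar> \<partial>unit_space) = (\<integral>\<^sup>+t. ennreal \<bar>cdfp \<rho> t - cdfp \<gamma> t\<bar> \<partial>lborel)"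
    using quantile_coupling[OF R(3,1) G(3,1)] by blast
  have id: "(\<lambda>x::real. x) \<in> borel_measurable Rplus" by (rule borel_measurable_Rplus) auto
  have iX: "integrable unit_space X" "integrable unit_space Y"
    using R(4) G(4) integrable_distr_eq[OF XY(1) id] integrable_distr_eq[OF XY(2) id] XY(3,4) by auto
  have "W1_dist \<rho> \<gamma> = (\<integral>\<omega>. \<bar>X \<omega> - Y \<omega>\<bar> \<partial>unit_space)"
  proof -
    have "ennreal (W1_dist \<rho> \<gamma>) = ennreal (\<integral>\<omega>. \<bar>X \<omega> - Y \<omega>\<bar> \<partial>unit_space)"
      using XY(5) iX by (subst nn_integral_eq_integral[symmetric]) (auto simp: ennreal_W1_dist[OF assms])
    then show ?thesis by (simp add: W1_dist_def)
  qed
  with that XY iX show ?thesis by blast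
qed

lemma W1_dist_distr_le:
  assumes M: "prob_space M" and X: "X \<in> measurable M Rplus" "integrable M X"
    and Y: "Y \<in> measurable M Rplus" "integrable M Y"
  shows "W1_dist (distr M Rplus X) (distr M Rplus Y) \<le> (\<integral>\<omega>. \<bar>X \<omega> - Y \<omega>\<bar> \<partial>M)"
proof -
  have "ennreal (W1_dist (distr M Rplus X) (distr M Rplus Y)) \<le> (\<integral>\<^sup>+\<omega>. ennreal \<bar>X \<omega> - Y \<omega>\<bar> \<partial>M)"
    using nn_integral_cdf_diff_le[OF M X(1)[THEN borel_measurable_of_Rplus] Y(1)[THEN borel_measurable_of_Rplus]]
    by (simp add: ennreal_W1_dist distr_in_W1_space assms cdfp_distr)
  also have "\<dots> = ennreal (\<integral>\<omega>. \<bar>X \<omega> - Y \<omega>\<bar> \<partial>M)"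
    using assms by (intro nn_integral_eq_integral) auto
  finally show ?thesis by (simp add: W1_dist_def)
qed

lemma AE_lborel_imp_ex_right:
  assumes "AE t in lborel. P (t::real)" "a < b"
  shows "\<exists>t. a < t \<and> t < b \<and> P t"
proof (rule ccontr)
  assume "\<not> ?thesis"
  then have "AE t in lborel. t \<notin> {a<..<b}"
    using assms(1) by (auto elim!: eventually_mono)
  moreover have "{t \<in> space lborel. t \<in> {a<..<b}} = {a<..<b}" by auto
  ultimately have "emeasure lborel {a<..<b} = 0"
    using emeasure_eq_0_AE[of "\<lambda>t. t \<in> {a<..<b}" lborel] by simp
  then show False using \<open>a < b\<close> by simp
qed

text \<open>A disagreement at x would persist on an interval to the right of x, which has positive
  length. This gives the definiteness of the metric.\<close>

lemma right_continuous_AE_eq: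
  fixes f g :: "real \<Rightarrow> real"
  assumes "\<And>x. continuous (at_right x) f" "\<And>x. continuous (at_right x) g"
    and "AE t in lborel. f t = g t"
  shows "f = g"
proof
  fix x
  have "((\<lambda>t. f t - g t) \<longlongrightarrow> f x - g x) (at_right x)"
    using assms(1,2)[of x] by (intro tendsto_diff) (auto simp: continuous_within)
  then have *: "eventually (\<lambda>t. f t - g t \<in> S) (at_right x)" if "open S" "f x - g x \<in> S" for S
    using that by (auto simp: tendsto_def)
  show "f x = g x"
  proof (rule ccontr)
    assume "f x \<noteq> g x"
    then have "eventually (\<lambda>t. f t - g t \<in> - {0}) (at_right x)" by (intro *) auto
    then obtain b where "x < b" "\<And>t. x < t \<Longrightarrow> t < b \<Longrightarrow> f t \<noteq> g t"
      unfolding eventually_at_right_field by auto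
    with AE_lborel_imp_ex_right[OF assms(3)] show False by blast
  qed
qed

lemma W1_dist_nonneg: "0 \<le> W1_dist \<rho> \<gamma>"
  by (simp add: W1_dist_def)

text \<open>The metric space axioms ask for symmetry without membership in the carrier, where the
  L^1 formula is not at hand; couplings are swapped instead.\<close>

lemma W1_dist_commute: "W1_dist \<rho> \<gamma> = W1_dist \<gamma> \<rho>"
proof -
  have *: "(INF \<pi> \<in> couplings \<rho> \<gamma>. \<integral>\<^sup>+p. ennreal \<bar>fst p - snd p\<bar> \<partial>\<pi>)
     \<le> (INF \<pi> \<in> couplings \<gamma> \<rho>. \<integral>\<^sup>+p. ennreal \<bar>fst p - snd p\<bar> \<partial>\<pi>)" for \<rho> \<gamma>
  proof (rule INF_greatest)
    fix \<pi> assume "\<pi> \<in> couplings \<gamma> \<rho>"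
    then have \<pi>: "prob_space \<pi>" "sets \<pi> = sets (Rplus \<Otimes>\<^sub>M Rplus)" 
      "distr \<pi> Rplus fst = \<gamma>" "distr \<pi> Rplus snd = \<rho>"
      by (auto simp: couplings_def space_prob_algebra)
    define \<pi>' where "\<pi>' = distr \<pi> (Rplus \<Otimes>\<^sub>M Rplus) (\<lambda>p. (snd p, fst p))"
    have fs0: "fst \<in> measurable (Rplus \<Otimes>\<^sub>M Rplus) Rplus" "snd \<in> measurable (Rplus \<Otimes>\<^sub>M Rplus) Rplus"
      by simp_all
    then have fs: "fst \<in> measurable \<pi> Rplus" "snd \<in> measurable \<pi> Rplus"
      using \<pi>(2) by (simp_all cong: measurable_cong_sets)
    then have m: "(\<lambda>p. (snd p, fst p)) \<in> measurable \<pi> (Rplus \<Otimes>\<^sub>M Rplus)" by measurable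
    have "\<pi>' \<in> couplings \<rho> \<gamma>"
      using \<pi>(3,4) m fs0 prob_space.prob_space_distr[OF \<pi>(1) m]
      by (auto simp: couplings_def \<pi>'_def space_prob_algebra distr_distr comp_def)
    moreover have "(\<integral>\<^sup>+p. ennreal \<bar>fst p - snd p\<bar> \<partial>\<pi>') = (\<integral>\<^sup>+p. ennreal \<bar>fst p - snd p\<bar> \<partial>\<pi>)"
      unfolding \<pi>'_def using fs0[THEN borel_measurable_of_Rplus]
      by (subst nn_integral_distr[OF m]) (auto simp: abs_minus_commute)
    ultimately show "(INF \<pi> \<in> couplings \<rho> \<gamma>. \<integral>\<^sup>+p. ennreal \<bar>fst p - snd p\<bar> \<partial>\<pi>)
       \<le> (\<integral>\<^sup>+p. ennreal \<bar>fst p - snd p\<bar> \<partial>\<pi>)"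
      by (metis (no_types, lifting) INF_lower)
  qed
  show ?thesis unfolding W1_dist_def by (intro arg_cong[where f=enn2real] antisym *)
qed

lemma measurable_cdfp: "\<nu> \<in> W1_space \<Longrightarrow> cdfp \<nu> \<in> borel_measurable borel"
  by (intro cdf_distribution.measurable_C cdf_distribution.intro real_distribution_distr_id W1_spaceD)

text \<open>Through the L^1 formula the triangle inequality is that of the absolute value under the
  integral, so no couplings have to be glued.\<close>

lemma Metric_space_W1: "Metric_space W1_space W1_dist"
proof
  show "0 \<le> W1_dist x y" for x y by (simp add: W1_dist_def)
  show "W1_dist x y = W1_dist y x" for x y by (rule W1_dist_commute)
next
  fix x y assume xy: "x \<in> W1_space" "y \<in> W1_space"
  note [measurable] = measurable_cdfp[OF xy(1)] measurable_cdfp[OF xy(2)]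
  note D = W1_spaceD[OF xy(1)] W1_spaceD[OF xy(2)]
  interpret X: real_distribution "distr x borel (\<lambda>x. x)" by (intro real_distribution_distr_id D)
  interpret Y: real_distribution "distr y borel (\<lambda>x. x)" by (intro real_distribution_distr_id D)
  show "W1_dist x y = 0 \<longleftrightarrow> x = y"
  proof
    assume "W1_dist x y = 0"
    then have "(\<integral>\<^sup>+t. ennreal \<bar>cdfp x t - cdfp y t\<bar> \<partial>lborel) = 0"
      using ennreal_W1_dist[OF xy] by simp
    then have "AE t in lborel. cdfp x t = cdfp y t"
      by (subst (asm) nn_integral_0_iff_AE) auto
    then have "cdfp x = cdfp y"
      by (intro right_continuous_AE_eq X.cdf_is_right_cont Y.cdf_is_right_cont)
    then have "distr x borel (\<lambda>x. x) = distr y borel (\<lambda>x. x)"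
      by (intro cdf_unique X.real_distribution_axioms Y.real_distribution_axioms)
    then show "x = y"
      using distr_max0_distr_id[OF D(1)] distr_max0_distr_id[OF D(5)] by metis
  next
    assume "x = y"
    then have "ennreal (W1_dist x y) = 0" using ennreal_W1_dist[OF xy] by simp
    then show "W1_dist x y = 0" by (simp add: W1_dist_def)
  qed
next
  fix x y z assume W: "x \<in> W1_space" "y \<in> W1_space" "z \<in> W1_space"
  note [measurable] = W[THEN measurable_cdfp]
  have "ennreal (W1_dist x z) \<le> (\<integral>\<^sup>+t. ennreal \<bar>cdfp x t - cdfp y t\<bar> + ennreal \<bar>cdfp y t - cdfp z t\<bar> \<partial>lborel)"
    unfolding ennreal_W1_dist[OF W(1,3)]
    by (intro nn_integral_mono) (auto simp: ennreal_plus[symmetric] simp del: ennreal_plus intro!: ennreal_leI)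
  also have "\<dots> = ennreal (W1_dist x y + W1_dist y z)"
    by (subst nn_integral_add)
       (simp_all add: ennreal_W1_dist[OF W(1,2), symmetric] ennreal_W1_dist[OF W(2,3), symmetric] W1_dist_nonneg)
  finally show "W1_dist x z \<le> W1_dist x y + W1_dist y z"
    by (subst (asm) ennreal_le_iff) (auto intro: add_nonneg_nonneg W1_dist_nonneg)
qed

text \<open>This is the elementary half of Kantorovich-Rubinstein duality, read off from an optimal
  coupling. It makes integrals of Lipschitz functions continuous in the law.\<close>

lemma integral_Lipschitz_diff_le:
  assumes "\<rho> \<in> W1_space" "\<gamma> \<in> W1_space" and g: "g \<in> borel_measurable borel"
    and L: "\<And>x y. 0 \<le> x \<Longrightarrow> 0 \<le> y \<Longrightarrow> \<bar>g x - g y\<bar> \<le> L * \<bar>x - y\<bar>"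
    and int: "integrable \<rho> g" "integrable \<gamma> g"
  shows "\<bar>(\<integral>x. g x \<partial>\<rho>) - (\<integral>x. g x \<partial>\<gamma>)\<bar> \<le> L * W1_dist \<rho> \<gamma>"
proof -
  obtain X Y where XY: "X \<in> measurable unit_space Rplus" "Y \<in> measurable unit_space Rplus"
    "distr unit_space Rplus X = \<rho>" "distr unit_space Rplus Y = \<gamma>"
    "integrable unit_space X" "integrable unit_space Y"
    "W1_dist \<rho> \<gamma> = (\<integral>\<omega>. \<bar>X \<omega> - Y \<omega>\<bar> \<partial>unit_space)"
    using optimal_coupling[OF assms(1,2)] by blast
  have g': "g \<in> borel_measurable Rplus" using g by (rule borel_measurable_Rplus[OF refl])
  have nn: "0 \<le> X \<omega>" "0 \<le> Y \<omega>" if "\<omega> \<in> space unit_space" for \<omega>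
    using measurable_space[OF XY(1) that] measurable_space[OF XY(2) that] by (auto simp: space_restrict_space)
  have i: "integrable unit_space (\<lambda>\<omega>. g (X \<omega>))" "integrable unit_space (\<lambda>\<omega>. g (Y \<omega>))"
    using int integrable_distr_eq[OF XY(1) g'] integrable_distr_eq[OF XY(2) g'] XY(3,4) by auto
  have "(\<integral>x. g x \<partial>\<rho>) - (\<integral>x. g x \<partial>\<gamma>) = (\<integral>\<omega>. g (X \<omega>) - g (Y \<omega>) \<partial>unit_space)"
    using i integral_distr[OF XY(1) g'] integral_distr[OF XY(2) g'] XY(3,4) by simp
  also have "\<bar>\<dots>\<bar> \<le> (\<integral>\<omega>. \<bar>g (X \<omega>) - g (Y \<omega>)\<bar> \<partial>unit_space)"
    by (rule integral_abs_bound)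
  also have "\<dots> \<le> (\<integral>\<omega>. L * \<bar>X \<omega> - Y \<omega>\<bar> \<partial>unit_space)"
    using i XY nn L by (intro integral_mono) auto
  finally show ?thesis using XY by simp
qed

section \<open>Mean, scaling and normalization of laws\<close>

abbreviation mean :: "real measure \<Rightarrow> real" where
  "mean \<nu> \<equiv> (\<integral>x. x \<partial>\<nu>)"

lemma mean_diff_le:
  assumes "\<rho> \<in> W1_space" "\<gamma> \<in> W1_space"
  shows "\<bar>mean \<rho> - mean \<gamma>\<bar> \<le> W1_dist \<rho> \<gamma>"
  using integral_Lipschitz_diff_le[OF assms, of "\<lambda>x. x" 1, OF _ _
      W1_spaceD(4)[OF assms(1)] W1_spaceD(4)[OF assms(2)]] by simp

lemma measurable_scale: 
  assumes "m > 0"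
  shows "(\<lambda>x::real. x / m) \<in> measurable Rplus Rplus"
  by (rule measurable_RplusI, rule borel_measurable_Rplus) (use assms in \<open>auto simp: space_restrict_space\<close>)

lemma measurable_cong_Rplus:
  "sets \<nu> = sets Rplus \<Longrightarrow> f \<in> measurable Rplus N \<Longrightarrow> f \<in> measurable \<nu> N"
  by (simp cong: measurable_cong_sets)

lemma G_scale_in_W1_space:
  assumes "\<nu> \<in> W1_space" "m > 0"
  shows "G_scale \<nu> m \<in> W1_space"
  unfolding G_scale_def using W1_spaceD[OF assms(1)] assms(2)
  by (intro distr_in_W1_space) (auto intro: measurable_cong_Rplus measurable_scale)

lemma integral_G_scale:
  fixes g :: "real \<Rightarrow> real"
  assumes "sets \<nu> = sets Rplus" "m > 0" "g \<in> borel_measurable borel"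
  shows "(\<integral>x. g x \<partial>G_scale \<nu> m) = (\<integral>x. g (x / m) \<partial>\<nu>)"
  unfolding G_scale_def
  by (rule integral_distr[OF measurable_cong_Rplus[OF assms(1) measurable_scale[OF assms(2)]]
      borel_measurable_Rplus[OF refl assms(3)]])

lemma mean_G_scale:
  assumes "\<nu> \<in> W1_space" "m > 0"
  shows "mean (G_scale \<nu> m) = mean \<nu> / m"
  using integral_G_scale[of \<nu> m "\<lambda>x. x"] W1_spaceD(1)[OF assms(1)] assms(2) by simp

lemma G_scale_G_scale:
  assumes "sets \<nu> = sets Rplus" "a > 0" "b > 0"
  shows "G_scale (G_scale \<nu> a) b = G_scale \<nu> (a * b)"
  unfolding G_scale_def
  by (subst distr_distr) (use assms in \<open>auto simp: comp_def intro: measurable_cong_Rplus measurable_scale\<close>)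

lemma G_scale_1:
  assumes "sets \<nu> = sets Rplus"
  shows "G_scale \<nu> 1 = \<nu>"
proof -
  have "G_scale \<nu> 1 = distr \<nu> \<nu> (\<lambda>x. x)" unfolding G_scale_def using assms by (intro distr_cong) auto
  then show ?thesis by (simp add: distr_id)
qed

text \<open>Under an optimal coupling, X / a - Y / b splits into (X - Y) / a and (1 / a - 1 / b) *
  Y, which account for the two terms.\<close>

lemma W1_dist_G_scale_le:
  assumes "\<rho> \<in> W1_space" "\<gamma> \<in> W1_space" "a > 0" "b > 0"
  shows "W1_dist (G_scale \<rho> a) (G_scale \<gamma> b) \<le> W1_dist \<rho> \<gamma> / a + \<bar>1 / a - 1 / b\<bar> * mean \<gamma>"
proof -
  obtain X Y where XY: "X \<in> measurable unit_space Rplus" "Y \<in> measurable unit_space Rplus"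
    "distr unit_space Rplus X = \<rho>" "distr unit_space Rplus Y = \<gamma>"
    "integrable unit_space X" "integrable unit_space Y"
    "W1_dist \<rho> \<gamma> = (\<integral>\<omega>. \<bar>X \<omega> - Y \<omega>\<bar> \<partial>unit_space)"
    using optimal_coupling[OF assms(1,2)] by blast
  have m: "(\<lambda>\<omega>. X \<omega> / a) \<in> measurable unit_space Rplus" "(\<lambda>\<omega>. Y \<omega> / b) \<in> measurable unit_space Rplus"
    using measurable_compose[OF XY(1) measurable_scale[OF assms(3)]]
      measurable_compose[OF XY(2) measurable_scale[OF assms(4)]] by auto
  have d: "G_scale \<rho> a = distr unit_space Rplus (\<lambda>\<omega>. X \<omega> / a)"
     "G_scale \<gamma> b = distr unit_space Rplus (\<lambda>\<omega>. Y \<omega> / b)"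
    unfolding G_scale_def XY(3,4)[symmetric] using XY(1,2) assms measurable_scale
    by (simp_all add: distr_distr comp_def)
  have nn: "0 \<le> Y \<omega>" if "\<omega> \<in> space unit_space" for \<omega>
    using measurable_space[OF XY(2) that] by (auto simp: space_restrict_space)
  have "W1_dist (G_scale \<rho> a) (G_scale \<gamma> b) \<le> (\<integral>\<omega>. \<bar>X \<omega> / a - Y \<omega> / b\<bar> \<partial>unit_space)"
    unfolding d using m XY by (intro W1_dist_distr_le prob_space_unit_space) auto
  also have "\<dots> \<le> (\<integral>\<omega>. \<bar>X \<omega> - Y \<omega>\<bar> / a + \<bar>1 / a - 1 / b\<bar> * Y \<omega> \<partial>unit_space)"
  proof (intro integral_mono)
    fix \<omega> assume "\<omega> \<in> space unit_space"
    then have "0 \<le> Y \<omega>" by (rule nn)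
    have "X \<omega> / a - Y \<omega> / b = (X \<omega> - Y \<omega>) / a + (1 / a - 1 / b) * Y \<omega>"
      by (simp add: algebra_simps diff_divide_distrib)
    also have "\<bar>\<dots>\<bar> \<le> \<bar>(X \<omega> - Y \<omega>) / a\<bar> + \<bar>(1 / a - 1 / b) * Y \<omega>\<bar>" by (rule abs_triangle_ineq)
    finally show "\<bar>X \<omega> / a - Y \<omega> / b\<bar> \<le> \<bar>X \<omega> - Y \<omega>\<bar> / a + \<bar>1 / a - 1 / b\<bar> * Y \<omega>"
      using \<open>a > 0\<close> \<open>0 \<le> Y \<omega>\<close> by (simp add: abs_mult)
  qed (use XY in auto)
  also have "\<dots> = W1_dist \<rho> \<gamma> / a + \<bar>1 / a - 1 / b\<bar> * mean \<gamma>"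
  proof -
    have "mean \<gamma> = (\<integral>\<omega>. Y \<omega> \<partial>unit_space)"
      unfolding XY(4)[symmetric]
      by (rule integral_distr[OF XY(2)], rule borel_measurable_Rplus[OF refl]) simp
    then show ?thesis using XY(5-7) by simp
  qed
  finally show ?thesis .
qed

definition normalize_law :: "real measure \<Rightarrow> real measure" where
  "normalize_law \<nu> = G_scale \<nu> (mean \<nu>)"

lemma normalize_law_in_M11:
  assumes "\<nu> \<in> W1_space" "mean \<nu> > 0"
  shows "normalize_law \<nu> \<in> M11"
  using assms by (auto simp: M11_def normalize_law_def G_scale_in_W1_space mean_G_scale)

lemma G_scale_normalize_law:
  assumes "\<nu> \<in> W1_space" "mean \<nu> > 0"
  shows "G_scale (normalize_law \<nu>) (1 / mean \<nu>) = \<nu>"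
  using assms W1_spaceD(1)[OF assms(1)] by (simp add: normalize_law_def G_scale_G_scale G_scale_1)

text \<open>Together with \<open>G_scale_normalize_law\<close> this identifies the fibre of
  normalization over \<rho> with the scaled copies of \<rho>, which is why \<open>rate_W\<close>
  takes an infimum over scales.\<close>

lemma normalize_law_G_scale:
  assumes "\<rho> \<in> M11" "m > 0"
  shows "normalize_law (G_scale \<rho> (1 / m)) = \<rho>"
proof -
  have \<rho>: "\<rho> \<in> W1_space" "mean \<rho> = 1" using assms by (auto simp: M11_def)
  have "mean (G_scale \<rho> (1 / m)) = m"
    using mean_G_scale[OF \<rho>(1), of "1 / m"] assms(2) \<rho>(2) by simp
  then show ?thesis
    using G_scale_G_scale[OF W1_spaceD(1)[OF \<rho>(1)], of "1 / m" m] G_scale_1[OF W1_spaceD(1)[OF \<rho>(1)]] assms(2)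
    by (simp add: normalize_law_def)
qed

text \<open>One copy of the distance comes from transport, the other from the change of the mean.
  Only the mean of the first law appears in the denominator, so along a sequence a lower bound on
  its means suffices.\<close>

lemma W1_dist_normalize_law_le:
  assumes "\<rho> \<in> W1_space" "\<gamma> \<in> W1_space" "mean \<rho> > 0" "mean \<gamma> > 0"
  shows "W1_dist (normalize_law \<rho>) (normalize_law \<gamma>) \<le> 2 * W1_dist \<rho> \<gamma> / mean \<rho>"
proof -
  have "\<bar>1 / mean \<rho> - 1 / mean \<gamma>\<bar> * mean \<gamma> = \<bar>(1 / mean \<rho> - 1 / mean \<gamma>) * mean \<gamma>\<bar>"
    using assms(4) by (simp add: abs_mult)
  also have "(1 / mean \<rho> - 1 / mean \<gamma>) * mean \<gamma> = (mean \<gamma> - mean \<rho>) / mean \<rho>"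
    using assms(3,4) by (simp add: field_simps)
  also have "\<bar>\<dots>\<bar> = \<bar>mean \<rho> - mean \<gamma>\<bar> / mean \<rho>"
    using assms(3) by (simp add: abs_minus_commute)
  also have "\<dots> \<le> W1_dist \<rho> \<gamma> / mean \<rho>"
    using mean_diff_le[OF assms(1,2)] assms(3) by (simp add: divide_right_mono)
  finally show ?thesis
    using W1_dist_G_scale_le[OF assms] by (simp add: normalize_law_def)
qed

interpretation W1: Metric_space W1_space W1_dist
  by (rule Metric_space_W1)

lemma M11_subset: "M11 \<subseteq> W1_space"
  by (auto simp: M11_def)

interpretation M11: Metric_space M11 W1_dist
  by (rule W1.subspace[OF M11_subset])

section \<open>The variational formula for relative entropy\<close>

lemma density_pos_AE:
  fixes F :: "'a \<Rightarrow> real"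
  assumes "F \<in> borel_measurable Q" "\<And>x. 0 \<le> F x"
  shows "AE x in density Q (\<lambda>x. ennreal (F x)). 0 < F x"
  using assms by (subst AE_density) (auto simp: less_le)

text \<open>This is the Donsker-Varadhan inequality. With y = g - ln F - ln Z, the integral of exp y
  under P is at most 1, and y + 1 \<le> exp y gives the claim. An upper bound Z replaces the exact
  integral so that convenient constants can be inserted later.\<close>

lemma variational_entropy_le:
  fixes F g :: "'a \<Rightarrow> real"
  assumes F: "F \<in> borel_measurable Q" "\<And>x. 0 \<le> F x"
    and P: "P = density Q (\<lambda>x. ennreal (F x))" "prob_space P"
    and int: "integrable P (\<lambda>x. ln (F x))" "integrable P g" and g: "g \<in> borel_measurable Q"
    and Z: "(\<integral>\<^sup>+x. ennreal (exp (g x)) \<partial>Q) \<le> ennreal Z" "0 < Z"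
  shows "(\<integral>x. g x \<partial>P) \<le> (\<integral>x. ln (F x) \<partial>P) + ln Z"
proof -
  interpret P: prob_space P by fact
  define y where "y x = g x - ln (F x) - ln Z" for x
  have iy: "integrable P y" unfolding y_def[abs_def] using int by auto
  have my: "y \<in> borel_measurable Q" unfolding y_def[abs_def] using F g by measurable
  have "(\<integral>\<^sup>+x. ennreal (exp (y x)) \<partial>P) = (\<integral>\<^sup>+x. ennreal (F x) * ennreal (exp (y x)) \<partial>Q)"
    unfolding P(1) using F my by (subst nn_integral_density) auto
  also have "\<dots> \<le> (\<integral>\<^sup>+x. ennreal (1 / Z) * ennreal (exp (g x)) \<partial>Q)"
  proof (intro nn_integral_mono)
    fix x
    have "F x * exp (y x) \<le> 1 / Z * exp (g x)"
    \<comment> \<open>Where the density vanishes the left side is 0 whatever value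
      \<open>ln 0\<close> takes; this set is also why only an inequality holds.\<close>
    proof (cases "F x = 0")
      case False
      then have "0 < F x" using F(2)[of x] by simp
      then have "exp (y x) = exp (g x) / F x / Z" using Z(2) by (simp add: y_def exp_diff)
      then show ?thesis using \<open>0 < F x\<close> by simp
    qed (use Z(2) in simp)
    then show "ennreal (F x) * ennreal (exp (y x)) \<le> ennreal (1 / Z) * ennreal (exp (g x))"
      using F(2)[of x] Z(2) by (simp add: ennreal_mult'[symmetric] ennreal_leI)
  qed
  also have "\<dots> = ennreal (1 / Z) * (\<integral>\<^sup>+x. ennreal (exp (g x)) \<partial>Q)"
    using g by (intro nn_integral_cmult) auto
  also have "\<dots> \<le> ennreal (1 / Z) * ennreal Z" using Z by (intro mult_left_mono) auto
  also have "\<dots> = 1" using Z(2) by (simp add: ennreal_mult'[symmetric])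
  finally have le1: "(\<integral>\<^sup>+x. ennreal (exp (y x)) \<partial>P) \<le> 1" .
  have my': "y \<in> borel_measurable P" using iy by auto
  have ie: "integrable P (\<lambda>x. exp (y x))"
    using le1 my' by (intro integrableI_nonneg) (auto simp: less_top[symmetric] top_unique)
  have "(\<integral>x. y x + 1 \<partial>P) \<le> (\<integral>x. exp (y x) \<partial>P)"
    using iy ie by (intro integral_mono) (auto simp: add.commute)
  also have "\<dots> \<le> 1"
    using le1 ie by (subst (asm) nn_integral_eq_integral) auto
  finally have "(\<integral>x. y x \<partial>P) \<le> 0" using iy by (simp add: P.prob_space)
  also have "(\<integral>x. y x \<partial>P) = (\<integral>x. g x \<partial>P) - (\<integral>x. ln (F x) \<partial>P) - ln Z"
    unfolding y_def[abs_def] using int by (simp add: P.prob_space)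
  finally show ?thesis by simp
qed

text \<open>From ln (1 / F) \<le> 1 / F - 1 one gets - F ln F \<le> 1 - F \<le> 1. The negative part
  of the entropy integrand is thus always integrable.\<close>

lemma nn_integral_neg_ln_density_le:
  fixes F :: "'a \<Rightarrow> real"
  assumes "prob_space Q" "F \<in> borel_measurable Q" "\<And>x. 0 \<le> F x"
  shows "(\<integral>\<^sup>+x. ennreal (- ln (F x)) \<partial>density Q (\<lambda>x. ennreal (F x))) \<le> 1"
proof -
  have "(\<integral>\<^sup>+x. ennreal (- ln (F x)) \<partial>density Q (\<lambda>x. ennreal (F x)))
      = (\<integral>\<^sup>+x. ennreal (F x) * ennreal (- ln (F x)) \<partial>Q)"
    using assms by (subst nn_integral_density) auto
  also have "\<dots> \<le> (\<integral>\<^sup>+x. 1 \<partial>Q)"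
  proof (intro nn_integral_mono)
    fix x
    have "F x * (- ln (F x)) \<le> 1"
    proof (cases "F x = 0")
      case False
      then have p: "0 < F x" using assms(3)[of x] by simp
      have "- ln (F x) \<le> 1 / F x - 1"
        using ln_le_minus_one[of "1 / F x"] p by (simp add: ln_div)
      then have "F x * (- ln (F x)) \<le> F x * (1 / F x - 1)" using p by (intro mult_left_mono) auto
      then show ?thesis using p by (simp add: algebra_simps)
    qed simp
    then show "ennreal (F x) * ennreal (- ln (F x)) \<le> 1"
      using assms(3)[of x] by (simp add: ennreal_mult'[symmetric] ennreal_le_1)
  qed
  also have "\<dots> = 1" using prob_space.emeasure_space_1[OF assms(1)] by simp
  finally show ?thesis .
qed

lemma RN_deriv_density_real:
  assumes "prob_space \<nu>" "prob_space \<xi>" "sets \<nu> = sets \<xi>" "absolutely_continuous \<xi> \<nu>"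
  shows "\<nu> = density \<xi> (\<lambda>x. ennreal (enn2real (RN_deriv \<xi> \<nu> x)))"
proof -
  interpret X: prob_space \<xi> by fact
  interpret N: prob_space \<nu> by fact
  have "\<nu> = density \<xi> (RN_deriv \<xi> \<nu>)"
    using X.density_RN_deriv[OF assms(4,3)] by simp
  also have "\<dots> = density \<xi> (\<lambda>x. ennreal (enn2real (RN_deriv \<xi> \<nu> x)))"
    using X.RN_deriv_finite[OF N.sigma_finite_measure_axioms assms(4,3)]
    by (intro density_cong) (auto elim!: eventually_mono simp: less_top)
  finally show ?thesis .
qed

text \<open>The negative part of the log-density is controlled anyway, so finite entropy forces its
  positive part to be integrable too. This replaces the extended-real entropy by an ordinary
  integral.\<close>

lemma rel_entropy_finite_density:
  assumes \<nu>: "prob_space \<nu>" and \<xi>: "prob_space \<xi>" and s: "sets \<nu> = sets \<xi>"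
    and fin: "rel_entropy \<nu> \<xi> \<noteq> \<infinity>"
  obtains F :: "'a \<Rightarrow> real" where "F \<in> borel_measurable \<xi>" "\<And>x. 0 \<le> F x"
    "\<nu> = density \<xi> (\<lambda>x. ennreal (F x))" "integrable \<nu> (\<lambda>x. ln (F x))"
    "rel_entropy \<nu> \<xi> = ereal (\<integral>x. ln (F x) \<partial>\<nu>)"
proof -
  define F where "F x = enn2real (RN_deriv \<xi> \<nu> x)" for x
  have ac: "absolutely_continuous \<xi> \<nu>" using fin by (auto simp: rel_entropy_def split: if_splits)
  have F: "F \<in> borel_measurable \<xi>" "\<And>x. 0 \<le> F x" unfolding F_def[abs_def] by auto
  have d: "\<nu> = density \<xi> (\<lambda>x. ennreal (F x))"
    using RN_deriv_density_real[OF \<nu> \<xi> s ac] by (simp add: F_def)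
  have mln: "(\<lambda>x. ln (F x)) \<in> borel_measurable \<nu>"
    using F s by (auto cong: measurable_cong_sets)
  let ?A = "\<integral>\<^sup>+x. ennreal (ln (F x)) \<partial>\<nu>" and ?B = "\<integral>\<^sup>+x. ennreal (- ln (F x)) \<partial>\<nu>"
  have B: "?B \<le> 1" using nn_integral_neg_ln_density_le[OF \<xi> F] d by simp
  then have B': "?B < \<infinity>" by (auto simp: less_top[symmetric] top_unique)
  have e: "rel_entropy \<nu> \<xi> = enn2ereal ?A - enn2ereal ?B"
    using ac by (simp add: rel_entropy_def eintegral_def F_def)
  have A': "?A < \<infinity>"
  proof (rule ccontr)
    assume "\<not> ?A < \<infinity>"
    then have "?A = \<infinity>" by (simp add: less_top[symmetric])
    then have "rel_entropy \<nu> \<xi> = \<infinity>" using e B' by (cases "enn2ereal ?B") auto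
    with fin show False by simp
  qed
  have i: "integrable \<nu> (\<lambda>x. ln (F x))"
  proof (rule integrableI_bounded[OF mln])
    have "(\<integral>\<^sup>+x. ennreal (norm (ln (F x))) \<partial>\<nu>) \<le> (\<integral>\<^sup>+x. ennreal (ln (F x)) + ennreal (- ln (F x)) \<partial>\<nu>)"
      by (intro nn_integral_mono) (auto simp: abs_if ennreal_neg)
    also have "\<dots> = ?A + ?B" using mln by (intro nn_integral_add) auto
    also have "\<dots> < \<infinity>" using A' B' by simp
    finally show "(\<integral>\<^sup>+x. ennreal (norm (ln (F x))) \<partial>\<nu>) < \<infinity>" .
  qed
  have "rel_entropy \<nu> \<xi> = ereal (\<integral>x. ln (F x) \<partial>\<nu>)"
    unfolding e using A' B' real_lebesgue_integral_def[OF i]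
    by (cases ?A; cases ?B) (auto simp: enn2ereal_ennreal)
  with that F d i show ?thesis by blast
qed

lemma rel_entropy_variational:
  fixes g :: "real \<Rightarrow> real"
  assumes \<nu>: "\<nu> \<in> W1_space" and \<xi>: "prob_space \<xi>" "sets \<xi> = sets Rplus"
    and H: "rel_entropy \<nu> \<xi> \<le> ereal a"
    and g: "g \<in> borel_measurable borel" "integrable \<nu> g"
    and Z: "(\<integral>\<^sup>+x. ennreal (exp (g x)) \<partial>\<xi>) \<le> ennreal Z" "0 < Z"
  shows "(\<integral>x. g x \<partial>\<nu>) \<le> a + ln Z"
proof -
  note D = W1_spaceD[OF \<nu>]
  obtain F :: "real \<Rightarrow> real" where F: "F \<in> borel_measurable \<xi>" "\<And>x. 0 \<le> F x"
    "\<nu> = density \<xi> (\<lambda>x. ennreal (F x))" "integrable \<nu> (\<lambda>x. ln (F x))"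
    "rel_entropy \<nu> \<xi> = ereal (\<integral>x. ln (F x) \<partial>\<nu>)"
    by (rule rel_entropy_finite_density[OF D(3) \<xi>(1)]) (use H D(1) \<xi>(2) in auto)
  have "(\<integral>x. g x \<partial>\<nu>) \<le> (\<integral>x. ln (F x) \<partial>\<nu>) + ln Z"
    by (rule variational_entropy_le[OF F(1,2,3) D(3) F(4) g(2) borel_measurable_Rplus[OF \<xi>(2) g(1)] Z])
  then show ?thesis using H F(5) by simp
qed

lemma rel_entropy_nonneg:
  assumes "prob_space \<nu>" "prob_space \<xi>" "sets \<nu> = sets \<xi>"
  shows "0 \<le> rel_entropy \<nu> \<xi>"
proof (cases "rel_entropy \<nu> \<xi> = \<infinity>")
  case False
  from rel_entropy_finite_density[OF assms False] obtain F :: "'a \<Rightarrow> real"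
    where F: "F \<in> borel_measurable \<xi>" "\<And>x. 0 \<le> F x"
    "\<nu> = density \<xi> (\<lambda>x. ennreal (F x))" "integrable \<nu> (\<lambda>x. ln (F x))"
    "rel_entropy \<nu> \<xi> = ereal (\<integral>x. ln (F x) \<partial>\<nu>)" by blast
  have "(\<integral>x. 0 \<partial>\<nu>) \<le> (\<integral>x. ln (F x) \<partial>\<nu>) + ln 1"
    by (rule variational_entropy_le[OF F(1,2,3) assms(1) F(4)])
       (auto simp: prob_space.emeasure_space_1[OF assms(2)])
  then show ?thesis using F(5) by simp
qed simp

text \<open>Lipschitz continuity makes the integral continuous in the Wasserstein metric;
  boundedness keeps exponential integrals finite and bounded away from 0.\<close>

definition Lipschitz_bdd :: "(real \<Rightarrow> real) \<Rightarrow> bool" where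
  "Lipschitz_bdd h \<longleftrightarrow> (\<exists>L. \<forall>x y. \<bar>h x - h y\<bar> \<le> L * \<bar>x - y\<bar>) \<and> (\<exists>B. \<forall>x. \<bar>h x\<bar> \<le> B)"

lemma Lipschitz_bddD:
  assumes "Lipschitz_bdd h"
  obtains L B where "\<And>x y. \<bar>h x - h y\<bar> \<le> L * \<bar>x - y\<bar>" "\<And>x. \<bar>h x\<bar> \<le> B" "L > 0"
proof -
  obtain L B where *: "\<And>x y. \<bar>h x - h y\<bar> \<le> L * \<bar>x - y\<bar>" "\<And>x. \<bar>h x\<bar> \<le> B"
    using assms unfolding Lipschitz_bdd_def by blast
  have "\<bar>h x - h y\<bar> \<le> (\<bar>L\<bar> + 1) * \<bar>x - y\<bar>" for x y
    by (rule order_trans[OF *(1)]) (intro mult_right_mono, auto)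
  with *(2) show ?thesis by (intro that[of "\<bar>L\<bar> + 1" B]) auto
qed

lemma Lipschitz_bdd_measurable:
  assumes "Lipschitz_bdd h"
  shows "h \<in> borel_measurable borel"
proof -
  from Lipschitz_bddD[OF assms] obtain L where L: "L > 0" "\<And>x y. \<bar>h x - h y\<bar> \<le> L * \<bar>x - y\<bar>" by metis
  have "L-lipschitz_on UNIV h"
    using L by (intro lipschitz_onI) (auto simp: dist_real_def)
  then show ?thesis
    by (intro borel_measurable_continuous_onI lipschitz_on_continuous_on)
qed

lemma Lipschitz_bdd_add:
  assumes "Lipschitz_bdd h" "Lipschitz_bdd k" shows "Lipschitz_bdd (\<lambda>x. h x + k x)"
proof -
  obtain L B where 1: "\<And>x y. \<bar>h x - h y\<bar> \<le> L * \<bar>x - y\<bar>" "\<And>x. \<bar>h x\<bar> \<le> B" 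
    using Lipschitz_bddD[OF assms(1)] by metis
  obtain L' B' where 2: "\<And>x y. \<bar>k x - k y\<bar> \<le> L' * \<bar>x - y\<bar>" "\<And>x. \<bar>k x\<bar> \<le> B'" 
    using Lipschitz_bddD[OF assms(2)] by metis
  have "\<bar>(h x + k x) - (h y + k y)\<bar> \<le> (L + L') * \<bar>x - y\<bar>" for x y
    using 1(1)[of x y] 2(1)[of x y] by (simp add: distrib_right)
  moreover have "\<bar>h x + k x\<bar> \<le> B + B'" for x using 1(2)[of x] 2(2)[of x] by simp
  ultimately show ?thesis unfolding Lipschitz_bdd_def by blast
qed

lemma Lipschitz_bdd_cmult:
  assumes "Lipschitz_bdd h" shows "Lipschitz_bdd (\<lambda>x. c * h x)"
proof -
  obtain L B where 1: "\<And>x y. \<bar>h x - h y\<bar> \<le> L * \<bar>x - y\<bar>" "\<And>x. \<bar>h x\<bar> \<le> B" 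
    using Lipschitz_bddD[OF assms(1)] by metis
  have "\<bar>c * h x - c * h y\<bar> \<le> (\<bar>c\<bar> * L) * \<bar>x - y\<bar>" for x y
    using mult_left_mono[OF 1(1)[of x y], of "\<bar>c\<bar>"] by (simp add: abs_mult[symmetric] right_diff_distrib mult.assoc)
  moreover have "\<bar>c * h x\<bar> \<le> \<bar>c\<bar> * B" for x using mult_left_mono[OF 1(2)[of x], of "\<bar>c\<bar>"] by (simp add: abs_mult)
  ultimately show ?thesis unfolding Lipschitz_bdd_def by blast
qed

lemma Lipschitz_bdd_clip:
  assumes "Lipschitz_bdd h" "0 \<le> C" shows "Lipschitz_bdd (\<lambda>x. max 0 (min C (h x)))"
proof -
  obtain L B where 1: "\<And>x y. \<bar>h x - h y\<bar> \<le> L * \<bar>x - y\<bar>" 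
    using Lipschitz_bddD[OF assms(1)] by metis
  have "\<bar>max 0 (min C (h x)) - max 0 (min C (h y))\<bar> \<le> L * \<bar>x - y\<bar>" for x y
    by (rule order_trans[OF _ 1[of x y]]) auto
  moreover have "\<bar>max 0 (min C (h x))\<bar> \<le> C" for x using assms(2) by auto
  ultimately show ?thesis unfolding Lipschitz_bdd_def by blast
qed

section \<open>Simultaneous L^1 approximation and the converse variational bound\<close>

lemma integrable_bounded:
  fixes h :: "'a \<Rightarrow> real"
  assumes "finite_measure M" "h \<in> borel_measurable M" "\<And>x. \<bar>h x\<bar> \<le> B"
  shows "integrable M h"
  using assms by (intro finite_measure.integrable_const_bound[where B=B]) auto

lemma exp_bounded_integral:
  fixes g :: "'a \<Rightarrow> real"
  assumes "prob_space Q" "g \<in> borel_measurable Q" "\<And>x. \<bar>g x\<bar> \<le> B"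
  shows "integrable Q (\<lambda>x. exp (g x))" and "0 < (\<integral>x. exp (g x) \<partial>Q)"
    and "(\<integral>\<^sup>+x. ennreal (exp (g x)) \<partial>Q) \<le> ennreal (\<integral>x. exp (g x) \<partial>Q)"
proof -
  interpret prob_space Q by fact
  have b: "\<bar>exp (g x)\<bar> \<le> exp B" "exp (- B) \<le> exp (g x)" for x using assms(3)[of x] by auto
  show i: "integrable Q (\<lambda>x. exp (g x))"
    by (rule integrable_bounded[OF finite_measure_axioms _ b(1)]) (use assms(2) in measurable)
  show "(\<integral>\<^sup>+x. ennreal (exp (g x)) \<partial>Q) \<le> ennreal (\<integral>x. exp (g x) \<partial>Q)"
    using nn_integral_eq_integral[OF i] by simp
  have "(\<integral>x. exp (- B) \<partial>Q) \<le> (\<integral>x. exp (g x) \<partial>Q)" using i b by (intro integral_mono) auto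
  then show "0 < (\<integral>x. exp (g x) \<partial>Q)"
    using exp_gt_zero[of "- B"] by (simp add: prob_space del: exp_gt_zero)
qed

text \<open>One approximant has to serve two measures, since the variational bound integrates the
  same test function against \<nu> and, exponentiated, against \<xi>.\<close>

definition L1_approx :: "real measure \<Rightarrow> real measure \<Rightarrow> (real \<Rightarrow> real) \<Rightarrow> bool" where
  "L1_approx M N u \<longleftrightarrow> (\<forall>e>0. \<exists>h. Lipschitz_bdd h \<and>
     (\<integral>x. \<bar>u x - h x\<bar> \<partial>M) < e \<and> (\<integral>x. \<bar>u x - h x\<bar> \<partial>N) < e)"

lemma L1_approx_open:
  assumes M: "real_distribution M" and N: "real_distribution N" and U: "open U"
  shows "L1_approx M N (indicator U)"
proof -
  \<comment> \<open>Inside U the distance to the complement is positive, so its multiples eventually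
    exceed 1. \<open>infdist\<close> to the empty set is 0, hence the separate branch for the whole
    line.\<close>
  define h where "h n x = (if U = UNIV then 1 else min 1 (real n * infdist x (- U)))" for n x
  have Lip: "Lipschitz_bdd (h n)" for n
  proof -
    have "\<bar>h n x - h n y\<bar> \<le> real n * \<bar>x - y\<bar>" for x y
    proof (cases "U = UNIV")
      case False
      have "\<bar>h n x - h n y\<bar> \<le> \<bar>real n * infdist x (- U) - real n * infdist y (- U)\<bar>"
        using False by (auto simp: h_def)
      also have "\<dots> = real n * \<bar>infdist x (- U) - infdist y (- U)\<bar>"
        by (simp add: abs_mult right_diff_distrib[symmetric])
      also have "\<dots> \<le> real n * \<bar>x - y\<bar>"
        using infdist_triangle_abs[of x "- U" y] by (intro mult_left_mono) (auto simp: dist_real_def)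
      finally show ?thesis .
    qed (simp add: h_def)
    moreover have "\<bar>h n x\<bar> \<le> 1" for x
      using infdist_nonneg[of x "- U"] by (auto simp: h_def abs_le_iff intro: order_trans[of _ 0])
    ultimately show ?thesis unfolding Lipschitz_bdd_def by blast
  qed
  have lim: "(\<lambda>n. h n x) \<longlonglongrightarrow> indicator U x" for x
  proof (cases "x \<in> U")
    case True
    have "eventually (\<lambda>n. h n x = 1) sequentially"
    proof (cases "U = UNIV")
      case False
      have "infdist x (- U) > 0" 
        using False True U infdist_pos_not_in_closed[of "- U" x] by auto
      then have "eventually (\<lambda>n. real n * infdist x (- U) \<ge> 1) sequentially" by real_asymp
      then show ?thesis using False by (auto simp: h_def elim!: eventually_mono)
    qed (simp add: h_def)
    then have "(\<lambda>n. h n x) \<longlonglongrightarrow> 1" by (rule tendsto_eventually)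
    then show ?thesis using True by simp
  next
    case False
    then have "h n x = 0" for n by (auto simp: h_def)
    then show ?thesis using False by simp
  qed
  have conv: "(\<lambda>n. \<integral>x. \<bar>indicator U x - h n x\<bar> \<partial>K) \<longlonglongrightarrow> 0" if "real_distribution K" for K
  proof -
    interpret real_distribution K by fact
    note [measurable] = Lipschitz_bdd_measurable[OF Lip]
    have "(\<lambda>n. \<integral>x. \<bar>indicator U x - h n x\<bar> \<partial>K) \<longlonglongrightarrow> (\<integral>x. 0 \<partial>K)"
    proof (rule integral_dominated_convergence[where w="\<lambda>_. 1"])
      show "AE x in K. (\<lambda>n. \<bar>indicator U x - h n x\<bar>) \<longlonglongrightarrow> 0"
      proof (intro AE_I2)
        fix x
        have "(\<lambda>n. \<bar>indicator U x - h n x\<bar>) \<longlonglongrightarrow> \<bar>indicator U x - indicator U x :: real\<bar>"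
          by (intro tendsto_intros lim)
        then show "(\<lambda>n. \<bar>indicator U x - h n x\<bar>) \<longlonglongrightarrow> 0" by simp
      qed
      show "AE x in K. norm \<bar>indicator U x - h n x\<bar> \<le> 1" for n
        using infdist_nonneg[of _ "- U"] by (intro AE_I2) (auto simp: h_def indicator_def)
    qed (use U in auto)
    then show ?thesis by simp
  qed
  show ?thesis
    unfolding L1_approx_def
  proof (intro allI impI)
    fix e :: real assume "0 < e"
    from eventually_conj[OF order_tendstoD(2)[OF conv[OF M] this] order_tendstoD(2)[OF conv[OF N] this]]
    show "\<exists>h. Lipschitz_bdd h \<and> (\<integral>x. \<bar>indicator U x - h x\<bar> \<partial>M) < e \<and> (\<integral>x. \<bar>indicator U x - h x\<bar> \<partial>N) < e"
      using Lip by (auto simp: eventually_sequentially)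
  qed
qed

lemma open_superset_measure:
  assumes "real_distribution M" "A \<in> sets borel" "e > 0"
  obtains U where "open U" "A \<subseteq> U" "measure M (U - A) < e"
proof -
  interpret real_distribution M by fact
  have "emeasure M A < emeasure M A + ennreal e"
    using assms(3) emeasure_finite[of A] by (simp add: ennreal_add_left_cancel_less less_top)
  moreover have "emeasure M A = (INF U \<in> {U. A \<subseteq> U \<and> open U}. emeasure M U)"
    using assms(2) by (intro outer_regular) auto
  ultimately obtain U where U: "A \<subseteq> U" "open U" "emeasure M U < emeasure M A + ennreal e"
    by (auto simp: INF_less_iff)
  then have "measure M U < measure M A + e"
    using assms(3) by (simp add: emeasure_eq_measure ennreal_plus[symmetric] ennreal_less_iff del: ennreal_plus)
  moreover have "measure M (U - A) = measure M U - measure M A"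
    using U assms(2) by (intro finite_measure_Diff) auto
  ultimately show ?thesis using that U by auto
qed

lemma L1_approx_close:
  assumes M: "finite_measure M" "sets M = sets borel" and N: "finite_measure N" "sets N = sets borel"
    and u: "u \<in> borel_measurable borel" "\<And>x. \<bar>u x\<bar> \<le> B"
    and close: "\<And>e. e > 0 \<Longrightarrow> \<exists>v. L1_approx M N v \<and> v \<in> borel_measurable borel \<and> (\<exists>B. \<forall>x. \<bar>v x\<bar> \<le> B) \<and>
        (\<integral>x. \<bar>u x - v x\<bar> \<partial>M) < e \<and> (\<integral>x. \<bar>u x - v x\<bar> \<partial>N) < e"
  shows "L1_approx M N u"
  unfolding L1_approx_def
proof (intro allI impI)
  fix e :: real assume "0 < e"
  then have e2: "0 < e / 2" by simp
  from close[OF this] obtain v B' where v: "L1_approx M N v" "v \<in> borel_measurable borel" "\<And>x. \<bar>v x\<bar> \<le> B'"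
    "(\<integral>x. \<bar>u x - v x\<bar> \<partial>M) < e / 2" "(\<integral>x. \<bar>u x - v x\<bar> \<partial>N) < e / 2" by blast
  from v(1) e2 obtain h where h: "Lipschitz_bdd h" "(\<integral>x. \<bar>v x - h x\<bar> \<partial>M) < e / 2" "(\<integral>x. \<bar>v x - h x\<bar> \<partial>N) < e / 2"
    unfolding L1_approx_def by blast
  from Lipschitz_bddD[OF h(1)] obtain C where C: "\<And>x. \<bar>h x\<bar> \<le> C" by metis
  have *: "(\<integral>x. \<bar>u x - h x\<bar> \<partial>K) \<le> (\<integral>x. \<bar>u x - v x\<bar> \<partial>K) + (\<integral>x. \<bar>v x - h x\<bar> \<partial>K)"
    if K: "finite_measure K" "sets K = sets borel" for K
  proof -
    have mK: "borel_measurable K = borel_measurable borel" using K(2) by (intro measurable_cong_sets) auto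
    have i: "integrable K u" "integrable K v" "integrable K h"
      by (rule integrable_bounded[OF K(1) _ u(2)] integrable_bounded[OF K(1) _ v(3)] integrable_bounded[OF K(1) _ C],
          use u(1) v(2) Lipschitz_bdd_measurable[OF h(1)] in \<open>simp add: mK\<close>)+
    have "(\<integral>x. \<bar>u x - h x\<bar> \<partial>K) \<le> (\<integral>x. \<bar>u x - v x\<bar> + \<bar>v x - h x\<bar> \<partial>K)"
      using i by (intro integral_mono) auto
    then show ?thesis using i by simp
  qed
  show "\<exists>h. Lipschitz_bdd h \<and> (\<integral>x. \<bar>u x - h x\<bar> \<partial>M) < e \<and> (\<integral>x. \<bar>u x - h x\<bar> \<partial>N) < e"
    using *[OF M] *[OF N] v h by (intro exI[of _ h]) auto
qed

text \<open>Boundedness is an implication inside the statement so that induction over nonnegative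
  Borel functions can pass it down: summands and members of an increasing sequence inherit the
  bound.\<close>

lemma L1_approx_bounded:
  fixes u :: "real \<Rightarrow> real"
  assumes M: "real_distribution M" and N: "real_distribution N"
    and u: "u \<in> borel_measurable borel" "\<And>x. 0 \<le> u x"
  shows "(\<exists>B. \<forall>x. u x \<le> B) \<longrightarrow> L1_approx M N u"
  using u
proof (induct rule: borel_measurable_induct_real)
  interpret M: real_distribution M by fact
  interpret N: real_distribution N by fact
  note F = M.finite_measure_axioms M.events_eq_borel N.finite_measure_axioms N.events_eq_borel
  {
    case (set A)
    have "L1_approx M N (indicator A)"
    proof (rule L1_approx_close[OF F, where B=1])
      fix e :: real assume e: "e > 0"
      \<comment> \<open>Outer regularity supplies one open superset per measure; their intersection
        is open and close to A under both.\<close>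
      obtain U where U: "open U" "A \<subseteq> U" "measure M (U - A) < e"
        by (rule open_superset_measure[OF M _ e, of A]) (use set in auto)
      obtain V where V: "open V" "A \<subseteq> V" "measure N (V - A) < e"
        by (rule open_superset_measure[OF N _ e, of A]) (use set in auto)
      have *: "(\<integral>x. \<bar>indicator A x - indicator (U \<inter> V) x :: real\<bar> \<partial>K) = measure K ((U \<inter> V) - A)"
        if "real_distribution K" for K
      proof -
        interpret real_distribution K by fact
        have "(\<integral>x. \<bar>indicator A x - indicator (U \<inter> V) x :: real\<bar> \<partial>K) = (\<integral>x. indicator ((U \<inter> V) - A) x \<partial>K)"
          using U V by (intro Bochner_Integration.integral_cong) (auto simp: indicator_def)
        then show ?thesis by simp
      qed
      have "measure M ((U \<inter> V) - A) < e"
        using U V set by (intro le_less_trans[OF M.finite_measure_mono U(3)]) auto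
      moreover have "measure N ((U \<inter> V) - A) < e"
        using U V set by (intro le_less_trans[OF N.finite_measure_mono V(3)]) auto
      moreover have "L1_approx M N (indicator (U \<inter> V))"
        using U V by (intro L1_approx_open[OF M N]) auto
      ultimately show "\<exists>v. L1_approx M N v \<and> v \<in> borel_measurable borel \<and> (\<exists>B. \<forall>x. \<bar>v x\<bar> \<le> B) \<and>
        (\<integral>x. \<bar>indicator A x - v x\<bar> \<partial>M) < e \<and> (\<integral>x. \<bar>indicator A x - v x\<bar> \<partial>N) < e"
      proof (intro exI[of _ "indicator (U \<inter> V)"] conjI)
        show "indicator (U \<inter> V) \<in> borel_measurable borel" using U V by (intro borel_measurable_indicator) auto
        show "\<exists>B. \<forall>x. \<bar>indicator (U \<inter> V) x :: real\<bar> \<le> B" by (intro exI[of _ 1]) (auto simp: indicator_def)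
      qed (simp_all only: *[OF M] *[OF N])
    qed (use set in \<open>auto simp: indicator_def\<close>)
    then show ?case by simp
  next
    case (mult u c)
    show ?case
    \<comment> \<open>A bound on c * u bounds u only if c is positive; for c = 0 the zero function
      is its own approximant.\<close>
    proof (cases "c = 0")
      case True
      have "Lipschitz_bdd (\<lambda>x. 0)" by (auto simp: Lipschitz_bdd_def intro: exI[of _ 0])
      then show ?thesis using True by (auto simp: L1_approx_def intro!: exI[of _ "\<lambda>x. 0"])
    next
      case False
      then have c: "c > 0" using mult by auto
      show ?thesis
      proof
        assume "\<exists>B. \<forall>x. c * u x \<le> B"
        then obtain B where B: "\<And>x. c * u x \<le> B" by blast
        then have "\<forall>x. u x \<le> B / c" using c by (simp add: field_simps)
        then have u: "L1_approx M N u" using mult(4) by blast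
        show "L1_approx M N (\<lambda>x. c * u x)"
          unfolding L1_approx_def
        proof (intro allI impI)
          fix e :: real assume "0 < e"
          then have "0 < e / c" using c by simp
          with u obtain h where h: "Lipschitz_bdd h" "(\<integral>x. \<bar>u x - h x\<bar> \<partial>M) < e / c" "(\<integral>x. \<bar>u x - h x\<bar> \<partial>N) < e / c"
            unfolding L1_approx_def by blast
          have "\<bar>c * u x - c * h x\<bar> = c * \<bar>u x - h x\<bar>" for x
            using c by (simp add: abs_mult right_diff_distrib[symmetric])
          then show "\<exists>h. Lipschitz_bdd h \<and> (\<integral>x. \<bar>c * u x - h x\<bar> \<partial>M) < e \<and> (\<integral>x. \<bar>c * u x - h x\<bar> \<partial>N) < e"
            using h c by (intro exI[of _ "\<lambda>x. c * h x"]) (auto simp: Lipschitz_bdd_cmult field_simps)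
        qed
      qed
    qed
  next
    case (add u v)
    show ?case
    proof
      assume "\<exists>B. \<forall>x. v x + u x \<le> B"
      then obtain B where B: "\<And>x. v x + u x \<le> B" by blast
      have B': "u x \<le> B" "v x \<le> B" for x using B[of x] add(2)[of x] add(5)[of x] by auto
      then have uv: "L1_approx M N u" "L1_approx M N v" using add(3,7) by blast+
      have u': "\<bar>u x\<bar> \<le> B" and v': "\<bar>v x\<bar> \<le> B" for x
        using B'[of x] add(2)[of x] add(5)[of x] by auto
      show "L1_approx M N (\<lambda>x. v x + u x)"
        unfolding L1_approx_def
      proof (intro allI impI)
        fix e :: real assume "0 < e"
        then have e2: "0 < e / 2" by simp
        with uv(1) obtain h where h: "Lipschitz_bdd h" "(\<integral>x. \<bar>u x - h x\<bar> \<partial>M) < e / 2" "(\<integral>x. \<bar>u x - h x\<bar> \<partial>N) < e / 2"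
          unfolding L1_approx_def by blast
        from uv(2) e2 obtain k where k: "Lipschitz_bdd k" "(\<integral>x. \<bar>v x - k x\<bar> \<partial>M) < e / 2" "(\<integral>x. \<bar>v x - k x\<bar> \<partial>N) < e / 2"
          unfolding L1_approx_def by blast
        obtain C D where C: "\<And>x. \<bar>h x\<bar> \<le> C" and D: "\<And>x. \<bar>k x\<bar> \<le> D" 
          using Lipschitz_bddD[OF h(1)] Lipschitz_bddD[OF k(1)] by metis
        have *: "(\<integral>x. \<bar>v x + u x - (k x + h x)\<bar> \<partial>K) \<le> (\<integral>x. \<bar>v x - k x\<bar> \<partial>K) + (\<integral>x. \<bar>u x - h x\<bar> \<partial>K)"
          if "real_distribution K" for K
        proof -
          interpret real_distribution K by fact
          have i: "integrable K u" "integrable K v" "integrable K h" "integrable K k"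
            by (rule integrable_bounded[OF finite_measure_axioms _ u'] integrable_bounded[OF finite_measure_axioms _ v']
                  integrable_bounded[OF finite_measure_axioms _ C] integrable_bounded[OF finite_measure_axioms _ D],
                use add(1,4) Lipschitz_bdd_measurable[OF h(1)] Lipschitz_bdd_measurable[OF k(1)] in simp)+
          have "(\<integral>x. \<bar>v x + u x - (k x + h x)\<bar> \<partial>K) \<le> (\<integral>x. \<bar>v x - k x\<bar> + \<bar>u x - h x\<bar> \<partial>K)"
            using i by (intro integral_mono) auto
          then show ?thesis using i by simp
        qed
        show "\<exists>h. Lipschitz_bdd h \<and> (\<integral>x. \<bar>v x + u x - h x\<bar> \<partial>M) < e \<and> (\<integral>x. \<bar>v x + u x - h x\<bar> \<partial>N) < e"
          using *[OF M] *[OF N] h k by (intro exI[of _ "\<lambda>x. k x + h x"]) (auto simp: Lipschitz_bdd_add)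
      qed
    qed
  next
    case (seq U)
    show ?case
    proof
      assume "\<exists>B. \<forall>x. u x \<le> B"
      then obtain B where B: "\<And>x. u x \<le> B" by blast
      have Uu: "U i x \<le> u x" for i x
        using seq(4) seq(5)[of x] by (intro incseq_le) (auto simp: incseq_def le_fun_def)
      have app: "L1_approx M N (U i)" for i
        using seq(3)[of i] Uu[of i] B by (meson order_trans)
      have mu: "u \<in> borel_measurable borel" using u by simp
      have u0: "0 \<le> u x" for x by (rule order_trans[OF seq(2)[of 0 x] Uu])
      have conv: "(\<lambda>n. \<integral>x. \<bar>u x - U n x\<bar> \<partial>K) \<longlonglongrightarrow> 0" if "real_distribution K" for K
      proof -
        interpret real_distribution K by fact
        have "(\<lambda>n. \<integral>x. \<bar>u x - U n x\<bar> \<partial>K) \<longlonglongrightarrow> (\<integral>x. 0 \<partial>K)"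
        proof (rule integral_dominated_convergence[where w="\<lambda>_. B"])
          show "AE x in K. (\<lambda>n. \<bar>u x - U n x\<bar>) \<longlonglongrightarrow> 0"
          proof (intro AE_I2)
            fix x
            have "(\<lambda>n. \<bar>u x - U n x\<bar>) \<longlonglongrightarrow> \<bar>u x - u x\<bar>" using seq(5)[of x] by (intro tendsto_intros) simp
            then show "(\<lambda>n. \<bar>u x - U n x\<bar>) \<longlonglongrightarrow> 0" by simp
          qed
          show "AE x in K. norm \<bar>u x - U n x\<bar> \<le> B" for n
            using Uu[of n] B seq(2)[of n] by (intro AE_I2) (auto simp: abs_le_iff algebra_simps intro: order_trans add_increasing2)
          show "(\<lambda>x. \<bar>u x - U n x\<bar>) \<in> borel_measurable K" for n using mu seq(1)[of n] by simp
        qed auto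
        then show ?thesis by simp
      qed
      show "L1_approx M N u"
      proof (rule L1_approx_close[OF F, where B=B])
        show "\<bar>u x\<bar> \<le> B" for x using B[of x] u0[of x] by simp
        fix e :: real assume "0 < e"
        from eventually_conj[OF order_tendstoD(2)[OF conv[OF M] this] order_tendstoD(2)[OF conv[OF N] this]]
        obtain n where "(\<integral>x. \<bar>u x - U n x\<bar> \<partial>M) < e" "(\<integral>x. \<bar>u x - U n x\<bar> \<partial>N) < e"
          by (auto simp: eventually_sequentially)
        moreover have "\<bar>U n x\<bar> \<le> B" for x using Uu[of n x] B[of x] seq(2)[of n x] by simp
        ultimately show "\<exists>v. L1_approx M N v \<and> v \<in> borel_measurable borel \<and> (\<exists>B. \<forall>x. \<bar>v x\<bar> \<le> B) \<and>
           (\<integral>x. \<bar>u x - v x\<bar> \<partial>M) < e \<and> (\<integral>x. \<bar>u x - v x\<bar> \<partial>N) < e"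
          using app seq(1) by blast
      qed (use mu in auto)
    qed
  }
qed

text \<open>The bound extends to bounded Borel functions by \<open>L\<^sup>1\<close> approximation and is then applied to the
  truncated logarithm of the density. Where the density \<open>F\<close> vanishes the truncation at level \<open>k\<close> is set
  to \<open>-k\<close>, because \<open>ln 0 = 0\<close>.\<close>

lemma rel_entropy_le_of_Lipschitz_bdd:
  assumes \<nu>: "prob_space \<nu>" "sets \<nu> = sets Rplus" and \<xi>: "prob_space \<xi>" "sets \<xi> = sets Rplus"
    and H: "\<And>g. Lipschitz_bdd g \<Longrightarrow> (\<integral>x. g x \<partial>\<nu>) \<le> a + ln (\<integral>x. exp (g x) \<partial>\<xi>)"
  shows "rel_entropy \<nu> \<xi> \<le> ereal a"
proof -
  interpret N: prob_space \<nu> by fact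
  interpret X: prob_space \<xi> by fact
  note m\<nu> = borel_measurable_Rplus[OF \<nu>(2)] and m\<xi> = borel_measurable_Rplus[OF \<xi>(2)]
  \<comment> \<open>Test functions with values in [0, C] come first: the approximation lemma wants
    nonnegative functions, and then the exponential integral is at least 1, which controls its
    logarithm.\<close>
  have nn: "(\<integral>x. u x \<partial>\<nu>) \<le> a + ln (\<integral>x. exp (u x) \<partial>\<xi>)"
    if u: "u \<in> borel_measurable borel" "\<And>x. 0 \<le> u x" "\<And>x. u x \<le> C" for u and C :: real
  proof -
    have C: "0 \<le> C" using u(2,3)[of 0] by simp
    have app: "L1_approx (distr \<nu> borel (\<lambda>x. x)) (distr \<xi> borel (\<lambda>x. x)) u"
      using L1_approx_bounded[OF real_distribution_distr_id[OF \<nu>] real_distribution_distr_id[OF \<xi>] u(1,2)] u(3) by blast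
    let ?Z = "\<integral>x. exp (u x) \<partial>\<xi>"
    have bd: "\<bar>u x\<bar> \<le> C" "\<bar>exp (u x)\<bar> \<le> exp C" for x using u(2,3)[of x] by auto
    have iu: "integrable \<nu> u" "integrable \<xi> u" "integrable \<xi> (\<lambda>x. exp (u x))"
      by (rule integrable_bounded[OF N.finite_measure_axioms m\<nu>[OF u(1)] bd(1)]
          integrable_bounded[OF X.finite_measure_axioms m\<xi>[OF u(1)] bd(1)]
          integrable_bounded[OF X.finite_measure_axioms m\<xi> bd(2)] measurable_compose[OF u(1) borel_measurable_exp])+
    have Z1: "1 \<le> ?Z"
    proof -
      have "(\<integral>x. 1 \<partial>\<xi>) \<le> ?Z" using iu u(2) by (intro integral_mono) auto
      then show ?thesis by (simp add: X.prob_space)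
    qed
    have "(\<integral>x. u x \<partial>\<nu>) \<le> a + ln ?Z + e" if e: "0 < e" for e
    proof -
      \<comment> \<open>The error is d from the integral under \<nu> and exp C * d from the
        logarithm, together e.\<close>
      define d where "d = e / (1 + exp C)"
      have d: "0 < d" "d + exp C * d = e"
        using e by (auto simp: d_def add_pos_pos field_simps add_nonneg_eq_0_iff)
      from app d(1) obtain h0 where h0: "Lipschitz_bdd h0"
        "(\<integral>x. \<bar>u x - h0 x\<bar> \<partial>distr \<nu> borel (\<lambda>x. x)) < d" "(\<integral>x. \<bar>u x - h0 x\<bar> \<partial>distr \<xi> borel (\<lambda>x. x)) < d"
        unfolding L1_approx_def by blast
      note mh0 = Lipschitz_bdd_measurable[OF h0(1)]
      obtain B where B: "\<And>x. \<bar>h0 x\<bar> \<le> B" using Lipschitz_bddD[OF h0(1)] by metis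
      \<comment> \<open>As u takes values in [0, C], clipping the approximant to this interval only
        brings it closer, and it bounds the exponentials by exp C.\<close>
      define h where "h x = max 0 (min C (h0 x))" for x
      have h: "Lipschitz_bdd h" unfolding h_def[abs_def] by (rule Lipschitz_bdd_clip[OF h0(1) C])
      note mh = Lipschitz_bdd_measurable[OF h]
      have hb: "0 \<le> h x" "h x \<le> C" "\<bar>h x\<bar> \<le> C" "\<bar>exp (h x)\<bar> \<le> exp C" for x using C by (auto simp: h_def)
      have uh: "\<bar>u x - h x\<bar> \<le> \<bar>u x - h0 x\<bar>" for x using u(2,3)[of x] by (auto simp: h_def)
      have ih: "integrable \<nu> h" "integrable \<xi> h" "integrable \<xi> (\<lambda>x. exp (h x))" "integrable \<nu> h0" "integrable \<xi> h0"
        by (rule integrable_bounded[OF N.finite_measure_axioms m\<nu>[OF mh] hb(3)]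
            integrable_bounded[OF X.finite_measure_axioms m\<xi>[OF mh] hb(3)]
            integrable_bounded[OF X.finite_measure_axioms m\<xi> hb(4)] measurable_compose[OF mh borel_measurable_exp]
            integrable_bounded[OF N.finite_measure_axioms m\<nu>[OF mh0] B]
            integrable_bounded[OF X.finite_measure_axioms m\<xi>[OF mh0] B])+
      have m0: "(\<lambda>x. \<bar>u x - h0 x\<bar>) \<in> borel_measurable borel" using u(1) mh0 by measurable
      have mid: "(\<lambda>x::real. x) \<in> borel_measurable borel" by simp
      have dn: "(\<integral>x. \<bar>u x - h x\<bar> \<partial>\<nu>) < d"
      proof (rule le_less_trans[OF _ h0(2)])
        have "(\<integral>x. \<bar>u x - h x\<bar> \<partial>\<nu>) \<le> (\<integral>x. \<bar>u x - h0 x\<bar> \<partial>\<nu>)"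
          using iu ih uh by (intro integral_mono) auto
        also have "\<dots> = (\<integral>x. \<bar>u x - h0 x\<bar> \<partial>distr \<nu> borel (\<lambda>x. x))"
          by (rule integral_distr[OF m\<nu>[OF mid] m0, symmetric])
        finally show "(\<integral>x. \<bar>u x - h x\<bar> \<partial>\<nu>) \<le> \<dots>" .
      qed
      have dx: "(\<integral>x. \<bar>u x - h x\<bar> \<partial>\<xi>) < d"
      proof (rule le_less_trans[OF _ h0(3)])
        have "(\<integral>x. \<bar>u x - h x\<bar> \<partial>\<xi>) \<le> (\<integral>x. \<bar>u x - h0 x\<bar> \<partial>\<xi>)"
          using iu ih uh by (intro integral_mono) auto
        also have "\<dots> = (\<integral>x. \<bar>u x - h0 x\<bar> \<partial>distr \<xi> borel (\<lambda>x. x))"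
          by (rule integral_distr[OF m\<xi>[OF mid] m0, symmetric])
        finally show "(\<integral>x. \<bar>u x - h x\<bar> \<partial>\<xi>) \<le> \<dots>" .
      qed
      have "(\<integral>x. u x \<partial>\<nu>) \<le> (\<integral>x. h x + \<bar>u x - h x\<bar> \<partial>\<nu>)"
        using iu ih by (intro integral_mono) auto
      also have "\<dots> = (\<integral>x. h x \<partial>\<nu>) + (\<integral>x. \<bar>u x - h x\<bar> \<partial>\<nu>)"
        using iu ih by simp
      also have "\<dots> \<le> a + ln (\<integral>x. exp (h x) \<partial>\<xi>) + d"
        using H[OF h] dn by simp
      also have "ln (\<integral>x. exp (h x) \<partial>\<xi>) \<le> ln ?Z + exp C * d"
      proof -
        \<comment> \<open>Where h exceeds u, the tangent line of exp at h x gives the bound, with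
          slope at most exp C.\<close>
        have "exp (h x) \<le> exp (u x) + exp C * \<bar>u x - h x\<bar>" for x
        proof (cases "h x \<le> u x")
          case True
          then show ?thesis by (simp add: add_increasing2)
        next
          case False
          have "exp (u x) \<ge> exp (h x) * (1 + (u x - h x))"
            using mult_left_mono[OF exp_ge_add_one_self[of "u x - h x"], of "exp (h x)"]
            by (simp add: mult_exp_exp)
          moreover have "exp (h x) * (h x - u x) \<le> exp C * (h x - u x)"
            using False hb(2)[of x] by (intro mult_right_mono) auto
          ultimately show ?thesis using False by (simp add: algebra_simps)
        qed
        then have "(\<integral>x. exp (h x) \<partial>\<xi>) \<le> (\<integral>x. exp (u x) + exp C * \<bar>u x - h x\<bar> \<partial>\<xi>)"
          using iu ih by (intro integral_mono) auto
        also have "\<dots> = ?Z + exp C * (\<integral>x. \<bar>u x - h x\<bar> \<partial>\<xi>)"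
          using iu ih by simp
        also have "\<dots> \<le> ?Z + exp C * d" using dx by simp
        finally have le: "(\<integral>x. exp (h x) \<partial>\<xi>) \<le> ?Z + exp C * d" .
        have "(\<integral>x. 1 \<partial>\<xi>) \<le> (\<integral>x. exp (h x) \<partial>\<xi>)" using ih hb by (intro integral_mono) auto
        then have pos: "0 < (\<integral>x. exp (h x) \<partial>\<xi>)" by (simp add: X.prob_space)
        have "ln (\<integral>x. exp (h x) \<partial>\<xi>) \<le> ln (?Z + exp C * d)" using le pos by simp
        \<comment> \<open>The product form is available because the integral is at least 1; its
          logarithm splits into the target and an error.\<close>
        also have "?Z + exp C * d \<le> ?Z * (1 + exp C * d)"
        proof -
          have "1 * (exp C * d) \<le> ?Z * (exp C * d)"
            using Z1 d by (intro mult_right_mono) auto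
          then show ?thesis by (simp add: algebra_simps)
        qed
        then have "ln (?Z + exp C * d) \<le> ln (?Z * (1 + exp C * d))"
          using Z1 d by (subst ln_le_cancel_iff) (auto intro!: add_pos_nonneg mult_pos_pos)
        also have "\<dots> = ln ?Z + ln (1 + exp C * d)"
        proof -
          have "0 < 1 + exp C * d" using d by (intro add_pos_nonneg) auto
          moreover have "0 < ?Z" using Z1 by simp
          ultimately show ?thesis by (simp add: ln_mult)
        qed
        also have "ln (1 + exp C * d) \<le> exp C * d" using d by (intro ln_add_one_self_le_self) auto
        finally show ?thesis by simp
      qed
      finally show ?thesis using d(2) by simp
    qed
    then show ?thesis by (rule field_le_epsilon)
  qed
  \<comment> \<open>Adding the constant C makes u nonnegative and raises both sides by C.\<close>
  have gen: "(\<integral>x. u x \<partial>\<nu>) \<le> a + ln (\<integral>x. exp (u x) \<partial>\<xi>)"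
    if u: "u \<in> borel_measurable borel" "\<And>x. \<bar>u x\<bar> \<le> C" for u and C :: real
  proof -
    have bd: "0 \<le> u x + C" "u x + C \<le> 2 * C" for x using u(2)[of x] by auto
    have i: "integrable \<nu> u" by (rule integrable_bounded[OF N.finite_measure_axioms m\<nu>[OF u(1)] u(2)])
    note pos = exp_bounded_integral(2)[OF \<xi>(1) m\<xi>[OF u(1)] u(2)]
    have "(\<integral>x. u x + C \<partial>\<nu>) \<le> a + ln (\<integral>x. exp (u x + C) \<partial>\<xi>)"
      by (rule nn[OF _ bd(1,2)]) (use u in simp)
    also have "(\<integral>x. exp (u x + C) \<partial>\<xi>) = (\<integral>x. exp (u x) \<partial>\<xi>) * exp C" by (simp add: exp_add)
    also have "ln \<dots> = ln (\<integral>x. exp (u x) \<partial>\<xi>) + C" using pos by (subst ln_mult) auto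
    finally show ?thesis using i by (simp add: N.prob_space)
  qed
  \<comment> \<open>The test function t times the indicator of a \<xi>-null set has exponential
    integral 1, so t times the \<nu>-measure of the set stays below a for every t.\<close>
  have ac: "absolutely_continuous \<xi> \<nu>"
    unfolding absolutely_continuous_def
  proof
    fix A assume A: "A \<in> null_sets \<xi>"
    have Ab: "A \<in> sets borel" "A \<in> sets \<nu>"
      using A \<xi>(2) \<nu>(2) by (auto simp: null_sets_def sets_restrict_space)
    have le: "t * measure \<nu> A \<le> a" if t: "0 \<le> t" for t
    proof -
      have "(\<integral>x. t * indicator A x \<partial>\<nu>) \<le> a + ln (\<integral>x. exp (t * indicator A x) \<partial>\<xi>)"
        by (rule gen[of _ t]) (use Ab t in \<open>auto simp: indicator_def\<close>)
      also have "(\<integral>x. exp (t * indicator A x) \<partial>\<xi>) = (\<integral>x. 1 \<partial>\<xi>)"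
      proof (rule integral_cong_AE)
        show "(\<lambda>x. exp (t * indicator A x)) \<in> borel_measurable \<xi>"
          by (rule m\<xi>) (use Ab in measurable)
        show "AE x in \<xi>. exp (t * indicator A x) = 1"
          using AE_not_in[OF A] by eventually_elim simp
      qed simp
      finally show ?thesis using Ab by (simp add: X.prob_space)
    qed
    have "measure \<nu> A = 0"
    proof (rule ccontr)
      assume "measure \<nu> A \<noteq> 0"
      then have p: "0 < measure \<nu> A" by (simp add: less_le)
      have "(\<bar>a\<bar> + 1) / measure \<nu> A * measure \<nu> A \<le> a" using p by (intro le) auto
      then show False using p by simp
    qed
    then show "A \<in> null_sets \<nu>" using Ab by (intro null_setsI) (simp add: N.emeasure_eq_measure)
  qed
  define F0 where "F0 x = enn2real (RN_deriv \<xi> \<nu> x)" for x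
  have F0: "F0 \<in> borel_measurable \<xi>" "\<And>x. 0 \<le> F0 x" unfolding F0_def[abs_def] by auto
  have d0: "\<nu> = density \<xi> (\<lambda>x. ennreal (F0 x))"
    using RN_deriv_density_real[OF \<nu>(1) \<xi>(1) _ ac] \<nu>(2) \<xi>(2) by (simp add: F0_def)
  \<comment> \<open>The density is extended by 0 to the whole line, where the test functions are
    required to be Borel.\<close>
  define F where "F x = (if 0 \<le> x then F0 x else 0)" for x
  have FF0: "F x = F0 x" if "x \<in> space \<xi>" for x
    using that space_Rplus_cong[OF \<xi>(2)] by (simp add: F_def)
  have F: "F \<in> borel_measurable borel" "\<And>x. 0 \<le> F x"
  proof -
    have "F0 \<in> borel_measurable Rplus" using F0(1) \<xi>(2) by (simp cong: measurable_cong_sets)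
    then have "(\<lambda>x. indicator {0..} x *\<^sub>R F0 x) \<in> borel_measurable borel"
      by (subst (asm) borel_measurable_restrict_space_iff) auto
    moreover have "(\<lambda>x. indicator {0..} x *\<^sub>R F0 x) = F" by (auto simp: F_def indicator_def)
    ultimately show "F \<in> borel_measurable borel" by simp
    show "0 \<le> F x" for x using F0(2) by (simp add: F_def)
  qed
  have d: "\<nu> = density \<xi> (\<lambda>x. ennreal (F x))"
    unfolding d0 using F0(1) m\<xi>[OF F(1)] by (intro density_cong) (auto simp: FF0)
  let ?A = "\<integral>\<^sup>+x. ennreal (ln (F x)) \<partial>\<nu>" and ?B = "\<integral>\<^sup>+x. ennreal (- ln (F x)) \<partial>\<nu>"
  have e: "rel_entropy \<nu> \<xi> = enn2ereal ?A - enn2ereal ?B"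
  proof -
    have "(\<integral>\<^sup>+x. ennreal (ln (F0 x)) \<partial>\<nu>) = ?A" "(\<integral>\<^sup>+x. ennreal (- ln (F0 x)) \<partial>\<nu>) = ?B"
      using space_Rplus_cong[OF \<nu>(2)] by (auto intro!: nn_integral_cong simp: F_def)
    then show ?thesis using ac by (simp add: rel_entropy_def eintegral_def F0_def)
  qed
  have B: "?B \<le> 1" using nn_integral_neg_ln_density_le[OF \<xi>(1) m\<xi>[OF F(1)] F(2)] d by simp
  then obtain b where b: "?B = ennreal b" "0 \<le> b" by (cases ?B) (auto simp: top_unique)
  have mF: "F \<in> borel_measurable \<nu>" by (rule m\<nu>[OF F(1)])
  have AEpos: "AE x in \<nu>. 0 < F x"
    by (rule density_pos_AE[OF m\<xi>[OF F(1)] F(2), folded d])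
  define A where "A k = (\<integral>\<^sup>+x. ennreal (min (real k) (ln (F x))) \<partial>\<nu>)" for k
  have Ak: "A k \<le> ennreal (a + b + exp (- real k))" for k
  proof -
    define g where "g x = (if F x = 0 then - real k else max (- real k) (min (real k) (ln (F x))))" for x
    have g: "g \<in> borel_measurable borel" unfolding g_def[abs_def] using F(1) by measurable
    have gb: "\<bar>g x\<bar> \<le> real k" for x by (auto simp: g_def)
    have ig: "integrable \<nu> g"
      by (rule integrable_bounded[OF N.finite_measure_axioms m\<nu>[OF g] gb])
    \<comment> \<open>Cutting off at -k raises the exponential by at most exp (-k), so its integral
      is at most 1 + exp (-k) and its logarithm vanishes in the limit.\<close>
    have eb: "exp (g x) \<le> F x + exp (- real k)" for x
    proof (cases "F x = 0")
      case False
      then have p: "0 < F x" using F(2)[of x] by simp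
      have "g x \<le> max (- real k) (ln (F x))" using p by (auto simp: g_def)
      then have "exp (g x) \<le> exp (max (- real k) (ln (F x)))" by simp
      also have "\<dots> \<le> F x + exp (- real k)" using p by (auto simp: max_def)
      finally show ?thesis .
    qed (simp add: g_def)
    have nF: "(\<integral>\<^sup>+x. ennreal (F x) \<partial>\<xi>) = 1"
    proof -
      have "emeasure \<nu> (space \<nu>) = (\<integral>\<^sup>+x. ennreal (F x) * indicator (space \<xi>) x \<partial>\<xi>)"
        unfolding d using m\<xi>[OF F(1)] by (simp add: emeasure_density)
      also have "\<dots> = (\<integral>\<^sup>+x. ennreal (F x) \<partial>\<xi>)" by (intro nn_integral_cong) simp
      finally show ?thesis by (simp add: N.emeasure_space_1)
    qed
    have iF: "integrable \<xi> F" "(\<integral>x. F x \<partial>\<xi>) = 1"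
      using nF m\<xi>[OF F(1)] F(2) by (auto intro!: integrableI_nonneg simp: integral_eq_nn_integral)
    note ieg = exp_bounded_integral(1)[OF \<xi>(1) m\<xi>[OF g] gb]
    note zpos = exp_bounded_integral(2)[OF \<xi>(1) m\<xi>[OF g] gb]
    have "(\<integral>x. exp (g x) \<partial>\<xi>) \<le> (\<integral>x. F x + exp (- real k) \<partial>\<xi>)"
      using ieg iF eb by (intro integral_mono) auto
    also have "\<dots> = 1 + exp (- real k)" using iF by (simp add: X.prob_space)
    finally have ze: "(\<integral>x. exp (g x) \<partial>\<xi>) \<le> 1 + exp (- real k)" .
    have "ln (\<integral>x. exp (g x) \<partial>\<xi>) \<le> ln (1 + exp (- real k))"
      using ze zpos by (intro ln_mono) auto
    also have "\<dots> \<le> exp (- real k)" by (intro ln_add_one_self_le_self) auto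
    finally have le: "(\<integral>x. g x \<partial>\<nu>) \<le> a + exp (- real k)" using gen[OF g gb] by simp
    \<comment> \<open>Truncation does not enlarge the negative part. Moving it to the other side
      bounds the truncated positive part by a + b + exp (-k), where b is the full negative part,
      which is subtracted again at the end.\<close>
    have neg: "(\<integral>\<^sup>+x. ennreal (- g x) \<partial>\<nu>) \<le> ?B"
    proof (rule nn_integral_mono_AE)
      show "AE x in \<nu>. ennreal (- g x) \<le> ennreal (- ln (F x))"
        using AEpos
      proof eventually_elim
        case (elim x)
        show ?case
        proof (cases "0 \<le> ln (F x)")
          case True
          then have "- g x \<le> 0" using elim unfolding g_def by (auto simp del: ln_ge_zero_iff)
          then show ?thesis by (simp add: ennreal_neg)
        next
          case False
          define y where "y = ln (F x)"
          have "g x = max (- real k) (min (real k) y)" using elim by (simp add: g_def y_def)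
          moreover have "y < 0" using False by (simp only: y_def not_le)
          ultimately have "- g x \<le> - y" by linarith
          then show ?thesis unfolding y_def by (rule ennreal_leI)
        qed
      qed
    qed
    have Aeq: "A k = (\<integral>\<^sup>+x. ennreal (g x) \<partial>\<nu>)"
      unfolding A_def
    proof (rule nn_integral_cong_AE)
      show "AE x in \<nu>. ennreal (min (real k) (ln (F x))) = ennreal (g x)"
        using AEpos
      proof eventually_elim
        case (elim x)
        then show ?case by (auto simp: g_def max_def min_def ennreal_neg)
      qed
    qed
    have fin: "(\<integral>\<^sup>+x. ennreal (g x) \<partial>\<nu>) < \<infinity>"
    proof -
      have "(\<integral>\<^sup>+x. ennreal (g x) \<partial>\<nu>) \<le> (\<integral>\<^sup>+x. ennreal (real k) \<partial>\<nu>)"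
        by (intro nn_integral_mono ennreal_leI) (use gb in \<open>auto simp: abs_le_iff\<close>)
      also have "\<dots> < \<infinity>" by (simp add: N.emeasure_space_1)
      finally show ?thesis .
    qed
    then obtain p where p: "(\<integral>\<^sup>+x. ennreal (g x) \<partial>\<nu>) = ennreal p" "0 \<le> p" by (cases "\<integral>\<^sup>+x. ennreal (g x) \<partial>\<nu>") auto
    obtain q where q: "(\<integral>\<^sup>+x. ennreal (- g x) \<partial>\<nu>) = ennreal q" "0 \<le> q" "q \<le> b"
      using neg b by (cases "\<integral>\<^sup>+x. ennreal (- g x) \<partial>\<nu>") (auto simp: top_unique)
    have "(\<integral>x. g x \<partial>\<nu>) = p - q" using real_lebesgue_integral_def[OF ig] p q by simp
    then have "p \<le> a + b + exp (- real k)" using le q by simp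
    then show ?thesis using p Aeq by (simp add: ennreal_leI)
  qed
  have inc: "incseq A" unfolding A_def incseq_def by (auto intro!: nn_integral_mono ennreal_leI)
  have "?A = (\<integral>\<^sup>+x. (SUP k. ennreal (min (real k) (ln (F x)))) \<partial>\<nu>)"
  proof (intro nn_integral_cong antisym)
    fix x
    obtain k where "ln (F x) \<le> real k" using real_arch_simple by blast
    then show "ennreal (ln (F x)) \<le> (SUP k. ennreal (min (real k) (ln (F x))))"
      by (intro SUP_upper2[of k]) auto
  qed (auto intro!: SUP_least ennreal_leI)
  also have "\<dots> = (SUP k. A k)"
    unfolding A_def using mF
    by (intro nn_integral_monotone_convergence_SUP) (auto simp: incseq_def le_fun_def intro!: ennreal_leI)
  finally have AS: "?A = (SUP k. A k)" .
  have "A \<longlonglongrightarrow> ?A" unfolding AS by (rule LIMSEQ_SUP[OF inc])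
  moreover have "(\<lambda>k. ennreal (a + b + exp (- real k))) \<longlonglongrightarrow> ennreal (a + b + 0)"
    by (intro tendsto_ennrealI tendsto_intros) real_asymp
  ultimately have "?A \<le> ennreal (a + b)"
    using Ak by (intro LIMSEQ_le[of A]) auto
  \<comment> \<open>\<open>ennreal\<close> sends negative numbers to 0, so the sign is needed before
    returning to real numbers; the test function 0 gives 0 \<le> a.\<close>
  moreover have "0 \<le> a + b"
  proof (rule tendsto_lowerbound)
    show "(\<lambda>k. a + b + exp (- real k)) \<longlonglongrightarrow> a + b" by real_asymp
    have gen0: "0 \<le> a" using gen[of "\<lambda>_. 0" 0] by (simp add: X.prob_space)
    show "\<forall>\<^sub>F k in sequentially. 0 \<le> a + b + exp (- real k)" using gen0 b by (intro always_eventually) auto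
  qed simp
  ultimately obtain p where p: "?A = ennreal p" "0 \<le> p" "p \<le> a + b"
    by (cases ?A) (auto simp: top_unique)
  show ?thesis unfolding e p b using p b by simp
qed

section \<open>Compactness\<close>

lemma integrable_of_le_id:
  assumes "\<nu> \<in> W1_space" "f \<in> borel_measurable borel" "\<And>x. 0 \<le> x \<Longrightarrow> \<bar>f x\<bar> \<le> a + b * x"
  shows "integrable \<nu> f"
proof -
  note D = W1_spaceD[OF assms(1)]
  interpret prob_space \<nu> by (rule D(3))
  have "integrable \<nu> (\<lambda>x. a + b * x)" using D(4) by simp
  then show ?thesis
    by (rule Bochner_Integration.integrable_bound[OF _ borel_measurable_Rplus[OF D(1) assms(2)]])
       (use assms(3) D(2) in \<open>auto intro!: AE_I2 order_trans[OF assms(3) abs_ge_self]\<close>)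
qed

lemma integrable_excess:
  assumes "\<nu> \<in> W1_space" "0 \<le> r"
  shows "integrable \<nu> (\<lambda>x. max 0 (x - r))"
  by (rule integrable_of_le_id[OF assms(1), of _ 0 1]) (use assms(2) in auto)

lemma tight_of_excess_bound:
  fixes R e :: "nat \<Rightarrow> real"
  assumes \<nu>: "\<And>n. \<nu> n \<in> W1_space" and R: "\<And>k. 0 \<le> R k"
    and ex: "\<And>n k. (\<integral>x. max 0 (x - R k) \<partial>\<nu> n) \<le> e k" and e: "e \<longlonglongrightarrow> 0"
  shows "tight (\<lambda>n. distr (\<nu> n) borel (\<lambda>x. x))"
  unfolding tight_def
proof (intro conjI allI impI)
  note D = W1_spaceD[OF \<nu>]
  show rd: "real_distribution (distr (\<nu> n) borel (\<lambda>x. x))" for n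
    by (rule real_distribution_distr_id[OF D(3,1)])
  fix \<epsilon> :: real assume "0 < \<epsilon>"
  with e have "eventually (\<lambda>k. e k < \<epsilon>) sequentially" by (auto dest: order_tendstoD)
  then obtain k where k: "e k < \<epsilon>" by (auto simp: eventually_sequentially)
  \<comment> \<open>The interval is open on the left, so its endpoint must be negative to keep mass
    at 0. Beyond R k + 1 the excess over R k is at least 1 and dominates the indicator.\<close>
  have "1 - \<epsilon> < measure (distr (\<nu> n) borel (\<lambda>x. x)) {-1<..R k + 1}" for n
  proof -
    interpret prob_space "\<nu> n" by (rule D(3))
    have m: "(\<lambda>x. x) \<in> borel_measurable (\<nu> n)" by (rule borel_measurable_Rplus[OF D(1)]) simp
    let ?S = "{x \<in> space (\<nu> n). x \<le> R k + 1}"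
    have S: "?S \<in> sets (\<nu> n)" using m by measurable
    have "measure (distr (\<nu> n) borel (\<lambda>x. x)) {-1<..R k + 1} = measure (\<nu> n) ?S"
      by (subst measure_distr[OF m]) (auto simp: D(2) intro!: arg_cong[where f="measure (\<nu> n)"])
    also have "\<dots> = 1 - measure (\<nu> n) (space (\<nu> n) - ?S)"
      by (subst prob_compl[OF S]) simp
    finally have eq: "measure (distr (\<nu> n) borel (\<lambda>x. x)) {-1<..R k + 1} = 1 - measure (\<nu> n) (space (\<nu> n) - ?S)" .
    have "measure (\<nu> n) (space (\<nu> n) - ?S) = (\<integral>x. indicator (space (\<nu> n) - ?S) x \<partial>\<nu> n)"
      using S by simp
    also have "\<dots> \<le> (\<integral>x. max 0 (x - R k) \<partial>\<nu> n)"
    proof (rule integral_mono)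
      show "integrable (\<nu> n) (\<lambda>x. indicator (space (\<nu> n) - ?S) x :: real)"
        using S by (intro integrable_real_indicator) (auto simp: less_top[symmetric])
      show "integrable (\<nu> n) (\<lambda>x. max 0 (x - R k))" by (rule integrable_excess[OF \<nu> R])
    qed (auto simp: indicator_def)
    also note ex[of n k]
    finally show ?thesis using k eq by simp
  qed
  then show "\<exists>a b. a < b \<and> (\<forall>n. 1 - \<epsilon> < measure (distr (\<nu> n) borel (\<lambda>x. x)) {a<..b})"
    using R[of k] by (intro exI[of _ "-1"] exI[of _ "R k + 1"]) auto
qed

text \<open>Skorohod's coupling turns weak convergence into pointwise convergence, and the uniform bound on
  the excess provides uniform integrability.\<close>

theorem W1_relatively_compact:
  fixes R e :: "nat \<Rightarrow> real"
  assumes \<nu>: "\<And>n. \<nu> n \<in> W1_space" and R: "\<And>k. 0 \<le> R k"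
    and ex: "\<And>n k. (\<integral>x. max 0 (x - R k) \<partial>\<nu> n) \<le> e k" and e: "e \<longlonglongrightarrow> 0"
  obtains r \<mu> where "strict_mono (r :: nat \<Rightarrow> nat)" "\<mu> \<in> W1_space" "(\<lambda>n. W1_dist (\<nu> (r n)) \<mu>) \<longlonglongrightarrow> 0"
proof -
  note D = W1_spaceD[OF \<nu>]
  define \<eta> where "\<eta> n = distr (\<nu> n) borel (\<lambda>x. x)" for n
  have "tight \<eta>" unfolding \<eta>_def[abs_def] by (rule tight_of_excess_bound[OF assms])
  from tight_imp_convergent_subsubsequence[OF this strict_mono_id] obtain r M
    where r: "strict_mono (r :: nat \<Rightarrow> nat)" "real_distribution M" "weak_conv_m (\<eta> \<circ> id \<circ> r) M"
    by (auto simp: strict_mono_def)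
  have rd: "real_distribution ((\<eta> \<circ> id \<circ> r) n)" for n
    unfolding \<eta>_def comp_def id_def by (rule real_distribution_distr_id[OF D(3,1)])
  from Skorohod[OF rd r(2,3)] obtain \<Omega> :: "real measure" and Y0 :: "nat \<Rightarrow> real \<Rightarrow> real" and Y :: "real \<Rightarrow> real"
    where Sk: "prob_space \<Omega>" "\<And>n. Y0 n \<in> borel_measurable \<Omega>" "\<And>n. distr \<Omega> borel (Y0 n) = \<eta> (r n)"
     "Y \<in> measurable \<Omega> lborel" "\<And>x. x \<in> space \<Omega> \<Longrightarrow> (\<lambda>n. Y0 n x) \<longlonglongrightarrow> Y x"
    unfolding comp_def id_def by blast
  interpret \<Omega>: prob_space \<Omega> by fact
  \<comment> \<open>The Skorohod representatives are real-valued; clipping keeps their laws and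
    their pointwise convergence and puts them into the half-line.\<close>
  define X0 where "X0 n x = max 0 (Y0 n x)" for n x
  define X where "X x = max 0 (Y x)" for x
  have mY: "Y \<in> borel_measurable \<Omega>" using Sk(4) by simp
  have mX0 [measurable]: "X0 n \<in> borel_measurable \<Omega>" for n unfolding X0_def[abs_def] using Sk(2) by measurable
  have mX [measurable]: "X \<in> borel_measurable \<Omega>" unfolding X_def[abs_def] using mY by measurable
  have R0: "X0 n \<in> measurable \<Omega> Rplus" for n by (rule measurable_RplusI) (auto simp: X0_def)
  have RX: "X \<in> measurable \<Omega> Rplus" by (rule measurable_RplusI) (auto simp: X_def)
  have lim: "(\<lambda>n. X0 n x) \<longlonglongrightarrow> X x" if "x \<in> space \<Omega>" for x
    unfolding X0_def X_def by (intro tendsto_max tendsto_const Sk(5) that)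
  have max0: "max 0 \<in> measurable borel Rplus" by (rule measurable_RplusI) auto
  have d0: "distr \<Omega> Rplus (X0 n) = \<nu> (r n)" for n
  proof -
    have "distr \<Omega> Rplus (X0 n) = distr (distr \<Omega> borel (Y0 n)) Rplus (max 0)"
      using max0 Sk(2) by (simp add: distr_distr comp_def X0_def[abs_def])
    then show ?thesis using Sk(3) distr_max0_distr_id[OF D(1)] by (simp add: \<eta>_def)
  qed
  have ex0: "integrable \<Omega> (\<lambda>x. max 0 (X0 n x - R k))" "(\<integral>x. max 0 (X0 n x - R k) \<partial>\<Omega>) \<le> e k" 
    "integrable \<Omega> (X0 n)" for n k
  proof -
    have m: "(\<lambda>x. max 0 (x - R k)) \<in> borel_measurable Rplus" by (rule borel_measurable_Rplus[OF refl]) simp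
    have m': "(\<lambda>x::real. x) \<in> borel_measurable Rplus" by (rule borel_measurable_Rplus[OF refl]) simp
    show "integrable \<Omega> (\<lambda>x. max 0 (X0 n x - R k))"
      using integrable_excess[OF \<nu> R, of "r n" k] integrable_distr_eq[OF R0[of n] m] by (simp add: d0)
    show "integrable \<Omega> (X0 n)"
      using D(4)[of "r n"] integrable_distr_eq[OF R0[of n] m'] by (simp add: d0)
    show "(\<integral>x. max 0 (X0 n x - R k) \<partial>\<Omega>) \<le> e k"
      using ex[of "r n" k] integral_distr[OF R0[of n] m] by (simp add: d0)
  qed
  \<comment> \<open>Fatou's lemma transfers the excess bounds to the limit, which also yields its
    first moment.\<close>
  have exX: "(\<integral>\<^sup>+x. ennreal (max 0 (X x - R k)) \<partial>\<Omega>) \<le> ennreal (e k)" for k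
  proof -
    have "(\<integral>\<^sup>+x. ennreal (max 0 (X x - R k)) \<partial>\<Omega>) = (\<integral>\<^sup>+x. liminf (\<lambda>n. ennreal (max 0 (X0 n x - R k))) \<partial>\<Omega>)"
    proof (intro nn_integral_cong)
      fix x assume "x \<in> space \<Omega>"
      then have "(\<lambda>n. ennreal (max 0 (X0 n x - R k))) \<longlonglongrightarrow> ennreal (max 0 (X x - R k))"
        by (intro tendsto_ennrealI tendsto_intros tendsto_max lim)
      then show "ennreal (max 0 (X x - R k)) = liminf (\<lambda>n. ennreal (max 0 (X0 n x - R k)))"
        by (intro lim_imp_Liminf[symmetric]) auto
    qed
    also have "\<dots> \<le> liminf (\<lambda>n. \<integral>\<^sup>+x. ennreal (max 0 (X0 n x - R k)) \<partial>\<Omega>)"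
      by (intro nn_integral_liminf) measurable
    also have "\<dots> \<le> liminf (\<lambda>n. ennreal (e k))"
    proof (intro Liminf_mono always_eventually allI)
      fix n
      have "(\<integral>\<^sup>+x. ennreal (max 0 (X0 n x - R k)) \<partial>\<Omega>) = ennreal (\<integral>x. max 0 (X0 n x - R k) \<partial>\<Omega>)"
        by (rule nn_integral_eq_integral[OF ex0(1)]) simp
      also have "\<dots> \<le> ennreal (e k)" by (rule ennreal_leI[OF ex0(2)])
      finally show "(\<integral>\<^sup>+x. ennreal (max 0 (X0 n x - R k)) \<partial>\<Omega>) \<le> ennreal (e k)" .
    qed
    also have "\<dots> = ennreal (e k)" by (simp add: Liminf_const)
    finally show ?thesis .
  qed
  have e0: "0 \<le> e k" for k
    using ex0(2)[of 0 k] by (intro order_trans[OF _ ex0(2)[of 0 k]] integral_nonneg_AE) auto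
  have iexX: "integrable \<Omega> (\<lambda>x. max 0 (X x - R k))" "(\<integral>x. max 0 (X x - R k) \<partial>\<Omega>) \<le> e k" for k
  proof -
    show i: "integrable \<Omega> (\<lambda>x. max 0 (X x - R k))"
      using exX[of k] by (intro integrableI_nonneg) (auto simp: less_top[symmetric] top_unique)
    show "(\<integral>x. max 0 (X x - R k) \<partial>\<Omega>) \<le> e k"
      using exX[of k] e0[of k] by (subst (asm) nn_integral_eq_integral[OF i]) auto
  qed
  have X0: "0 \<le> X x" for x by (simp add: X_def)
  have iX: "integrable \<Omega> X"
  proof (rule Bochner_Integration.integrable_bound)
    show "integrable \<Omega> (\<lambda>x. max 0 (X x - R 0) + R 0)" using iexX by auto
    show "AE x in \<Omega>. norm (X x) \<le> norm (max 0 (X x - R 0) + R 0)" using X0 R[of 0] by (intro AE_I2) auto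
  qed simp
  define \<mu> where "\<mu> = distr \<Omega> Rplus X"
  have \<mu>: "\<mu> \<in> W1_space" unfolding \<mu>_def by (rule distr_in_W1_space[OF Sk(1) RX iX])
  have "(\<lambda>n. W1_dist (\<nu> (r n)) \<mu>) \<longlonglongrightarrow> 0"
  proof (rule tendstoI)
    fix \<epsilon> :: real assume \<epsilon>: "0 < \<epsilon>"
    then have "eventually (\<lambda>k. e k < \<epsilon> / 4) sequentially" using e by (intro order_tendstoD) auto
    then obtain k where k: "e k < \<epsilon> / 4" by (auto simp: eventually_sequentially)
    have "(\<lambda>n. \<integral>x. \<bar>min (X0 n x) (R k) - min (X x) (R k)\<bar> \<partial>\<Omega>) \<longlonglongrightarrow> (\<integral>x. 0 \<partial>\<Omega>)"
    proof (rule integral_dominated_convergence[where w="\<lambda>_. R k"])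
      show "AE x in \<Omega>. (\<lambda>n. \<bar>min (X0 n x) (R k) - min (X x) (R k)\<bar>) \<longlonglongrightarrow> 0"
      proof (intro AE_I2)
        fix x assume x: "x \<in> space \<Omega>"
        have "(\<lambda>n. \<bar>min (X0 n x) (R k) - min (X x) (R k)\<bar>) \<longlonglongrightarrow> \<bar>min (X x) (R k) - min (X x) (R k)\<bar>"
          by (intro tendsto_intros tendsto_min lim x)
        then show "(\<lambda>n. \<bar>min (X0 n x) (R k) - min (X x) (R k)\<bar>) \<longlonglongrightarrow> 0" by simp
      qed
      show "AE x in \<Omega>. norm \<bar>min (X0 n x) (R k) - min (X x) (R k)\<bar> \<le> R k" for n
      proof (intro AE_I2)
        fix x
        have "0 \<le> X0 n x" by (simp add: X0_def)
        then show "norm \<bar>min (X0 n x) (R k) - min (X x) (R k)\<bar> \<le> R k"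
          using R[of k] X0[of x] by (auto simp: abs_le_iff min_def)
      qed
    qed auto
    then have "eventually (\<lambda>n. (\<integral>x. \<bar>min (X0 n x) (R k) - min (X x) (R k)\<bar> \<partial>\<Omega>) < \<epsilon> / 2) sequentially"
      using \<epsilon> by (intro order_tendstoD(2)) auto
    then show "eventually (\<lambda>n. dist (W1_dist (\<nu> (r n)) \<mu>) 0 < \<epsilon>) sequentially"
    proof eventually_elim
      case (elim n)
      have im: "integrable \<Omega> (\<lambda>x. \<bar>min (X0 n x) (R k) - min (X x) (R k)\<bar>)"
        using ex0(3) iX by (intro integrable_abs Bochner_Integration.integrable_diff integrable_min) auto
      have "W1_dist (\<nu> (r n)) \<mu> \<le> (\<integral>x. \<bar>X0 n x - X x\<bar> \<partial>\<Omega>)"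
        unfolding \<mu>_def d0[symmetric] by (rule W1_dist_distr_le[OF Sk(1) R0 ex0(3) RX iX])
      \<comment> \<open>Each variable is its truncation at R k plus its excess. The truncations
        converge boundedly and get \<epsilon> / 2, the two excesses \<epsilon> / 4 each.\<close>
      also have "\<dots> \<le> (\<integral>x. \<bar>min (X0 n x) (R k) - min (X x) (R k)\<bar> + max 0 (X0 n x - R k) + max 0 (X x - R k) \<partial>\<Omega>)"
        using im ex0[of n] iX iexX by (intro integral_mono) auto
      also have "\<dots> = (\<integral>x. \<bar>min (X0 n x) (R k) - min (X x) (R k)\<bar> \<partial>\<Omega>)
          + (\<integral>x. max 0 (X0 n x - R k) \<partial>\<Omega>) + (\<integral>x. max 0 (X x - R k) \<partial>\<Omega>)"
        using im ex0[of n] iX iexX by simp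
      also have "\<dots> < \<epsilon> / 2 + \<epsilon> / 4 + \<epsilon> / 4"
        using elim ex0(2)[of n k] iexX(2)[of k] k by linarith
      finally show ?case using W1_dist_nonneg[of "\<nu> (r n)" \<mu>] by simp
    qed
  qed
  with r(1) \<mu> that show ?thesis by blast
qed

section \<open>Continuity of integrals, of the mean and of normalization along sequences\<close>

lemma integrable_Lipschitz_bdd:
  assumes "\<nu> \<in> W1_space" "Lipschitz_bdd g"
  shows "integrable \<nu> g"
proof -
  obtain B where "\<And>x. \<bar>g x\<bar> \<le> B" using Lipschitz_bddD[OF assms(2)] by metis
  then show ?thesis
    by (intro integrable_of_le_id[OF assms(1) Lipschitz_bdd_measurable[OF assms(2)], of B 0]) simp
qed

lemma tendsto_integral_Lipschitz:
  assumes \<nu>: "\<And>n. \<nu> n \<in> W1_space" and \<mu>: "\<mu> \<in> W1_space" and lim: "(\<lambda>n. W1_dist (\<nu> n) \<mu>) \<longlonglongrightarrow> 0"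
    and g: "g \<in> borel_measurable borel" "\<And>x y. 0 \<le> x \<Longrightarrow> 0 \<le> y \<Longrightarrow> \<bar>g x - g y\<bar> \<le> L * \<bar>x - y\<bar>"
    and int: "\<And>n. integrable (\<nu> n) g" "integrable \<mu> g"
  shows "(\<lambda>n. \<integral>x. g x \<partial>\<nu> n) \<longlonglongrightarrow> (\<integral>x. g x \<partial>\<mu>)"
proof -
  have "(\<lambda>n. (\<integral>x. g x \<partial>\<nu> n) - (\<integral>x. g x \<partial>\<mu>)) \<longlonglongrightarrow> 0"
  proof (rule Lim_null_comparison)
    show "eventually (\<lambda>n. norm ((\<integral>x. g x \<partial>\<nu> n) - (\<integral>x. g x \<partial>\<mu>)) \<le> L * W1_dist (\<nu> n) \<mu>) sequentially"
      using integral_Lipschitz_diff_le[OF \<nu> \<mu> g int] by (intro always_eventually allI) simp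
    show "(\<lambda>n. L * W1_dist (\<nu> n) \<mu>) \<longlonglongrightarrow> 0" using tendsto_mult_left[OF lim, of L] by simp
  qed
  then show ?thesis by (rule LIM_zero_cancel)
qed

lemma tendsto_integral_Lipschitz_bdd:
  assumes \<nu>: "\<And>n. \<nu> n \<in> W1_space" and \<mu>: "\<mu> \<in> W1_space" and lim: "(\<lambda>n. W1_dist (\<nu> n) \<mu>) \<longlonglongrightarrow> 0"
    and g: "Lipschitz_bdd g"
  shows "(\<lambda>n. \<integral>x. g x \<partial>\<nu> n) \<longlonglongrightarrow> (\<integral>x. g x \<partial>\<mu>)"
proof -
  obtain L where "\<And>x y. \<bar>g x - g y\<bar> \<le> L * \<bar>x - y\<bar>" using Lipschitz_bddD[OF g] by metis
  then show ?thesis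
    by (rule tendsto_integral_Lipschitz[OF \<nu> \<mu> lim Lipschitz_bdd_measurable[OF g] _
        integrable_Lipschitz_bdd[OF \<nu> g] integrable_Lipschitz_bdd[OF \<mu> g]])
qed

lemma tendsto_mean:
  assumes \<nu>: "\<And>n. \<nu> n \<in> W1_space" and \<mu>: "\<mu> \<in> W1_space" and lim: "(\<lambda>n. W1_dist (\<nu> n) \<mu>) \<longlonglongrightarrow> 0"
  shows "(\<lambda>n. mean (\<nu> n)) \<longlonglongrightarrow> mean \<mu>"
  by (rule tendsto_integral_Lipschitz[OF \<nu> \<mu> lim _ _ W1_spaceD(4)[OF \<nu>] W1_spaceD(4)[OF \<mu>], of 1]) auto

text \<open>The common lower bound d on the means turns the pointwise Lipschitz estimate for
  normalization into a uniform one.\<close>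

lemma tendsto_normalize_law:
  assumes \<nu>: "\<And>n. \<nu> n \<in> W1_space" "\<And>n. d \<le> mean (\<nu> n)" and d: "0 < d"
    and \<mu>: "\<mu> \<in> W1_space" "0 < mean \<mu>" and lim: "(\<lambda>n. W1_dist (\<nu> n) \<mu>) \<longlonglongrightarrow> 0"
  shows "(\<lambda>n. W1_dist (normalize_law (\<nu> n)) (normalize_law \<mu>)) \<longlonglongrightarrow> 0"
proof (rule Lim_null_comparison)
  show "eventually (\<lambda>n. norm (W1_dist (normalize_law (\<nu> n)) (normalize_law \<mu>)) \<le> 2 / d * W1_dist (\<nu> n) \<mu>) sequentially"
  proof (intro always_eventually allI)
    fix n
    have "W1_dist (normalize_law (\<nu> n)) (normalize_law \<mu>) \<le> 2 * W1_dist (\<nu> n) \<mu> / mean (\<nu> n)"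
      by (rule W1_dist_normalize_law_le[OF \<nu>(1) \<mu>(1) less_le_trans[OF d \<nu>(2)] \<mu>(2)])
    also have "\<dots> \<le> 2 * W1_dist (\<nu> n) \<mu> / d"
      using \<nu>(2)[of n] d W1_dist_nonneg[of "\<nu> n" \<mu>] less_le_trans[OF d \<nu>(2)[of n]]
      by (intro divide_left_mono mult_pos_pos) simp_all
    finally show "norm (W1_dist (normalize_law (\<nu> n)) (normalize_law \<mu>)) \<le> 2 / d * W1_dist (\<nu> n) \<mu>"
      using W1_dist_nonneg by simp
  qed
  show "(\<lambda>n. 2 / d * W1_dist (\<nu> n) \<mu>) \<longlonglongrightarrow> 0" using tendsto_mult_left[OF lim, of "2 / d"] by simp
qed

text \<open>The assumption \<open>exp_small\<close> is the form in which \<open>\<Lambda>\<^sup>*(0) = \<infinity>\<close> is used.\<close>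

locale exp_moments =
  fixes \<xi> :: "real measure"
  assumes prob: "prob_space \<xi>" and sets_xi: "sets \<xi> = sets Rplus"
    and exp_finite: "\<And>\<alpha>. \<alpha> > 0 \<Longrightarrow> (\<integral>\<^sup>+x. ennreal (exp (\<alpha> * x)) \<partial>\<xi>) < \<infinity>"
    and exp_small: "\<And>\<epsilon>. \<epsilon> > 0 \<Longrightarrow> \<exists>l>0. (\<integral>\<^sup>+x. ennreal (exp (- (l * x))) \<partial>\<xi>) \<le> ennreal \<epsilon>"
begin

interpretation X: prob_space \<xi> by (rule prob)

lemmas meas = borel_measurable_Rplus[OF sets_xi]

text \<open>As the cutoff grows the integrand decreases to 1, dominated by exp (l * x), so the
  integral tends to 1. The bound 2 lies above this limit and below e, so that a unit in the exponent
  absorbs it later.\<close>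

lemma exp_excess_le_2:
  assumes l: "0 < l"
  shows "\<exists>R\<ge>0. (\<integral>\<^sup>+x. ennreal (exp (l * max 0 (x - R))) \<partial>\<xi>) \<le> ennreal 2"
proof -
  have sp: "space \<xi> = {0..}" by (rule space_Rplus_cong[OF sets_xi])
  have "(\<lambda>n. \<integral>\<^sup>+x. ennreal (exp (l * max 0 (x - real n))) \<partial>\<xi>) \<longlonglongrightarrow> (\<integral>\<^sup>+x. 1 \<partial>\<xi>)"
  proof (rule nn_integral_dominated_convergence[where w="\<lambda>x. ennreal (exp (l * x))"])
    show "AE x in \<xi>. (\<lambda>n. ennreal (exp (l * max 0 (x - real n)))) \<longlonglongrightarrow> 1"
    proof (intro AE_I2 tendsto_eventually)
      fix x :: real
      have "eventually (\<lambda>n. x \<le> real n) sequentially" by real_asymp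
      then show "eventually (\<lambda>n. ennreal (exp (l * max 0 (x - real n))) = 1) sequentially"
        by eventually_elim simp
    qed
    show "AE x in \<xi>. ennreal (exp (l * max 0 (x - real n))) \<le> ennreal (exp (l * x))" for n
      using l by (intro AE_I2 ennreal_leI) (auto simp: sp)
    show "(\<integral>\<^sup>+x. ennreal (exp (l * x)) \<partial>\<xi>) < \<infinity>" using exp_finite[OF l] .
    show "(\<lambda>x. ennreal (exp (l * max 0 (x - real n)))) \<in> borel_measurable \<xi>" for n by (rule meas) measurable
    show "(\<lambda>x. ennreal (exp (l * x))) \<in> borel_measurable \<xi>" by (rule meas) measurable
  qed simp
  then have "(\<lambda>n. \<integral>\<^sup>+x. ennreal (exp (l * max 0 (x - real n))) \<partial>\<xi>) \<longlonglongrightarrow> 1"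
    by (simp add: X.emeasure_space_1)
  then have "eventually (\<lambda>n. (\<integral>\<^sup>+x. ennreal (exp (l * max 0 (x - real n))) \<partial>\<xi>) < 2) sequentially"
    by (rule order_tendstoD) (simp add: one_less_numeral_iff)
  then obtain n where "(\<integral>\<^sup>+x. ennreal (exp (l * max 0 (x - real n))) \<partial>\<xi>) < 2"
    by (auto simp: eventually_sequentially)
  then show ?thesis by (intro exI[of _ "real n"]) (auto intro: less_imp_le)
qed

text \<open>The exponents \<open>(k + 1)\<^sup>2\<close> make the mean excess over \<open>cutoff k\<close> at most \<open>(a + k + 1) / (k + 1)\<^sup>2\<close>,
  which tends to 0, while the exceptional probabilities stay summable in \<open>k\<close>.\<close>

definition cutoff :: "nat \<Rightarrow> real" where
  "cutoff k = (SOME R. 0 \<le> R \<and> (\<integral>\<^sup>+x. ennreal (exp ((real k + 1)\<^sup>2 * max 0 (x - R))) \<partial>\<xi>) \<le> ennreal 2)"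

lemma cutoff: "0 \<le> cutoff k" "(\<integral>\<^sup>+x. ennreal (exp ((real k + 1)\<^sup>2 * max 0 (x - cutoff k))) \<partial>\<xi>) \<le> ennreal 2"
proof -
  have "\<exists>R. 0 \<le> R \<and> (\<integral>\<^sup>+x. ennreal (exp ((real k + 1)\<^sup>2 * max 0 (x - R))) \<partial>\<xi>) \<le> ennreal 2"
    using exp_excess_le_2[of "(real k + 1)\<^sup>2"] by (auto simp: zero_less_power2)
  from someI_ex[OF this]
  show "0 \<le> cutoff k" "(\<integral>\<^sup>+x. ennreal (exp ((real k + 1)\<^sup>2 * max 0 (x - cutoff k))) \<partial>\<xi>) \<le> ennreal 2"
    unfolding cutoff_def by blast+
qed

text \<open>The rate l makes a mean below 1 / l exponentially unlikely: Chernoff's inequality with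
  test function -l x and threshold -1 loses a factor e per sample, which the extra 1 in the exponent
  pays for, leaving exp (-a).\<close>

definition rate_const :: "real \<Rightarrow> real" where
  "rate_const a = (SOME l. 0 < l \<and> (\<integral>\<^sup>+x. ennreal (exp (- (l * x))) \<partial>\<xi>) \<le> ennreal (exp (- (a + 1))))"

lemma rate_const: "0 < rate_const a" "(\<integral>\<^sup>+x. ennreal (exp (- (rate_const a * x))) \<partial>\<xi>) \<le> ennreal (exp (- (a + 1)))"
proof -
  have "\<exists>l. 0 < l \<and> (\<integral>\<^sup>+x. ennreal (exp (- (l * x))) \<partial>\<xi>) \<le> ennreal (exp (- (a + 1)))"
    using exp_small[of "exp (- (a + 1))"] by auto
  from someI_ex[OF this]
  show "0 < rate_const a" "(\<integral>\<^sup>+x. ennreal (exp (- (rate_const a * x))) \<partial>\<xi>) \<le> ennreal (exp (- (a + 1)))"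
    unfolding rate_const_def by blast+
qed

text \<open>All constraints are linear in the law, with Lipschitz integrands. They therefore pass to
  Wasserstein limits and can be tested both by entropy and by sums over a sample. The last one keeps
  the set away from the Dirac measure at 0.\<close>

definition tight_set :: "real \<Rightarrow> real measure set" where
  "tight_set a = {\<nu> \<in> W1_space. (\<forall>k. (real k + 1)\<^sup>2 * (\<integral>x. max 0 (x - cutoff k) \<partial>\<nu>) \<le> a + real k + 1)
     \<and> 1 \<le> rate_const a * mean \<nu>}"

lemma tight_set_mean: "\<nu> \<in> tight_set a \<Longrightarrow> 1 / rate_const a \<le> mean \<nu>"
  using rate_const(1)[of a] by (auto simp: tight_set_def field_simps)

lemma tight_setD: "\<nu> \<in> tight_set a \<Longrightarrow> \<nu> \<in> W1_space"
  by (simp add: tight_set_def)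

text \<open>The excess bounds provide a convergent subsequence, and the limit stays in the set
  because each constraint is continuous in the law.\<close>

lemma tight_set_sequentially_compact:
  assumes "\<And>n. \<nu> n \<in> tight_set a"
  obtains r \<mu> where "strict_mono (r :: nat \<Rightarrow> nat)" "\<mu> \<in> tight_set a" "(\<lambda>n. W1_dist (\<nu> (r n)) \<mu>) \<longlonglongrightarrow> 0"
proof -
  have W: "\<nu> n \<in> W1_space" for n using assms by (rule tight_setD)
  define e where "e k = (a + real k + 1) / (real k + 1)\<^sup>2" for k
  have e: "e \<longlonglongrightarrow> 0" unfolding e_def[abs_def] by real_asymp
  have ex: "(\<integral>x. max 0 (x - cutoff k) \<partial>\<nu> n) \<le> e k" for n k
    using assms[of n] by (auto simp: tight_set_def e_def pos_le_divide_eq mult.commute zero_less_power2)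
  obtain r \<mu> where r: "strict_mono r" "\<mu> \<in> W1_space" "(\<lambda>n. W1_dist (\<nu> (r n)) \<mu>) \<longlonglongrightarrow> 0"
    by (rule W1_relatively_compact[OF W cutoff(1) ex e])
  have "\<mu> \<in> tight_set a"
    unfolding tight_set_def
  proof (intro CollectI conjI allI)
    fix k
    have "(\<lambda>n. \<integral>x. max 0 (x - cutoff k) \<partial>\<nu> (r n)) \<longlonglongrightarrow> (\<integral>x. max 0 (x - cutoff k) \<partial>\<mu>)"
      by (rule tendsto_integral_Lipschitz[OF W r(2,3), of _ 1])
         (auto intro!: integrable_excess W r(2) cutoff(1))
    then have "(\<lambda>n. (real k + 1)\<^sup>2 * (\<integral>x. max 0 (x - cutoff k) \<partial>\<nu> (r n))) \<longlonglongrightarrow> (real k + 1)\<^sup>2 * (\<integral>x. max 0 (x - cutoff k) \<partial>\<mu>)"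
      by (intro tendsto_intros)
    then show "(real k + 1)\<^sup>2 * (\<integral>x. max 0 (x - cutoff k) \<partial>\<mu>) \<le> a + real k + 1"
      by (rule LIMSEQ_le_const2) (use assms[unfolded tight_set_def] in blast)
  next
    have "(\<lambda>n. rate_const a * mean (\<nu> (r n))) \<longlonglongrightarrow> rate_const a * mean \<mu>"
      by (intro tendsto_intros tendsto_mean W r)
    then show "1 \<le> rate_const a * mean \<mu>"
      by (rule LIMSEQ_le_const) (use assms[unfolded tight_set_def] in blast)
  qed (rule r(2))
  with r that show ?thesis by blast
qed

text \<open>Each constraint is the variational inequality for one unbounded test function, with the
  exponential integrals bounded by the choice of \<open>cutoff\<close> and
  \<open>rate_const\<close>; ln 2 \<le> 1 leaves room in the excess constraints.\<close>

lemma rel_entropy_le_imp_tight: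
  assumes \<nu>: "\<nu> \<in> W1_space" and H: "rel_entropy \<nu> \<xi> \<le> ereal a"
  shows "\<nu> \<in> tight_set a"
  unfolding tight_set_def
proof (intro CollectI conjI allI)
  fix k
  have "(\<integral>x. (real k + 1)\<^sup>2 * max 0 (x - cutoff k) \<partial>\<nu>) \<le> a + ln 2"
    by (rule rel_entropy_variational[OF \<nu> prob sets_xi H _ _ cutoff(2)])
       (auto intro!: integrable_mult_right integrable_excess[OF \<nu>] cutoff(1))
  also have "\<dots> \<le> a + real k + 1" using ln_le_minus_one[of 2] by simp
  finally show "(real k + 1)\<^sup>2 * (\<integral>x. max 0 (x - cutoff k) \<partial>\<nu>) \<le> a + real k + 1" by simp
next
  have "(\<integral>x. - (rate_const a * x) \<partial>\<nu>) \<le> a + ln (exp (- (a + 1)))"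
    by (rule rel_entropy_variational[OF \<nu> prob sets_xi H _ _ rate_const(2)])
       (simp_all add: W1_spaceD(4)[OF \<nu>])
  then show "1 \<le> rate_const a * mean \<nu>" by simp
qed (rule \<nu>)

text \<open>Every variational inequality with a bounded Lipschitz function passes to the limit, and
  together these inequalities bound the entropy.\<close>

lemma rel_entropy_lsc:
  assumes \<nu>: "\<And>n. \<nu> n \<in> W1_space" and \<mu>: "\<mu> \<in> W1_space" and lim: "(\<lambda>n. W1_dist (\<nu> n) \<mu>) \<longlonglongrightarrow> 0"
    and H: "eventually (\<lambda>n. rel_entropy (\<nu> n) \<xi> \<le> ereal a) sequentially"
  shows "rel_entropy \<mu> \<xi> \<le> ereal a"
proof (rule rel_entropy_le_of_Lipschitz_bdd)
  show "prob_space \<mu>" "sets \<mu> = sets Rplus" "prob_space \<xi>" "sets \<xi> = sets Rplus"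
    by (rule W1_spaceD(3)[OF \<mu>] W1_spaceD(1)[OF \<mu>] prob sets_xi)+
  fix g assume g: "Lipschitz_bdd g"
  obtain B where B: "\<And>x. \<bar>g x\<bar> \<le> B" using Lipschitz_bddD[OF g] by metis
  note m = Lipschitz_bdd_measurable[OF g] and int = integrable_Lipschitz_bdd[OF _ g]
  note Z = exp_bounded_integral(3,2)[OF prob meas[OF Lipschitz_bdd_measurable[OF g]] B]
  show "(\<integral>x. g x \<partial>\<mu>) \<le> a + ln (\<integral>x. exp (g x) \<partial>\<xi>)"
  proof (rule tendsto_upperbound[OF tendsto_integral_Lipschitz_bdd[OF \<nu> \<mu> lim g]])
    show "eventually (\<lambda>n. (\<integral>x. g x \<partial>\<nu> n) \<le> a + ln (\<integral>x. exp (g x) \<partial>\<xi>)) sequentially"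
      using H
    proof eventually_elim
      case (elim n)
      show ?case by (rule rel_entropy_variational[OF \<nu> prob sets_xi elim m int[OF \<nu>] Z])
    qed
  qed simp
qed

lemma rate_W_normalize_law_le:
  assumes "\<nu> \<in> W1_space" "0 < mean \<nu>"
  shows "rate_W \<xi> (normalize_law \<nu>) \<le> rel_entropy \<nu> \<xi>"
  unfolding rate_W_def
  by (rule INF_lower2[of "mean \<nu>"]) (use assms in \<open>auto simp: G_scale_normalize_law\<close>)

lemma rate_W_nonneg:
  assumes "\<rho> \<in> M11"
  shows "0 \<le> rate_W \<xi> \<rho>"
  unfolding rate_W_def
proof (rule INF_greatest)
  fix m :: real assume "m \<in> {0<..}"
  then have "G_scale \<rho> (1 / m) \<in> W1_space" using assms M11_subset by (intro G_scale_in_W1_space) auto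
  from W1_spaceD(1,3)[OF this] show "0 \<le> rel_entropy (G_scale \<rho> (1 / m)) \<xi>"
    using prob sets_xi by (intro rel_entropy_nonneg) auto
qed

text \<open>The sequence is lifted to laws of small entropy, which lie in one
  \<open>tight_set\<close>; a subsequence of the lifts converges, and normalization maps it to a
  convergent subsequence of the given one.\<close>

lemma compactin_rate_W_sublevel:
  "compactin M11.mtopology {\<rho> \<in> M11. rate_W \<xi> \<rho> \<le> ereal \<alpha>}"
  unfolding M11.compactin_sequentially
proof (intro conjI allI impI)
  fix \<sigma> :: "nat \<Rightarrow> real measure" assume \<sigma>: "range \<sigma> \<subseteq> {\<rho> \<in> M11. rate_W \<xi> \<rho> \<le> ereal \<alpha>}"
  then have \<sigma>M: "\<sigma> n \<in> M11" for n by auto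
  \<comment> \<open>Attainment of the infimum over m is not known here. The slack 1 / (n + 1)
    vanishes along the subsequence, so semicontinuity restores the level \<alpha>.\<close>
  have "\<exists>m>0. rel_entropy (G_scale (\<sigma> n) (1 / m)) \<xi> \<le> ereal (\<alpha> + 1 / (real n + 1))" for n
  proof -
    have "rate_W \<xi> (\<sigma> n) \<le> ereal \<alpha>" using \<sigma> by auto
    also have "\<dots> < ereal (\<alpha> + 1 / (real n + 1))" by simp
    finally show ?thesis unfolding rate_W_def by (auto simp: INF_less_iff intro: less_imp_le)
  qed
  then obtain m where m: "\<And>n. m n > 0" "\<And>n. rel_entropy (G_scale (\<sigma> n) (1 / m n)) \<xi> \<le> ereal (\<alpha> + 1 / (real n + 1))"
    by metis
  define \<nu> where "\<nu> n = G_scale (\<sigma> n) (1 / m n)" for n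
  have \<nu>: "\<nu> n \<in> W1_space" "normalize_law (\<nu> n) = \<sigma> n" for n
    unfolding \<nu>_def
    by (rule G_scale_in_W1_space[OF subsetD[OF M11_subset \<sigma>M]], simp add: m(1))
       (rule normalize_law_G_scale[OF \<sigma>M m(1)])
  have "\<nu> n \<in> tight_set (\<alpha> + 1)" for n
  proof (rule rel_entropy_le_imp_tight[OF \<nu>(1)])
    have "ereal (\<alpha> + 1 / (real n + 1)) \<le> ereal (\<alpha> + 1)" by simp
    with m(2)[of n] show "rel_entropy (\<nu> n) \<xi> \<le> ereal (\<alpha> + 1)" unfolding \<nu>_def by (rule order_trans)
  qed
  note tight = this
  obtain r \<mu> where r: "strict_mono (r :: nat \<Rightarrow> nat)" "\<mu> \<in> tight_set (\<alpha> + 1)" "(\<lambda>n. W1_dist (\<nu> (r n)) \<mu>) \<longlonglongrightarrow> 0"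
    by (rule tight_set_sequentially_compact[OF tight])
  let ?d = "1 / rate_const (\<alpha> + 1)"
  have d: "0 < ?d" using rate_const(1) by simp
  have \<mu>: "\<mu> \<in> W1_space" "0 < mean \<mu>"
    using tight_setD[OF r(2)] less_le_trans[OF d tight_set_mean[OF r(2)]] by auto
  have "rel_entropy \<mu> \<xi> \<le> ereal \<alpha>"
  proof (rule ereal_le_epsilon2)
    fix e :: real assume e: "0 < e"
    have "rel_entropy \<mu> \<xi> \<le> ereal (\<alpha> + e)"
    proof (rule rel_entropy_lsc[OF \<nu>(1) \<mu>(1) r(3)])
      have "eventually (\<lambda>n. 1 / (real n + 1) < e) sequentially" using e by real_asymp
      then have "eventually (\<lambda>n. 1 / (real (r n) + 1) < e) sequentially"
        using r(1) by (rule eventually_subseq[rotated])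
      then show "eventually (\<lambda>n. rel_entropy (\<nu> (r n)) \<xi> \<le> ereal (\<alpha> + e)) sequentially"
      proof eventually_elim
        case (elim n)
        then have "ereal (\<alpha> + 1 / (real (r n) + 1)) \<le> ereal (\<alpha> + e)" by simp
        with m(2)[of "r n"] show ?case unfolding \<nu>_def by (rule order_trans)
      qed
    qed
    then show "rel_entropy \<mu> \<xi> \<le> ereal \<alpha> + ereal e" by simp
  qed
  then have "rate_W \<xi> (normalize_law \<mu>) \<le> ereal \<alpha>"
    using rate_W_normalize_law_le[OF \<mu>] by (rule order_trans[rotated])
  moreover have nM: "normalize_law \<mu> \<in> M11" by (rule normalize_law_in_M11[OF \<mu>])
  moreover have "limitin M11.mtopology (\<sigma> \<circ> r) (normalize_law \<mu>) sequentially"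
  proof -
    have "(\<lambda>n. W1_dist (normalize_law (\<nu> (r n))) (normalize_law \<mu>)) \<longlonglongrightarrow> 0"
      by (rule tendsto_normalize_law[OF \<nu>(1) tight_set_mean[OF tight] d \<mu> r(3)])
    then show ?thesis unfolding M11.limitin_metric_dist_null using nM \<sigma>M \<nu>(2) by (simp add: comp_def)
  qed
  ultimately show "\<exists>l r. l \<in> {\<rho> \<in> M11. rate_W \<xi> \<rho> \<le> ereal \<alpha>} \<and> strict_mono r \<and> limitin M11.mtopology (\<sigma> \<circ> r) l sequentially"
    using r(1) by blast
qed auto

text \<open>Lower semicontinuity comes for free from compact sublevels, which are closed because the
  space is Hausdorff.\<close>

lemma good_rate_function_rate_W: "good_rate_function M11.mtopology (rate_W \<xi>)"
proof -
  have cl: "closedin M11.mtopology {\<rho> \<in> M11. rate_W \<xi> \<rho> \<le> ereal \<alpha>}" for \<alpha>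
    by (rule compactin_imp_closedin[OF M11.Hausdorff_space_mtopology compactin_rate_W_sublevel])
  have "openin M11.mtopology {\<rho> \<in> M11. a < rate_W \<xi> \<rho>}" for a
  proof (cases a)
    case (real \<alpha>)
    have "{\<rho> \<in> M11. a < rate_W \<xi> \<rho>} = topspace M11.mtopology - {\<rho> \<in> M11. rate_W \<xi> \<rho> \<le> ereal \<alpha>}"
      using real by auto
    then show ?thesis using cl[of \<alpha>] by (simp only: openin_diff openin_topspace)
  next
    case MInf
    then have "{\<rho> \<in> M11. a < rate_W \<xi> \<rho>} = topspace M11.mtopology"
      using rate_W_nonneg by (auto intro: less_le_trans[of _ 0])
    then show ?thesis by (simp only: openin_topspace)
  qed simp
  then show ?thesis
    unfolding good_rate_function_def rate_function_def
    using rate_W_nonneg compactin_rate_W_sublevel by simp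
qed

end

section \<open>Empirical measures of independent samples\<close>

declare One_nat_def [simp del]

lemma sets_empirical_measure: "sets (empirical_measure n w) = sets Rplus"
  unfolding empirical_measure_def by (rule sigma_algebra.sets_measure_of_eq[OF sets.sigma_algebra_axioms])

text \<open>An empirical measure is the law of w at a uniformly chosen index, so coupling estimates
  and change of variables apply to it.\<close>

lemma empirical_measure_eq_distr:
  assumes "1 \<le> n" "w \<in> {1..n} \<rightarrow> {0..}"
  shows "empirical_measure n w = distr (uniform_count_measure {1..n}) Rplus w"
    and "w \<in> measurable (uniform_count_measure {1..n}) Rplus"
proof -
  let ?U = "uniform_count_measure {1..n}"
  show w: "w \<in> measurable ?U Rplus"
    using assms by (auto simp: measurable_def space_uniform_count_measure sets_uniform_count_measure space_restrict_space)
  show "empirical_measure n w = distr ?U Rplus w"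
  proof (rule measure_eqI)
    show "sets (empirical_measure n w) = sets (distr ?U Rplus w)"
      by (simp add: sets_empirical_measure)
    fix A assume "A \<in> sets (empirical_measure n w)"
    then have A: "A \<in> sets Rplus" by (simp add: sets_empirical_measure)
    have "emeasure (distr ?U Rplus w) A = emeasure ?U (w -` A \<inter> {1..n})"
      using emeasure_distr[OF w A] by (simp add: space_uniform_count_measure)
    also have "\<dots> = ennreal (real (card (w -` A \<inter> {1..n})) / real n)"
      by (subst emeasure_uniform_count_measure) auto
    also have "real (card (w -` A \<inter> {1..n})) = (\<Sum>i=1..n. indicator A (w i))"
    proof -
      have "real (card (w -` A \<inter> {1..n})) = (\<Sum>i\<in>w -` A \<inter> {1..n}. 1)" by simp
      also have "\<dots> = (\<Sum>i=1..n. indicator A (w i))" by (rule sum.mono_neutral_cong_left) (auto simp: indicator_def)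
      finally show ?thesis .
    qed
    also have "ennreal ((\<Sum>i=1..n. indicator A (w i)) / real n) = ennreal (1 / real n) * ennreal (\<Sum>i=1..n. indicator A (w i))"
      by (subst ennreal_mult'[symmetric]) auto
    also have "ennreal (\<Sum>i=1..n. indicator A (w i)) = (\<Sum>i=1..n. indicator A (w i))"
      by (subst sum_ennreal[symmetric]) (auto simp: ennreal_indicator)
    finally show "emeasure (empirical_measure n w) A = emeasure (distr ?U Rplus w) A"
      using emeasure_empirical_measure[OF A] by simp
  qed
qed

lemma prob_space_uniform_count: "1 \<le> n \<Longrightarrow> prob_space (uniform_count_measure {1..n::nat})"
  by (intro prob_space_uniform_count_measure) auto

lemma integrable_uniform_count:
  fixes f :: "nat \<Rightarrow> real"
  shows "integrable (uniform_count_measure {1..n}) f"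
  unfolding uniform_count_measure_def by (rule integrable_point_measure_finite) simp

lemma empirical_measure_in_W1_space:
  assumes "1 \<le> n" "w \<in> {1..n} \<rightarrow> {0..}"
  shows "empirical_measure n w \<in> W1_space"
  using empirical_measure_eq_distr[of n w, OF assms]
  by (simp only: distr_in_W1_space[OF prob_space_uniform_count[OF assms(1)] _ integrable_uniform_count])

lemma integral_empirical_measure:
  fixes g :: "real \<Rightarrow> real"
  assumes "1 \<le> n" "w \<in> {1..n} \<rightarrow> {0..}" "g \<in> borel_measurable borel"
  shows "(\<integral>x. g x \<partial>empirical_measure n w) = (\<Sum>i=1..n. g (w i)) / real n"
proof -
  have "(\<integral>x. g x \<partial>empirical_measure n w) = (\<integral>i. g (w i) \<partial>uniform_count_measure {1..n})"
    using empirical_measure_eq_distr[of n w, OF assms(1,2)]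
    by (simp only: integral_distr[OF _ borel_measurable_Rplus[OF refl assms(3)]])
  then show ?thesis by (simp add: integral_uniform_count_measure)
qed

lemma mean_empirical_measure:
  assumes "1 \<le> n" "w \<in> {1..n} \<rightarrow> {0..}"
  shows "mean (empirical_measure n w) = 1 / real n * (\<Sum>i=1..n. w i)"
  using integral_empirical_measure[of n w "\<lambda>x. x", OF assms] by simp

lemma cdfp_empirical_measure:
  assumes "1 \<le> n" "w \<in> {1..n} \<rightarrow> {0..}"
  shows "cdfp (empirical_measure n w) t = (\<Sum>i=1..n. indicator {w i..} t) / real n"
proof -
  note E = empirical_measure_eq_distr[of n w, OF assms]
  have "cdfp (empirical_measure n w) t = (\<integral>i. indicator {w i..} t \<partial>uniform_count_measure {1..n})"
    unfolding E(1) cdfp_distr[OF E(2)]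
    by (rule cdf_distr_eq_expectation[OF prob_space_uniform_count[OF assms(1)] borel_measurable_of_Rplus[OF E(2)]])
  then show ?thesis by (simp add: integral_uniform_count_measure)
qed

text \<open>Choosing the same random index for both samples is a coupling.\<close>

lemma W1_dist_empirical_measure_le:
  assumes "1 \<le> n" "w \<in> {1..n} \<rightarrow> {0..}" "v \<in> {1..n} \<rightarrow> {0..}"
  shows "W1_dist (empirical_measure n w) (empirical_measure n v) \<le> (\<Sum>i=1..n. \<bar>w i - v i\<bar>) / real n"
proof -
  note E = empirical_measure_eq_distr[of n w, OF assms(1,2)] empirical_measure_eq_distr[of n v, OF assms(1,3)]
  have "W1_dist (empirical_measure n w) (empirical_measure n v) \<le> (\<integral>i. \<bar>w i - v i\<bar> \<partial>uniform_count_measure {1..n})"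
    unfolding E(1,3)
    by (rule W1_dist_distr_le[OF prob_space_uniform_count[OF assms(1)] E(2) integrable_uniform_count E(4) integrable_uniform_count])
  then show ?thesis by (simp add: integral_uniform_count_measure)
qed

lemma normalize_law_empirical_measure:
  assumes "1 \<le> n" "w \<in> {1..n} \<rightarrow> {0..}" "0 < (\<Sum>i=1..n. w i)"
  shows "normalize_law (empirical_measure n w) = empirical_measure n (\<lambda>i. w i / (1 / real n * (\<Sum>j=1..n. w j)))"
proof -
  let ?m = "1 / real n * (\<Sum>i=1..n. w i)"
  have m: "0 < ?m" using assms by simp
  have w': "(\<lambda>i. w i / ?m) \<in> {1..n} \<rightarrow> {0..}"
  proof (rule Pi_I)
    fix i assume "i \<in> {1..n}"
    then have "0 \<le> w i" using assms(2) by (simp add: Pi_iff)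
    from divide_nonneg_pos[OF this m] show "w i / ?m \<in> {0..}" by (simp only: atLeast_iff)
  qed
  note E = empirical_measure_eq_distr[of n w, OF assms(1,2)]
  have "normalize_law (empirical_measure n w) = G_scale (empirical_measure n w) ?m"
    unfolding normalize_law_def mean_empirical_measure[OF assms(1,2)] ..
  also have "\<dots> = distr (distr (uniform_count_measure {1..n}) Rplus w) Rplus (\<lambda>x. x / ?m)"
    unfolding E(1) G_scale_def ..
  also have "\<dots> = distr (uniform_count_measure {1..n}) Rplus (\<lambda>i. w i / ?m)"
    unfolding distr_distr[OF measurable_scale[OF m] E(2)] comp_def ..
  also have "\<dots> = empirical_measure n (\<lambda>i. w i / ?m)"
    by (rule empirical_measure_eq_distr(1)[OF assms(1) w', symmetric])
  finally show ?thesis .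
qed

abbreviation iid :: "nat \<Rightarrow> real measure \<Rightarrow> (nat \<Rightarrow> real) measure" where
  "iid n N \<equiv> PiM {1..n} (\<lambda>_. N)"

lemma iid_nonneg:
  assumes "sets N = sets Rplus" "y \<in> space (iid n N)"
  shows "y \<in> {1..n} \<rightarrow> {0..}"
  using assms(2) space_Rplus_cong[OF assms(1)] by (auto simp: space_PiM PiE_iff)

lemma measurable_sample_component:
  assumes "sets N = sets Rplus" "i \<in> {1..n}"
  shows "(\<lambda>y. y i) \<in> borel_measurable (iid n N)"
proof -
  have "(\<lambda>x::real. x) \<in> borel_measurable N" by (rule borel_measurable_Rplus[OF assms(1)]) simp
  from measurable_compose[OF measurable_component_singleton[OF assms(2)] this] show ?thesis by simp
qed

text \<open>The indicator of the event is at most the product of exp (g (y i) - c), whose integral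
  factorizes. Spreading c over the coordinates makes the bound an n-th power.\<close>

lemma chernoff_sample:
  fixes g :: "real \<Rightarrow> real"
  assumes N: "prob_space N" "sets N = sets Rplus" and g: "g \<in> borel_measurable borel"
    and Z: "(\<integral>\<^sup>+x. ennreal (exp (g x)) \<partial>N) \<le> ennreal Z" "0 \<le> Z"
  shows "emeasure (iid n N) {y \<in> space (iid n N). real n * c \<le> (\<Sum>i=1..n. g (y i))}
     \<le> ennreal ((Z * exp (- c)) ^ n)"
proof -
  interpret N: prob_space N by fact
  interpret P: product_sigma_finite "\<lambda>_::nat. N" by standard
  let ?Q = "iid n N"
  let ?A = "{y \<in> space ?Q. real n * c \<le> (\<Sum>i=1..n. g (y i))}"
  have mg: "(\<lambda>x. ennreal (exp (g x - c))) \<in> borel_measurable N"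
    by (rule borel_measurable_Rplus[OF N(2)]) (use g in measurable)
  have "(\<lambda>y. g (y i)) \<in> borel_measurable ?Q" if "i \<in> {1..n}" for i
    by (rule measurable_compose[OF measurable_sample_component[OF N(2) that] g])
  then have ms: "(\<lambda>y. \<Sum>i=1..n. g (y i)) \<in> borel_measurable ?Q" by (rule borel_measurable_sum)
  then have mA: "?A \<in> sets ?Q" by measurable
  have "emeasure ?Q ?A = (\<integral>\<^sup>+y. indicator ?A y \<partial>?Q)" using mA by simp
  also have "\<dots> \<le> (\<integral>\<^sup>+y. (\<Prod>i=1..n. ennreal (exp (g (y i) - c))) \<partial>?Q)"
  proof (intro nn_integral_mono)
    fix y
    have "(\<Prod>i=1..n. ennreal (exp (g (y i) - c))) = ennreal (\<Prod>i=1..n. exp (g (y i) - c))"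
      by (rule prod_ennreal) simp
    also have "(\<Prod>i=1..n. exp (g (y i) - c)) = exp ((\<Sum>i=1..n. g (y i)) - real n * c)"
      by (subst exp_sum[symmetric]) (simp_all add: sum_subtractf)
    finally show "indicator ?A y \<le> (\<Prod>i=1..n. ennreal (exp (g (y i) - c)))"
      by (auto simp: indicator_def)
  qed
  also have "\<dots> = (\<Prod>i=1..n. \<integral>\<^sup>+x. ennreal (exp (g x - c)) \<partial>N)"
    using mg by (intro P.product_nn_integral_prod) auto
  also have "\<dots> = (\<integral>\<^sup>+x. ennreal (exp (g x - c)) \<partial>N) ^ n" by simp
  also have "(\<integral>\<^sup>+x. ennreal (exp (g x - c)) \<partial>N) = (\<integral>\<^sup>+x. ennreal (exp (- c)) * ennreal (exp (g x)) \<partial>N)"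
    by (intro nn_integral_cong) (simp add: ennreal_mult'[symmetric] exp_diff exp_minus field_simps)
  also have "\<dots> = ennreal (exp (- c)) * (\<integral>\<^sup>+x. ennreal (exp (g x)) \<partial>N)"
    by (rule nn_integral_cmult, rule borel_measurable_Rplus[OF N(2)]) (use g in measurable)
  also have "(ennreal (exp (- c)) * (\<integral>\<^sup>+x. ennreal (exp (g x)) \<partial>N)) ^ n \<le> (ennreal (exp (- c)) * ennreal Z) ^ n"
    using Z(1) by (intro power_mono mult_left_mono) auto
  also have "\<dots> = ennreal ((Z * exp (- c)) ^ n)"
    using Z(2) by (simp add: ennreal_mult'[symmetric] ennreal_power mult.commute)
  finally show ?thesis .
qed

section \<open>The law of large numbers in the Wasserstein metric\<close>

lemma sample_product_expectation:
  fixes z :: "real \<Rightarrow> real"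
  assumes N: "prob_space N" and z: "z \<in> borel_measurable N" "\<And>x. \<bar>z x\<bar> \<le> 1" "(\<integral>x. z x \<partial>N) = 0"
    and ij: "i \<in> {1..n}" "j \<in> {1..n}" "i \<noteq> j"
  shows "(\<integral>y. z (y i) * z (y j) \<partial>iid n N) = 0"
proof -
  interpret N: prob_space N by fact
  interpret P: product_sigma_finite "\<lambda>_::nat. N" by standard
  \<comment> \<open>Filling the other coordinates with the factor 1 brings the product into the form
    to which the product integral applies.\<close>
  define f where "f k = (if k = i \<or> k = j then z else (\<lambda>_. 1))" for k
  have f: "integrable N (f k)" for k
    using integrable_bounded[OF N.finite_measure_axioms z(1,2)] by (auto simp: f_def)
  have "(\<Prod>k=1..n. f k (y k)) = z (y i) * z (y j)" for y
  proof -
    have "(\<Prod>k=1..n. f k (y k)) = f i (y i) * (\<Prod>k\<in>{1..n} - {i}. f k (y k))"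
      using ij by (intro prod.remove) auto
    also have "(\<Prod>k\<in>{1..n} - {i}. f k (y k)) = f j (y j) * (\<Prod>k\<in>{1..n} - {i} - {j}. f k (y k))"
      using ij by (intro prod.remove) auto
    also have "(\<Prod>k\<in>{1..n} - {i} - {j}. f k (y k)) = 1" by (intro prod.neutral) (auto simp: f_def)
    finally show ?thesis by (simp add: f_def)
  qed
  then have "(\<integral>y. z (y i) * z (y j) \<partial>iid n N) = (\<integral>y. (\<Prod>k=1..n. f k (y k)) \<partial>iid n N)" by simp
  also have "\<dots> = (\<Prod>k=1..n. \<integral>x. f k x \<partial>N)" by (rule P.product_integral_prod) (auto intro: f)
  also have "\<dots> = 0" using ij z(3) by (intro prod_zero bexI[of _ i]) (auto simp: f_def)
  finally show ?thesis .
qed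

text \<open>Off-diagonal terms of the squared sum vanish by centering and diagonal ones are at most
  1, so the second moment is at most n.\<close>

lemma sample_sum_expectation_le_sqrt:
  fixes z :: "real \<Rightarrow> real"
  assumes N: "prob_space N" and z: "z \<in> borel_measurable N" "\<And>x. \<bar>z x\<bar> \<le> 1" "(\<integral>x. z x \<partial>N) = 0" and n: "1 \<le> n"
  shows "(\<integral>y. \<bar>\<Sum>i=1..n. z (y i)\<bar> \<partial>iid n N) \<le> sqrt (real n)"
proof -
  interpret Q: prob_space "iid n N" by (rule prob_space_PiM) (rule N)
  have mz: "(\<lambda>y. z (y i)) \<in> borel_measurable (iid n N)" if "i \<in> {1..n}" for i
    by (rule measurable_compose[OF measurable_component_singleton[OF that] z(1)])
  have zz: "\<bar>z x * z x'\<bar> \<le> 1" for x x'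
    using z(2)[of x] z(2)[of x'] by (simp add: abs_mult mult_le_one)
  have izz: "integrable (iid n N) (\<lambda>y. z (y i) * z (y j))" if "i \<in> {1..n}" "j \<in> {1..n}" for i j
    by (rule integrable_bounded[OF Q.finite_measure_axioms _ zz]) (use mz[OF that(1)] mz[OF that(2)] in measurable)
  have iz: "integrable (iid n N) (\<lambda>y. z (y i))" if "i \<in> {1..n}" for i
    by (rule integrable_bounded[OF Q.finite_measure_axioms mz[OF that] z(2)])
  let ?S = "\<lambda>y. \<Sum>i=1..n. z (y i)"
  have iS: "integrable (iid n N) ?S" using iz by (rule Bochner_Integration.integrable_sum)
  have S2: "(?S y)\<^sup>2 = (\<Sum>i=1..n. \<Sum>j=1..n. z (y i) * z (y j))" for y
    by (simp add: power2_eq_square sum_product)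
  have iS2: "integrable (iid n N) (\<lambda>y. (?S y)\<^sup>2)"
    unfolding S2 using izz by (intro Bochner_Integration.integrable_sum)
  have "(\<integral>y. (?S y)\<^sup>2 \<partial>iid n N) = (\<Sum>i=1..n. \<Sum>j=1..n. \<integral>y. z (y i) * z (y j) \<partial>iid n N)"
  proof -
    have "(\<integral>y. (?S y)\<^sup>2 \<partial>iid n N) = (\<Sum>i=1..n. \<integral>y. (\<Sum>j=1..n. z (y i) * z (y j)) \<partial>iid n N)"
      unfolding S2 by (rule Bochner_Integration.integral_sum) (rule Bochner_Integration.integrable_sum, rule izz)
    also have "\<dots> = (\<Sum>i=1..n. \<Sum>j=1..n. \<integral>y. z (y i) * z (y j) \<partial>iid n N)"
      by (intro sum.cong refl Bochner_Integration.integral_sum izz)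
    finally show ?thesis .
  qed
  also have "\<dots> = (\<Sum>i=1..n. \<Sum>j=1..n. if j = i then \<integral>y. z (y i) * z (y i) \<partial>iid n N else 0)"
    using sample_product_expectation[OF N z] by (intro sum.cong refl) auto
  also have "\<dots> = (\<Sum>i=1..n. \<integral>y. z (y i) * z (y i) \<partial>iid n N)"
    by (intro sum.cong refl) simp
  also have "\<dots> \<le> (\<Sum>i=1..n. 1)"
  proof (intro sum_mono)
    fix i assume i: "i \<in> {1..n}"
    have "(\<integral>y. z (y i) * z (y i) \<partial>iid n N) \<le> (\<integral>y. 1 \<partial>iid n N)"
      using izz[OF i i] zz by (intro integral_mono) (auto simp: abs_le_iff)
    then show "(\<integral>y. z (y i) * z (y i) \<partial>iid n N) \<le> 1" by (simp add: Q.prob_space)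
  qed
  finally have var: "(\<integral>y. (?S y)\<^sup>2 \<partial>iid n N) \<le> real n" by simp
  define s where "s = sqrt (real n)"
  have s: "0 < s" "s\<^sup>2 = real n" using n by (auto simp: s_def)
  \<comment> \<open>The inequality 2 |S| s \<le> S^2 + s^2 with s = sqrt n bounds the first moment
    by the second without Cauchy-Schwarz.\<close>
  have "(\<integral>y. \<bar>?S y\<bar> \<partial>iid n N) \<le> (\<integral>y. (?S y)\<^sup>2 / (2 * s) + s / 2 \<partial>iid n N)"
  proof (intro integral_mono)
    fix y
    have "0 \<le> (\<bar>?S y\<bar> - s)\<^sup>2" by simp
    then have "2 * \<bar>?S y\<bar> * s \<le> (?S y)\<^sup>2 + s\<^sup>2" by (simp add: power2_diff)
    then show "\<bar>?S y\<bar> \<le> (?S y)\<^sup>2 / (2 * s) + s / 2" using s(1) by (simp add: field_simps power2_eq_square)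
  qed (use iS iS2 in auto)
  also have "\<dots> = (\<integral>y. (?S y)\<^sup>2 \<partial>iid n N) / (2 * s) + s / 2"
    using iS2 by (simp add: Q.prob_space)
  also have "\<dots> \<le> s\<^sup>2 / (2 * s) + s / 2" using var s by (simp add: divide_right_mono)
  also have "\<dots> = s" using s(1) by (simp add: power2_eq_square)
  finally show ?thesis by (simp add: s_def)
qed

lemma nn_integral_cdfp_tail_finite:
  assumes "\<nu> \<in> W1_space"
  shows "(\<integral>\<^sup>+t. ennreal \<bar>cdfp \<nu> t - indicator {0..} t\<bar> \<partial>lborel) < \<infinity>"
proof -
  note D = W1_spaceD[OF assms]
  interpret prob_space \<nu> by (rule D(3))
  have m0: "(\<lambda>_. 0::real) \<in> measurable \<nu> Rplus" by (rule measurable_RplusI) auto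
  have "cdfp (distr \<nu> Rplus (\<lambda>_. 0)) t = indicator {0..} t" for t
    unfolding cdfp_distr[OF m0] by (subst cdf_distr_eq_expectation[OF D(3)]) (simp_all add: prob_space)
  moreover have "distr \<nu> Rplus (\<lambda>_. 0) \<in> W1_space" by (rule distr_in_W1_space[OF D(3) m0]) simp
  ultimately show ?thesis using nn_integral_cdfp_diff_finite[OF assms, of "distr \<nu> Rplus (\<lambda>_. 0)"] by simp
qed

text \<open>Unlike the distance of the empirical measure to \<nu>, this integral over levels is
  visibly measurable in y and open to an exchange of integrals; \<open>empirical_gap_eq\<close>
  shows that the two agree on nonnegative samples.\<close>

definition empirical_gap :: "nat \<Rightarrow> real measure \<Rightarrow> (nat \<Rightarrow> real) \<Rightarrow> ennreal" where
  "empirical_gap n \<nu> y = (\<integral>\<^sup>+t. ennreal \<bar>(\<Sum>i=1..n. indicator {y i..} t) / real n - cdfp \<nu> t\<bar> \<partial>lborel)"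

lemma empirical_gap_eq:
  assumes "1 \<le> n" "\<nu> \<in> W1_space" "y \<in> {1..n} \<rightarrow> {0..}"
  shows "empirical_gap n \<nu> y = ennreal (W1_dist (empirical_measure n y) \<nu>)"
proof -
  have "ennreal (W1_dist (empirical_measure n y) \<nu>) = (\<integral>\<^sup>+t. ennreal \<bar>cdfp (empirical_measure n y) t - cdfp \<nu> t\<bar> \<partial>lborel)"
    by (rule ennreal_W1_dist[OF empirical_measure_in_W1_space assms(2)]) (use assms in auto)
  also have "\<dots> = empirical_gap n \<nu> y"
    unfolding empirical_gap_def using assms by (intro nn_integral_cong) (simp add: cdfp_empirical_measure)
  finally show ?thesis by simp
qed

lemma measurable_empirical_gap_aux:
  assumes \<nu>: "\<nu> \<in> W1_space" and N: "sets N = sets Rplus"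
  shows "(\<lambda>(y, t). ennreal \<bar>(\<Sum>i=1..n. indicator {y i..} t) / real n - cdfp \<nu> t\<bar>)
     \<in> borel_measurable (iid n N \<Otimes>\<^sub>M lborel)"
proof -
  have "(\<lambda>p. \<Sum>i=1..n. indicator {fst p i..} (snd p) :: real) \<in> borel_measurable (iid n N \<Otimes>\<^sub>M lborel)"
  proof (rule borel_measurable_sum)
    fix i assume "i \<in> {1..n}"
    from measurable_compose[OF measurable_fst measurable_sample_component[OF N this]]
    show "(\<lambda>p. indicator {fst p i..} (snd p) :: real) \<in> borel_measurable (iid n N \<Otimes>\<^sub>M lborel)"
      by (rule measurable_step) simp
  qed
  moreover have "(\<lambda>p. cdfp \<nu> (snd p)) \<in> borel_measurable (iid n N \<Otimes>\<^sub>M lborel)"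
    by (rule measurable_compose[OF _ measurable_cdfp[OF \<nu>]]) simp
  ultimately show ?thesis by (simp add: case_prod_beta')
qed

lemma measurable_empirical_gap:
  assumes \<nu>: "\<nu> \<in> W1_space" and N: "sets N = sets Rplus"
  shows "empirical_gap n \<nu> \<in> borel_measurable (iid n N)"
  unfolding empirical_gap_def[abs_def]
  using measurable_empirical_gap_aux[OF assms] by (rule sigma_finite_measure.borel_measurable_nn_integral[OF sigma_finite_lborel])

text \<open>The first bound is the variance estimate and vanishes with n; the second does not depend
  on n and is integrable in t. Their minimum admits dominated convergence over all levels.\<close>

lemma integral_empirical_cdf_diff_le:
  assumes \<nu>: "\<nu> \<in> W1_space" and n: "1 \<le> n"
  shows "(\<integral>\<^sup>+y. ennreal \<bar>(\<Sum>i=1..n. indicator {y i..} t) / real n - cdfp \<nu> t\<bar> \<partial>iid n \<nu>)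
     \<le> ennreal (min (1 / sqrt (real n)) (2 * \<bar>cdfp \<nu> t - indicator {0..} t\<bar>))"
proof -
  note D = W1_spaceD[OF \<nu>]
  interpret N: prob_space \<nu> by (rule D(3))
  interpret Q: prob_space "iid n \<nu>" by (rule prob_space_PiM) (rule D(3))
  interpret rd: real_distribution "distr \<nu> borel (\<lambda>x. x)" by (rule real_distribution_distr_id[OF D(3,1)])
  let ?p = "cdfp \<nu> t"
  have p01: "0 \<le> ?p" "?p \<le> 1" by (rule rd.cdf_nonneg, rule rd.cdf_bounded_prob)
  have mI: "(\<lambda>x. indicator {x..} t :: real) \<in> borel_measurable \<nu>"
    by (rule borel_measurable_Rplus[OF D(1)], rule measurable_step) simp_all
  have p: "?p = (\<integral>x. indicator {x..} t \<partial>\<nu>)"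
    by (rule cdf_distr_eq_expectation[OF D(3)], rule borel_measurable_Rplus[OF D(1)]) simp
  have iI: "integrable \<nu> (\<lambda>x. indicator {x..} t :: real)"
    by (rule integrable_bounded[OF N.finite_measure_axioms mI, of 1]) (simp add: indicator_def)
  define z where "z x = indicator {x..} t - ?p" for x
  have mz: "z \<in> borel_measurable \<nu>" unfolding z_def[abs_def] using mI by simp
  have z1: "\<bar>z x\<bar> \<le> 1" for x using p01 by (auto simp: z_def indicator_def)
  have z0: "(\<integral>x. z x \<partial>\<nu>) = 0" unfolding z_def using iI by (simp add: N.prob_space flip: p)
  have mzi: "(\<lambda>y. z (y i)) \<in> borel_measurable (iid n \<nu>)" if "i \<in> {1..n}" for i
    by (rule measurable_compose[OF measurable_component_singleton[OF that] mz])
  have iz: "integrable (iid n \<nu>) (\<lambda>y. z (y i))" if "i \<in> {1..n}" for i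
    by (rule integrable_bounded[OF Q.finite_measure_axioms mzi[OF that] z1])
  have eq: "(\<Sum>i=1..n. indicator {y i..} t) / real n - ?p = (\<Sum>i=1..n. z (y i)) / real n" for y
    using n by (simp add: z_def sum_subtractf diff_divide_distrib)
  have iS: "integrable (iid n \<nu>) (\<lambda>y. \<bar>(\<Sum>i=1..n. z (y i)) / real n\<bar>)"
    using iz by (intro integrable_abs Bochner_Integration.integrable_divide Bochner_Integration.integrable_sum) 
  have "(\<integral>\<^sup>+y. ennreal \<bar>(\<Sum>i=1..n. indicator {y i..} t) / real n - ?p\<bar> \<partial>iid n \<nu>)
      = ennreal (\<integral>y. \<bar>(\<Sum>i=1..n. z (y i)) / real n\<bar> \<partial>iid n \<nu>)"
    unfolding eq by (rule nn_integral_eq_integral[OF iS]) simp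
  also have "(\<integral>y. \<bar>(\<Sum>i=1..n. z (y i)) / real n\<bar> \<partial>iid n \<nu>)
      = (\<integral>y. \<bar>\<Sum>i=1..n. z (y i)\<bar> \<partial>iid n \<nu>) / real n"
    by simp
  also have "\<dots> \<le> min (1 / sqrt (real n)) (2 * \<bar>?p - indicator {0..} t\<bar>)"
  proof (rule min.boundedI)
    have "(\<integral>y. \<bar>\<Sum>i=1..n. z (y i)\<bar> \<partial>iid n \<nu>) / real n \<le> sqrt (real n) / real n"
      using sample_sum_expectation_le_sqrt[OF D(3) mz z1 z0 n] by (rule divide_right_mono) simp
    also have "sqrt (real n) / real n = 1 / sqrt (real n)"
      using n by (simp add: real_div_sqrt field_simps)
    finally show "(\<integral>y. \<bar>\<Sum>i=1..n. z (y i)\<bar> \<partial>iid n \<nu>) / real n \<le> 1 / sqrt (real n)" .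
  next
    \<comment> \<open>The triangle inequality goes through the step at 0. For x \<ge> 0 the
      difference of the two steps has a constant sign, so its expectation is again the distance of
      \<open>?p\<close> from the step at 0.\<close>
    have Ez: "(\<integral>x. \<bar>z x\<bar> \<partial>\<nu>) \<le> 2 * \<bar>?p - indicator {0..} t\<bar>"
    proof -
      have "(\<integral>x. \<bar>z x\<bar> \<partial>\<nu>) \<le> (\<integral>x. \<bar>indicator {x..} t - indicator {0..} t\<bar> + \<bar>?p - indicator {0..} t\<bar> \<partial>\<nu>)"
        using iI mz z1 by (intro integral_mono integrable_abs integrable_bounded[OF N.finite_measure_axioms mz z1]
            Bochner_Integration.integrable_add Bochner_Integration.integrable_diff) (auto simp: z_def)
      also have "\<dots> = (\<integral>x. \<bar>indicator {x..} t - indicator {0..} t\<bar> \<partial>\<nu>) + \<bar>?p - indicator {0..} t\<bar>"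
        using iI by (subst Bochner_Integration.integral_add)
          (auto simp: N.prob_space intro!: integrable_abs Bochner_Integration.integrable_diff)
      also have "(\<integral>x. \<bar>indicator {x..} t - indicator {0..} t\<bar> \<partial>\<nu>) = (\<integral>x. (indicator {0..} t - indicator {x..} t :: real) \<partial>\<nu>)"
      proof (rule Bochner_Integration.integral_cong[OF refl])
        fix x assume "x \<in> space \<nu>"
        then have "0 \<le> x" by (simp add: D(2))
        then show "\<bar>indicator {x..} t - indicator {0..} t\<bar> = (indicator {0..} t - indicator {x..} t :: real)"
          by (cases "x \<le> t"; cases "0 \<le> t") simp_all
      qed
      also have "\<dots> = indicator {0..} t - ?p" using iI by (simp add: N.prob_space flip: p)
      finally show ?thesis using abs_ge_minus_self[of "?p - indicator {0..} t"] by simp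
    qed
    have "(\<integral>y. \<bar>z (y i)\<bar> \<partial>iid n \<nu>) = (\<integral>x. \<bar>z x\<bar> \<partial>\<nu>)" if i: "i \<in> {1..n}" for i
    proof -
      have "(\<integral>x. \<bar>z x\<bar> \<partial>distr (iid n \<nu>) \<nu> (\<lambda>y. y i)) = (\<integral>y. \<bar>z (y i)\<bar> \<partial>iid n \<nu>)"
        by (rule integral_distr[OF measurable_component_singleton[OF i]]) (use mz in simp)
      then show ?thesis using distr_PiM_component[of "{1..n}" "\<lambda>_. \<nu>" i] D(3) i by simp
    qed
    then have "(\<Sum>i=1..n. \<integral>y. \<bar>z (y i)\<bar> \<partial>iid n \<nu>) = real n * (\<integral>x. \<bar>z x\<bar> \<partial>\<nu>)" by simp
    moreover have "(\<integral>y. \<bar>\<Sum>i=1..n. z (y i)\<bar> \<partial>iid n \<nu>) \<le> (\<integral>y. (\<Sum>i=1..n. \<bar>z (y i)\<bar>) \<partial>iid n \<nu>)"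
      using iz by (intro integral_mono integrable_abs Bochner_Integration.integrable_sum sum_abs) auto
    moreover have "\<dots> = (\<Sum>i=1..n. \<integral>y. \<bar>z (y i)\<bar> \<partial>iid n \<nu>)"
      using iz by (intro Bochner_Integration.integral_sum integrable_abs)
    ultimately have "(\<integral>y. \<bar>\<Sum>i=1..n. z (y i)\<bar> \<partial>iid n \<nu>) / real n \<le> (\<integral>x. \<bar>z x\<bar> \<partial>\<nu>)"
      using n by (simp add: field_simps)
    then show "(\<integral>y. \<bar>\<Sum>i=1..n. z (y i)\<bar> \<partial>iid n \<nu>) / real n \<le> 2 * \<bar>?p - indicator {0..} t\<bar>"
      using Ez by simp
  qed
  finally show ?thesis by (simp add: ennreal_leI)
qed

text \<open>After exchanging expectation and level integral, the pointwise bounds tend to 0 and are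
  dominated by twice the distance of the distribution function to the step at 0, which is integrable
  by the finite first moment.\<close>

theorem empirical_measure_LLN:
  assumes \<nu>: "\<nu> \<in> W1_space"
  shows "(\<lambda>n. \<integral>\<^sup>+y. empirical_gap n \<nu> y \<partial>iid n \<nu>) \<longlonglongrightarrow> 0"
proof -
  note D = W1_spaceD[OF \<nu>]
  note mF = measurable_cdfp[OF \<nu>]
  define h where "h n t = ennreal (min (1 / sqrt (real n)) (2 * \<bar>cdfp \<nu> t - indicator {0..} t\<bar>))" for n t
  have mh: "h n \<in> borel_measurable lborel" for n unfolding h_def[abs_def] using mF by measurable
  have le: "(\<integral>\<^sup>+y. empirical_gap n \<nu> y \<partial>iid n \<nu>) \<le> (\<integral>\<^sup>+t. h n t \<partial>lborel)" if n: "1 \<le> n" for n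
  proof -
    interpret Q: prob_space "iid n \<nu>" by (rule prob_space_PiM) (rule D(3))
    interpret P: pair_sigma_finite "iid n \<nu>" lborel by standard
    have "(\<integral>\<^sup>+y. empirical_gap n \<nu> y \<partial>iid n \<nu>)
      = (\<integral>\<^sup>+t. (\<integral>\<^sup>+y. ennreal \<bar>(\<Sum>i=1..n. indicator {y i..} t) / real n - cdfp \<nu> t\<bar> \<partial>iid n \<nu>) \<partial>lborel)"
      unfolding empirical_gap_def using P.Fubini'[OF measurable_empirical_gap_aux[OF \<nu> D(1)]] by simp
    also have "\<dots> \<le> (\<integral>\<^sup>+t. h n t \<partial>lborel)"
      unfolding h_def by (intro nn_integral_mono integral_empirical_cdf_diff_le[OF \<nu> n])
    finally show ?thesis .
  qed
  have "(\<lambda>n. \<integral>\<^sup>+t. h n t \<partial>lborel) \<longlonglongrightarrow> (\<integral>\<^sup>+(t::real). 0 \<partial>lborel)"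
  proof (rule nn_integral_dominated_convergence[where w="\<lambda>t. ennreal (2 * \<bar>cdfp \<nu> t - indicator {0..} t\<bar>)"])
    have "(\<integral>\<^sup>+t. ennreal (2 * \<bar>cdfp \<nu> t - indicator {0..} t\<bar>) \<partial>lborel)
        = 2 * (\<integral>\<^sup>+t. ennreal \<bar>cdfp \<nu> t - indicator {0..} t\<bar> \<partial>lborel)"
      using mF by (subst nn_integral_cmult[symmetric]) (auto simp: ennreal_mult)
    also have "\<dots> < \<infinity>" using nn_integral_cdfp_tail_finite[OF \<nu>] by (simp add: ennreal_mult_less_top)
    finally show "(\<integral>\<^sup>+t. ennreal (2 * \<bar>cdfp \<nu> t - indicator {0..} t\<bar>) \<partial>lborel) < \<infinity>" .
    show "AE t in lborel. (\<lambda>n. h n t) \<longlonglongrightarrow> 0"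
    proof (intro AE_I2)
      fix t
      have "(\<lambda>n. min (1 / sqrt (real n)) (2 * \<bar>cdfp \<nu> t - indicator {0..} t\<bar>)) \<longlonglongrightarrow> min 0 (2 * \<bar>cdfp \<nu> t - indicator {0..} t\<bar>)"
        by (intro tendsto_min tendsto_const) real_asymp
      then have "(\<lambda>n. h n t) \<longlonglongrightarrow> ennreal (min 0 (2 * \<bar>cdfp \<nu> t - indicator {0..} t\<bar>))"
        unfolding h_def by (rule tendsto_ennrealI)
      also have "min 0 (2 * \<bar>cdfp \<nu> t - indicator {0..} t\<bar>) = 0" by (rule min_absorb1) simp
      finally show "(\<lambda>n. h n t) \<longlonglongrightarrow> 0" by simp
    qed
    show "AE t in lborel. h n t \<le> ennreal (2 * \<bar>cdfp \<nu> t - indicator {0..} t\<bar>)" for n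
      unfolding h_def by (intro AE_I2 ennreal_leI) simp
  qed (use mh mF in measurable)
  then have lim: "(\<lambda>n. \<integral>\<^sup>+t. h n t \<partial>lborel) \<longlonglongrightarrow> 0" by simp
  show ?thesis
    by (rule tendsto_sandwich[OF _ _ tendsto_const lim])
       (auto intro!: eventually_sequentiallyI[of 1] le)
qed

section \<open>Change of measure between product laws\<close>

lemma iid_density:
  fixes F :: "real \<Rightarrow> real"
  assumes \<xi>: "prob_space \<xi>" and \<nu>: "prob_space \<nu>" and F: "F \<in> borel_measurable \<xi>" "\<And>x. 0 \<le> F x"
    and d: "\<nu> = density \<xi> (\<lambda>x. ennreal (F x))"
  shows "iid n \<nu> = density (iid n \<xi>) (\<lambda>y. ennreal (\<Prod>i=1..n. F (y i)))"
proof -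
  interpret N: prob_space \<nu> by fact
  interpret X: prob_space \<xi> by fact
  interpret PN: product_sigma_finite "\<lambda>_::nat. \<nu>" by standard
  interpret PX: product_sigma_finite "\<lambda>_::nat. \<xi>" by standard
  have s: "sets \<nu> = sets \<xi>" by (simp add: d)
  have mF: "(\<lambda>y. F (y i)) \<in> borel_measurable (iid n \<xi>)" if "i \<in> {1..n}" for i
    by (rule measurable_compose[OF measurable_component_singleton[OF that] F(1)])
  then have mP: "(\<lambda>y. \<Prod>i=1..n. F (y i)) \<in> borel_measurable (iid n \<xi>)" by (rule borel_measurable_prod)
  show ?thesis
  proof (rule PN.PiM_eqI[symmetric])
    show "sets (density (iid n \<xi>) (\<lambda>y. ennreal (\<Prod>i=1..n. F (y i)))) = sets (iid n \<nu>)"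
      using s by (simp cong: sets_PiM_cong)
    fix A assume A: "\<And>i. i \<in> {1..n} \<Longrightarrow> A i \<in> sets \<nu>"
    have AP: "Pi\<^sub>E {1..n} A \<in> sets (iid n \<xi>)" using A s by (intro sets_PiM_I_finite) auto
    have "emeasure (density (iid n \<xi>) (\<lambda>y. ennreal (\<Prod>i=1..n. F (y i)))) (Pi\<^sub>E {1..n} A)
       = (\<integral>\<^sup>+y. ennreal (\<Prod>i=1..n. F (y i)) * indicator (Pi\<^sub>E {1..n} A) y \<partial>iid n \<xi>)"
      using mP AP by (intro emeasure_density) auto
    also have "\<dots> = (\<integral>\<^sup>+y. (\<Prod>i=1..n. ennreal (F (y i)) * indicator (A i) (y i)) \<partial>iid n \<xi>)"
    proof (intro nn_integral_cong)
      fix y assume y: "y \<in> space (iid n \<xi>)"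
      have "indicator (Pi\<^sub>E {1..n} A) y = (\<Prod>i=1..n. indicator (A i) (y i) :: ennreal)"
      proof (cases "y \<in> Pi\<^sub>E {1..n} A")
        case True
        then show ?thesis by (auto simp: PiE_iff intro!: prod.neutral[symmetric])
      next
        case False
        then obtain i where "i \<in> {1..n}" "y i \<notin> A i" using y unfolding space_PiM PiE_iff by blast
        then have "(\<Prod>i=1..n. indicator (A i) (y i) :: ennreal) = 0" by (intro prod_zero bexI[of _ i]) auto
        then show ?thesis using False by simp
      qed
      then show "ennreal (\<Prod>i=1..n. F (y i)) * indicator (Pi\<^sub>E {1..n} A) y = (\<Prod>i=1..n. ennreal (F (y i)) * indicator (A i) (y i))"
        using F(2) by (simp add: prod.distrib prod_ennreal)
    qed
    also have "\<dots> = (\<Prod>i=1..n. \<integral>\<^sup>+x. ennreal (F x) * indicator (A i) x \<partial>\<xi>)"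
      using F(1) A s by (intro PX.product_nn_integral_prod) auto
    also have "\<dots> = (\<Prod>i=1..n. emeasure \<nu> (A i))"
      unfolding d using F(1) A s by (intro prod.cong refl emeasure_density[symmetric]) (auto simp: d)
    finally show "emeasure (density (iid n \<xi>) (\<lambda>y. ennreal (\<Prod>i=1..n. F (y i)))) (Pi\<^sub>E {1..n} A)
       = (\<Prod>i=1..n. emeasure \<nu> (A i))" .
  qed simp
qed

text \<open>Relative entropy is additive over independent coordinates, which gives n h. The test
  function is l times the indicator of E, with exponential integral at most 1 + exp l times the
  \<xi>-probability of E; l stays free to be tuned to that probability.\<close>

lemma sample_entropy_lower_bound:
  assumes \<xi>: "prob_space \<xi>" and \<nu>: "prob_space \<nu>" and s: "sets \<nu> = sets \<xi>"
    and H: "rel_entropy \<nu> \<xi> = ereal h" and E: "E \<in> sets (iid n \<xi>)"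
    and l: "0 \<le> l"
  shows "l * measure (iid n \<nu>) E \<le> real n * h + ln (1 + exp l * measure (iid n \<xi>) E)"
proof -
  obtain F :: "real \<Rightarrow> real" where F: "F \<in> borel_measurable \<xi>" "\<And>x. 0 \<le> F x"
    "\<nu> = density \<xi> (\<lambda>x. ennreal (F x))" "integrable \<nu> (\<lambda>x. ln (F x))"
    "rel_entropy \<nu> \<xi> = ereal (\<integral>x. ln (F x) \<partial>\<nu>)"
    by (rule rel_entropy_finite_density[OF \<nu> \<xi> s]) (use H in auto)
  have h: "h = (\<integral>x. ln (F x) \<partial>\<nu>)" using H F(5) by simp
  interpret QN: prob_space "iid n \<nu>" by (rule prob_space_PiM) (rule \<nu>)
  interpret QX: prob_space "iid n \<xi>" by (rule prob_space_PiM) (rule \<xi>)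
  have mlnF: "(\<lambda>x. ln (F x)) \<in> borel_measurable \<nu>" using F(4) by simp
  have comp: "integrable (iid n \<nu>) (\<lambda>y. ln (F (y i)))"
    "(\<integral>y. ln (F (y i)) \<partial>iid n \<nu>) = h" if i: "i \<in> {1..n}" for i
  proof -
    have di: "distr (iid n \<nu>) \<nu> (\<lambda>y. y i) = \<nu>"
      using distr_PiM_component[of "{1..n}" "\<lambda>_. \<nu>" i] \<nu> i by simp
    show "integrable (iid n \<nu>) (\<lambda>y. ln (F (y i)))"
      using integrable_distr_eq[OF measurable_component_singleton[OF i, of "\<lambda>_. \<nu>"] mlnF] F(4) by (simp add: di)
    show "(\<integral>y. ln (F (y i)) \<partial>iid n \<nu>) = h"
      using integral_distr[OF measurable_component_singleton[OF i, of "\<lambda>_. \<nu>"] mlnF] by (simp add: di h)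
  qed
  define G where "G y = (\<Prod>i=1..n. F (y i))" for y
  have dens: "iid n \<nu> = density (iid n \<xi>) (\<lambda>y. ennreal (G y))"
    unfolding G_def by (rule iid_density[OF \<xi> \<nu> F(1-3)])
  have mF: "(\<lambda>y. F (y i)) \<in> borel_measurable (iid n \<xi>)" if "i \<in> {1..n}" for i
    by (rule measurable_compose[OF measurable_component_singleton[OF that] F(1)])
  then have mG: "G \<in> borel_measurable (iid n \<xi>)"
    unfolding G_def[abs_def] by (rule borel_measurable_prod)
  have G0: "0 \<le> G y" for y unfolding G_def using F(2) by (intro prod_nonneg) auto
  have mGN: "G \<in> borel_measurable (iid n \<nu>)" unfolding dens using mG by simp
  \<comment> \<open>The logarithm of the product splits only if no factor vanishes, which holds
    almost surely under the law that has this density.\<close>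
  have AEG: "AE y in iid n \<nu>. ln (G y) = (\<Sum>i=1..n. ln (F (y i)))"
  proof -
    have "AE y in iid n \<nu>. 0 < G y" unfolding dens by (rule density_pos_AE[OF mG G0])
    then show ?thesis
    proof eventually_elim
      case (elim y)
      have "F (y i) \<noteq> 0" if "i \<in> {1..n}" for i
      proof
        assume "F (y i) = 0"
        then have "G y = 0" unfolding G_def using that by (intro prod_zero bexI[of _ i]) auto
        with elim show False by simp
      qed
      then show ?case unfolding G_def by (intro ln_prod) auto
    qed
  qed
  have isum: "integrable (iid n \<nu>) (\<lambda>y. \<Sum>i=1..n. ln (F (y i)))"
    using comp(1) by (rule Bochner_Integration.integrable_sum)
  have iG: "integrable (iid n \<nu>) (\<lambda>y. ln (G y))"
    using mGN isum AEG by (subst integrable_cong_AE[where g="\<lambda>y. \<Sum>i=1..n. ln (F (y i))"]) auto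
  have "(\<integral>y. ln (G y) \<partial>iid n \<nu>) = (\<integral>y. (\<Sum>i=1..n. ln (F (y i))) \<partial>iid n \<nu>)"
    using mGN isum AEG by (intro integral_cong_AE) auto
  also have "\<dots> = (\<Sum>i=1..n. \<integral>y. ln (F (y i)) \<partial>iid n \<nu>)"
    using comp(1) by (rule Bochner_Integration.integral_sum)
  also have "\<dots> = real n * h" using comp(2) by simp
  finally have hG: "(\<integral>y. ln (G y) \<partial>iid n \<nu>) = real n * h" .
  have EN: "E \<in> sets (iid n \<nu>)" unfolding dens using E by simp
  let ?q = "measure (iid n \<xi>) E"
  have "(\<integral>y. l * indicator E y \<partial>iid n \<nu>) \<le> (\<integral>y. ln (G y) \<partial>iid n \<nu>) + ln (1 + exp l * ?q)"
  proof (rule variational_entropy_le[OF mG G0 dens QN.prob_space_axioms iG])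
    show "integrable (iid n \<nu>) (\<lambda>y. l * indicator E y)"
      using EN by (intro integrable_mult_right integrable_real_indicator) (auto simp: less_top[symmetric])
    show "(\<lambda>y. l * indicator E y) \<in> borel_measurable (iid n \<xi>)" using E by measurable
    have "(\<integral>\<^sup>+y. ennreal (exp (l * indicator E y)) \<partial>iid n \<xi>)
       \<le> (\<integral>\<^sup>+y. 1 + ennreal (exp l) * indicator E y \<partial>iid n \<xi>)"
      by (intro nn_integral_mono) (auto simp: indicator_def)
    also have "\<dots> = 1 + ennreal (exp l) * emeasure (iid n \<xi>) E"
      using E by (subst nn_integral_add) (auto simp: nn_integral_cmult_indicator QX.emeasure_space_1)
    also have "\<dots> = ennreal (1 + exp l * ?q)"
      by (simp add: QX.emeasure_eq_measure ennreal_mult'[symmetric] ennreal_plus[symmetric] del: ennreal_plus flip: ennreal_1)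
    finally show "(\<integral>\<^sup>+y. ennreal (exp (l * indicator E y)) \<partial>iid n \<xi>) \<le> ennreal (1 + exp l * ?q)" .
    show "0 < 1 + exp l * ?q" by (intro add_pos_nonneg) auto
  qed
  then show ?thesis using EN hG by simp
qed

section \<open>Measurability of the normalized empirical measure\<close>

definition normalized :: "nat \<Rightarrow> (nat \<Rightarrow> real) \<Rightarrow> nat \<Rightarrow> real" where
  "normalized n w i = w i / (1 / real n * (\<Sum>j=1..n. w j))"

abbreviation normalized_event :: "nat \<Rightarrow> real measure \<Rightarrow> real measure set \<Rightarrow> (nat \<Rightarrow> real) set" where
  "normalized_event n N A \<equiv> {y \<in> space (iid n N). empirical_measure n (normalized n y) \<in> A}"

lemma empirical_measure_cong:
  assumes "\<And>i. i \<in> {1..n} \<Longrightarrow> w i = v i"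
  shows "empirical_measure n w = empirical_measure n v"
  unfolding empirical_measure_def using assms by (intro arg_cong[where f="measure_of _ _"] ext) (auto intro!: arg_cong2[where f="(*)"] sum.cong)

lemma normalized_nonneg:
  assumes "w \<in> {1..n} \<rightarrow> {0..}"
  shows "normalized n w \<in> {1..n} \<rightarrow> {0..}"
  unfolding normalized_def using assms by (auto simp: Pi_iff intro!: divide_nonneg_nonneg mult_nonneg_nonneg sum_nonneg)

lemma empirical_normalized_in_M11:
  assumes "1 \<le> n" "w \<in> {1..n} \<rightarrow> {0..}" "0 < (\<Sum>i=1..n. w i)"
  shows "empirical_measure n (normalized n w) \<in> M11"
    and "empirical_measure n (normalized n w) = normalize_law (empirical_measure n w)"
proof -
  show e: "empirical_measure n (normalized n w) = normalize_law (empirical_measure n w)"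
    unfolding normalized_def[abs_def] by (rule normalize_law_empirical_measure[symmetric, OF assms])
  show "empirical_measure n (normalized n w) \<in> M11"
    unfolding e using assms
    by (intro normalize_law_in_M11 empirical_measure_in_W1_space) (auto simp: mean_empirical_measure)
qed

text \<open>If the sum vanishes, division by 0 returns 0 and all normalized points sit at 0, so the
  mean is 0 instead of 1. Membership in \<open>M11\<close> thus detects nondegenerate
  samples.\<close>

lemma empirical_normalized_not_in_M11:
  assumes "1 \<le> n" "w \<in> {1..n} \<rightarrow> {0..}" "empirical_measure n (normalized n w) \<in> M11"
  shows "0 < (\<Sum>i=1..n. w i)"
proof (rule ccontr)
  assume "\<not> ?thesis"
  then have "(\<Sum>i=1..n. w i) = 0" using sum_nonneg[of "{1..n}" w] assms(2) by (auto simp: less_le Pi_iff)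
  then have "normalized n w i = 0" for i by (simp add: normalized_def)
  then have "mean (empirical_measure n (normalized n w)) = 0"
    using mean_empirical_measure[OF assms(1) normalized_nonneg[OF assms(2)]] by simp
  then show False using assms(3) by (simp add: M11_def)
qed

text \<open>Clipping extends the map to all real sequences, where openness makes sense. Where the
  sum is positive the normalized coordinates are continuous, and their average displacement bounds
  the Wasserstein distance.\<close>

lemma open_normalized_event:
  assumes n: "1 \<le> n" and A: "openin M11.mtopology A"
  shows "open {z :: nat \<Rightarrow> real. 0 < (\<Sum>i=1..n. max 0 (z i)) \<and> empirical_measure n (normalized n (\<lambda>i. max 0 (z i))) \<in> A}"
    (is "open ?O")
proof -
  have "closed (- ?O)"
    unfolding closed_sequential_limits
  proof (intro allI impI, elim conjE)
    fix x :: "nat \<Rightarrow> nat \<Rightarrow> real" and z assume x: "\<forall>k. x k \<in> - ?O" and lim: "x \<longlonglongrightarrow> z"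
    have limi: "(\<lambda>k. x k i) \<longlonglongrightarrow> z i" for i
      by (rule continuous_on_tendsto_compose[OF continuous_on_product_coordinates lim]) auto
    show "z \<in> - ?O"
    proof
      assume z: "z \<in> ?O"
      let ?m = "\<lambda>z i. max 0 (z i :: real)"
      let ?s = "\<lambda>z. \<Sum>i=1..n. ?m z i"
      have s: "(\<lambda>k. ?s (x k)) \<longlonglongrightarrow> ?s z" by (intro tendsto_sum tendsto_max tendsto_const limi)
      have s0: "0 < ?s z" using z by simp
      have ev: "eventually (\<lambda>k. 0 < ?s (x k)) sequentially" using order_tendstoD(1)[OF s s0] .
      from A z obtain r where r: "0 < r" "M11.mball (empirical_measure n (normalized n (?m z))) r \<subseteq> A"
        unfolding M11.openin_mtopology by blast
      have zM: "empirical_measure n (normalized n (?m z)) \<in> M11"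
        by (rule empirical_normalized_in_M11(1)[OF n _ s0]) simp
      have "(\<lambda>k. (\<Sum>i=1..n. \<bar>normalized n (?m z) i - normalized n (?m (x k)) i\<bar>) / real n)
         \<longlonglongrightarrow> (\<Sum>i=1..n. \<bar>normalized n (?m z) i - normalized n (?m z) i\<bar>) / real n"
        unfolding normalized_def using n s0
        by (intro tendsto_intros tendsto_sum tendsto_max limi) auto
      then have "eventually (\<lambda>k. (\<Sum>i=1..n. \<bar>normalized n (?m z) i - normalized n (?m (x k)) i\<bar>) / real n < r) sequentially"
        using r(1) by (intro order_tendstoD(2)) auto
      with ev have "eventually (\<lambda>k. x k \<in> ?O) sequentially"
      proof eventually_elim
        case (elim k)
        have "W1_dist (empirical_measure n (normalized n (?m z))) (empirical_measure n (normalized n (?m (x k)))) < r"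
          by (rule le_less_trans[OF W1_dist_empirical_measure_le[OF n] elim(2)]) (rule normalized_nonneg, simp)+
        moreover have "empirical_measure n (normalized n (?m (x k))) \<in> M11"
          by (rule empirical_normalized_in_M11(1)[OF n _ elim(1)]) simp
        ultimately have "empirical_measure n (normalized n (?m (x k))) \<in> A"
          using r(2) zM by (auto simp: M11.mball_def)
        then show ?case using elim(1) by simp
      qed
      then show False using x by (auto simp: eventually_sequentially)
    qed
  qed
  then show ?thesis by (simp add: closed_open)
qed

lemma sets_normalized_event:
  assumes n: "1 \<le> n" and N: "sets N = sets Rplus" and A: "A \<in> sets (borel_of M11.mtopology)"
  shows "normalized_event n N A \<in> sets (iid n N)"
proof -
  let ?P = "normalized_event n N"
  have op: "?P U \<in> sets (iid n N)" if U: "openin M11.mtopology U" for U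
  proof -
    \<comment> \<open>Points of the finite product are \<open>undefined\<close> outside the index
      set; padding by 0 gives a measurable map into full sequences.\<close>
    define T where "T y i = (if i \<in> {1..n} then y i else 0)" for y :: "nat \<Rightarrow> real" and i
    have mT: "T \<in> borel_measurable (iid n N)"
    proof (rule measurable_coordinatewise_then_product)
      show "(\<lambda>y. T y i) \<in> borel_measurable (iid n N)" for i
        using measurable_sample_component[OF N, of i n] by (cases "i \<in> {1..n}") (auto simp: T_def)
    qed
    let ?O = "{z :: nat \<Rightarrow> real. 0 < (\<Sum>i=1..n. max 0 (z i)) \<and> empirical_measure n (normalized n (\<lambda>i. max 0 (z i))) \<in> U}"
    have "?P U = T -` ?O \<inter> space (iid n N)"
    proof -
      have "empirical_measure n (normalized n y) \<in> U \<longleftrightarrow> T y \<in> ?O" if y: "y \<in> space (iid n N)" for y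
      proof -
        have nn': "y \<in> {1..n} \<rightarrow> {0..}" by (rule iid_nonneg[OF N y])
        then have nn: "\<And>i. i \<in> {1..n} \<Longrightarrow> 0 \<le> y i" by (simp add: Pi_iff)
        have s: "(\<Sum>i=1..n. max 0 (T y i)) = (\<Sum>i=1..n. y i)" using nn by (intro sum.cong) (auto simp: T_def)
        have e: "empirical_measure n (normalized n (\<lambda>i. max 0 (T y i))) = empirical_measure n (normalized n y)"
          using nn by (intro empirical_measure_cong) (auto simp: normalized_def s, auto simp: T_def)
        have "U \<subseteq> M11" using openin_subset[OF U] by simp
        then show ?thesis using empirical_normalized_not_in_M11[OF n nn'] by (auto simp: s e)
      qed
      then show ?thesis by auto
    qed
    moreover have "?O \<in> sets borel" using open_normalized_event[OF n U] by simp
    ultimately show ?thesis by (simp only: measurable_sets[OF mT])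
  qed
  have "A \<in> sigma_sets M11 {U. openin M11.mtopology U}"
    using A openin_subset[of M11.mtopology] by (auto simp: borel_of_def sets_measure_of_conv Pow_def split: if_splits)
  then show ?thesis
  proof induct
    case (Basic U) then show ?case using op by simp
  next
    case Empty show ?case by simp
  next
    case (Compl B)
    \<comment> \<open>Degenerate samples are outside the event of \<open>M11\<close>, so the
      complement is taken inside that event, which is measurable because \<open>M11\<close> is open
      in itself.\<close>
    have "?P (M11 - B) = ?P M11 - ?P B" by auto
    moreover have "?P M11 \<in> sets (iid n N)"
      using op[of M11] openin_topspace[of M11.mtopology] by simp
    ultimately show ?case using Compl by (simp only: sets.Diff)
  next
    case (Union B)
    have "?P (\<Union>i. B i) = (\<Union>i. ?P (B i))" by auto
    then show ?case using Union by (simp only: sets.countable_UN) auto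
  qed
qed

section \<open>The large deviation principle\<close>

lemma elog_ennreal: "0 < r \<Longrightarrow> elog (ennreal r) = ereal (ln r)"
  by (simp add: elog_def)

lemma elog_mono: "x \<le> y \<Longrightarrow> elog x \<le> elog y"
proof -
  assume xy: "x \<le> y"
  consider "x = 0" | "y = \<infinity>" | r s where "x = ennreal r" "y = ennreal s" "0 < r" "r \<le> s"
    using xy by (cases x; cases y) (auto simp: less_le top_unique ennreal_le_iff2)
  then show ?thesis
  proof cases
    case 3
    then show ?thesis by (simp add: elog_ennreal)
  qed (auto simp: elog_def)
qed

lemma less_exp_of_elog_less:
  assumes "elog x < ereal c"
  shows "x < ennreal (exp c)"
proof (cases x)
  case (real r)
  show ?thesis
  proof (cases "r = 0")
    case False
    then have "0 < r" using real by simp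
    then have "ln r < c" using assms real by (simp add: elog_ennreal)
    then have "r < exp c" using \<open>0 < r\<close> by (metis exp_less_mono exp_ln)
    then show ?thesis using real by (simp add: ennreal_lessI)
  qed (use real in simp)
qed (use assms in \<open>simp add: elog_def\<close>)

text \<open>The prefactor K contributes ln K / n and disappears on the exponential scale.\<close>

lemma limsup_elog_le:
  assumes "\<And>n. 1 \<le> n \<Longrightarrow> P n \<le> ennreal (K * exp (- (real n * a)))" "0 < K"
  shows "limsup (\<lambda>n. ereal (1 / real n) * elog (P n)) \<le> ereal (- a)"
proof -
  have "limsup (\<lambda>n. ereal (1 / real n) * elog (P n)) \<le> limsup (\<lambda>n. ereal (ln K / real n - a))"
  proof (rule Limsup_mono, rule eventually_sequentiallyI)
    fix n :: nat assume n: "1 \<le> n"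
    have "ereal (1 / real n) * elog (P n) \<le> ereal (1 / real n) * elog (ennreal (K * exp (- (real n * a))))"
      by (intro ereal_mult_left_mono elog_mono assms(1) n) simp
    also have "\<dots> = ereal (1 / real n * (ln K - real n * a))"
      using assms(2) by (simp add: elog_ennreal ln_mult)
    also have "1 / real n * (ln K - real n * a) = ln K / real n - a" using n by (simp add: field_simps)
    finally show "ereal (1 / real n) * elog (P n) \<le> ereal (ln K / real n - a)" .
  qed
  also have "\<dots> = ereal (- a)"
  proof (rule lim_imp_Limsup)
    have "(\<lambda>n. ln K / real n - a) \<longlonglongrightarrow> - a" by real_asymp
    then show "(\<lambda>n. ereal (ln K / real n - a)) \<longlonglongrightarrow> ereal (- a)" by simp
  qed simp
  finally show ?thesis .
qed

context exp_moments
begin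

interpretation X: prob_space \<xi> by (rule prob)

interpretation Q: prob_space "iid n \<xi>" for n
  by (rule prob_space_PiM) (rule prob)

lemma sum_event_measurable:
  fixes g :: "real \<Rightarrow> real"
  assumes g: "g \<in> borel_measurable borel"
  shows "{y \<in> space (iid n \<xi>). c \<le> (\<Sum>i=1..n. g (y i))} \<in> sets (iid n \<xi>)"
proof -
  have "(\<lambda>y. g (y i)) \<in> borel_measurable (iid n \<xi>)" if "i \<in> {1..n}" for i
    by (rule measurable_compose[OF measurable_sample_component[OF sets_xi that] g])
  then have "(\<lambda>y. \<Sum>i=1..n. g (y i)) \<in> borel_measurable (iid n \<xi>)" by (rule borel_measurable_sum)
  then show ?thesis by measurable
qed

text \<open>A union bound over the constraints of \<open>tight_set\<close>, each violated with a
  Chernoff probability. The factor 3 is 2 from the geometric series of the excess constraints plus 1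
  from the mean constraint.\<close>

lemma exponential_tightness:
  assumes n: "1 \<le> n"
  obtains B where "B \<in> sets (iid n \<xi>)" "emeasure (iid n \<xi>) B \<le> ennreal (3 * exp (- (real n * a)))"
    "\<And>y. y \<in> space (iid n \<xi>) \<Longrightarrow> y \<notin> B \<Longrightarrow> empirical_measure n y \<in> tight_set a"
proof -
  let ?Q = "iid n \<xi>"
  define g where "g k x = (real k + 1)\<^sup>2 * max 0 (x - cutoff k)" for k x
  define Bk where "Bk k = {y \<in> space ?Q. real n * (a + real k + 1) \<le> (\<Sum>i=1..n. g k (y i))}" for k
  define B0 where "B0 = {y \<in> space ?Q. real n * - 1 \<le> (\<Sum>i=1..n. - (rate_const a * y i))}"
  have mg: "g k \<in> borel_measurable borel" for k unfolding g_def[abs_def] by measurable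
  have sB: "Bk k \<in> sets ?Q" "B0 \<in> sets ?Q" for k
    unfolding Bk_def B0_def by (intro sum_event_measurable mg, rule sum_event_measurable) measurable
  \<comment> \<open>The constant 2 is absorbed by e from the unit in the threshold; since n \<ge> 1,
    the remaining exp (-n k) is at most (1 / 2)^k, summable uniformly in n.\<close>
  have eBk: "emeasure ?Q (Bk k) \<le> ennreal (exp (- (real n * a)) * (1 / 2) ^ k)" for k
  proof -
    have "emeasure ?Q (Bk k) \<le> ennreal ((2 * exp (- (a + real k + 1))) ^ n)"
      unfolding Bk_def by (rule chernoff_sample[OF prob sets_xi mg]) (use cutoff(2)[of k] in \<open>simp_all add: g_def\<close>)
    also have "(2 * exp (- (a + real k + 1))) ^ n \<le> (exp (- (a + real k))) ^ n"
    proof (rule power_mono)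
      have "2 \<le> exp (1::real)" using exp_ge_add_one_self[of "1::real"] by simp
      then have "2 * exp (- (a + real k + 1)) \<le> exp 1 * exp (- (a + real k + 1))" by (rule mult_right_mono) simp
      then show "2 * exp (- (a + real k + 1)) \<le> exp (- (a + real k))" by (simp add: mult_exp_exp)
    qed simp
    also have "(exp (- (a + real k))) ^ n = exp (- (real n * a)) * (exp (- real n)) ^ k"
      by (simp add: exp_of_nat_mult[symmetric] mult_exp_exp algebra_simps)
    also have "\<dots> \<le> exp (- (real n * a)) * (1 / 2) ^ k"
    proof (intro mult_left_mono power_mono)
      have "2 \<le> 1 + real n" using n by simp
      then have "2 \<le> exp (real n)" using exp_ge_add_one_self[of "real n"] by linarith
      then show "exp (- real n) \<le> 1 / 2" by (simp add: exp_minus field_simps)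
    qed auto
    finally show ?thesis by (simp add: ennreal_leI)
  qed
  have eB0: "emeasure ?Q B0 \<le> ennreal (exp (- (real n * a)))"
  proof -
    \<comment> \<open>The threshold -1 contributes a factor e per sample, cancelling the extra unit
      in the definition of \<open>rate_const\<close>.\<close>
    have "emeasure ?Q B0 \<le> ennreal ((exp (- (a + 1)) * exp (- (- 1))) ^ n)"
      unfolding B0_def by (rule chernoff_sample[OF prob sets_xi]) (use rate_const(2)[of a] in simp_all)
    also have "(exp (- (a + 1)) * exp (- (- 1))) ^ n = exp (- (real n * a))"
      by (simp add: mult_exp_exp exp_of_nat_mult[symmetric])
    finally show ?thesis .
  qed
  show ?thesis
  proof (rule that[of "(\<Union>k. Bk k) \<union> B0"])
    show "(\<Union>k. Bk k) \<union> B0 \<in> sets ?Q" using sB by auto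
    have "emeasure ?Q (\<Union>k. Bk k) \<le> (\<Sum>k. emeasure ?Q (Bk k))"
      using sB by (intro emeasure_subadditive_countably) auto
    also have "\<dots> \<le> (\<Sum>k. ennreal (exp (- (real n * a)) * (1 / 2) ^ k))"
      by (intro suminf_le eBk) auto
    also have "\<dots> = ennreal (2 * exp (- (real n * a)))"
    proof (rule suminf_ennreal_eq)
      show "(\<lambda>k. exp (- (real n * a)) * (1 / 2) ^ k) sums (2 * exp (- (real n * a)))"
        using sums_mult[OF geometric_sums[of "1/2::real"], of "exp (- (real n * a))"] by (simp add: mult.commute)
    qed simp
    finally have U: "emeasure ?Q (\<Union>k. Bk k) \<le> ennreal (2 * exp (- (real n * a)))" .
    have "emeasure ?Q ((\<Union>k. Bk k) \<union> B0) \<le> emeasure ?Q (\<Union>k. Bk k) + emeasure ?Q B0"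
      using sB by (intro emeasure_subadditive) auto
    also have "\<dots> \<le> ennreal (2 * exp (- (real n * a))) + ennreal (exp (- (real n * a)))"
      by (intro add_mono U eB0)
    also have "\<dots> = ennreal (3 * exp (- (real n * a)))" by (subst ennreal_plus[symmetric]) auto
    finally show "emeasure ?Q ((\<Union>k. Bk k) \<union> B0) \<le> ennreal (3 * exp (- (real n * a)))" .
    fix y assume y: "y \<in> space ?Q" "y \<notin> (\<Union>k. Bk k) \<union> B0"
    have nn: "y \<in> {1..n} \<rightarrow> {0..}" by (rule iid_nonneg[OF sets_xi y(1)])
    show "empirical_measure n y \<in> tight_set a"
      unfolding tight_set_def
    proof (intro CollectI conjI allI)
      show "empirical_measure n y \<in> W1_space" by (rule empirical_measure_in_W1_space[OF n nn])
      fix k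
      have "(real k + 1)\<^sup>2 * (\<integral>x. max 0 (x - cutoff k) \<partial>empirical_measure n y) = (\<integral>x. g k x \<partial>empirical_measure n y)"
        unfolding g_def by simp
      also have "\<dots> = (\<Sum>i=1..n. g k (y i)) / real n" by (rule integral_empirical_measure[OF n nn mg])
      also have "\<dots> \<le> a + real k + 1"
        using y n by (auto simp: Bk_def not_le pos_divide_le_eq mult.commute intro!: less_imp_le)
      finally show "(real k + 1)\<^sup>2 * (\<integral>x. max 0 (x - cutoff k) \<partial>empirical_measure n y) \<le> a + real k + 1" .
    next
      have "(\<Sum>i=1..n. - (rate_const a * y i)) < real n * - 1" using y by (auto simp: B0_def not_le)
      then have "real n < rate_const a * (\<Sum>i=1..n. y i)" by (simp add: sum_negf sum_distrib_left)
      then show "1 \<le> rate_const a * mean (empirical_measure n y)"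
        unfolding mean_empirical_measure[OF n nn] using n by (simp add: field_simps)
    qed
  qed
qed

section \<open>The upper bound by finite covers with half-spaces\<close>

lemma Lipschitz_witness:
  assumes \<nu>: "\<nu> \<in> W1_space" and H: "ereal a < rel_entropy \<nu> \<xi>"
  obtains g where "Lipschitz_bdd g" "a + ln (\<integral>x. exp (g x) \<partial>\<xi>) < (\<integral>x. g x \<partial>\<nu>)"
proof (rule ccontr)
  assume "\<not> thesis"
  then have "\<And>g. Lipschitz_bdd g \<Longrightarrow> (\<integral>x. g x \<partial>\<nu>) \<le> a + ln (\<integral>x. exp (g x) \<partial>\<xi>)"
    using that by (meson not_le)
  from rel_entropy_le_of_Lipschitz_bdd[OF W1_spaceD(3,1)[OF \<nu>] prob sets_xi this] H show False by simp
qed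

lemma openin_Lipschitz_halfspace:
  assumes g: "Lipschitz_bdd g"
  shows "openin W1.mtopology {\<mu> \<in> W1_space. c < (\<integral>x. g x \<partial>\<mu>)}"
  unfolding W1.openin_mtopology
proof (intro conjI allI impI)
  fix \<mu> assume "\<mu> \<in> {\<mu> \<in> W1_space. c < (\<integral>x. g x \<partial>\<mu>)}"
  then have \<mu>: "\<mu> \<in> W1_space" "c < (\<integral>x. g x \<partial>\<mu>)" by auto
  obtain L B where LB: "\<And>x y. \<bar>g x - g y\<bar> \<le> L * \<bar>x - y\<bar>" "\<And>x. \<bar>g x\<bar> \<le> B" "L > 0"
    using Lipschitz_bddD[OF g] by metis
  note m = Lipschitz_bdd_measurable[OF g]
  note int = integrable_Lipschitz_bdd[OF _ g]
  define r where "r = ((\<integral>x. g x \<partial>\<mu>) - c) / L"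
  have "W1.mball \<mu> r \<subseteq> {\<mu> \<in> W1_space. c < (\<integral>x. g x \<partial>\<mu>)}"
  proof
    fix \<nu> assume "\<nu> \<in> W1.mball \<mu> r"
    then have \<nu>: "\<nu> \<in> W1_space" "W1_dist \<mu> \<nu> < r" by (auto simp: W1.mball_def)
    have "\<bar>(\<integral>x. g x \<partial>\<mu>) - (\<integral>x. g x \<partial>\<nu>)\<bar> \<le> L * W1_dist \<mu> \<nu>"
      by (rule integral_Lipschitz_diff_le[OF \<mu>(1) \<nu>(1) m LB(1) int[OF \<mu>(1)] int[OF \<nu>(1)]])
    also have "\<dots> < L * r" using \<nu>(2) LB(3) by simp
    also have "L * r = (\<integral>x. g x \<partial>\<mu>) - c" using LB(3) by (simp add: r_def)
    finally show "\<nu> \<in> {\<mu> \<in> W1_space. c < (\<integral>x. g x \<partial>\<mu>)}" using \<nu>(1) by simp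
  qed
  moreover have "0 < r" using \<mu>(2) LB(3) by (simp add: r_def)
  ultimately show "\<exists>r>0. W1.mball \<mu> r \<subseteq> {\<mu> \<in> W1_space. c < (\<integral>x. g x \<partial>\<mu>)}" by blast
qed auto

text \<open>Normalization is continuous along sequences in \<open>tight_set\<close>, where means are
  bounded below, so the preimage of a closed set is closed in a compact one.\<close>

lemma compactin_tight_preimage:
  assumes C: "closedin M11.mtopology C"
  shows "compactin W1.mtopology {\<nu> \<in> tight_set a. normalize_law \<nu> \<in> C}"
  unfolding W1.compactin_sequentially
proof (intro conjI allI impI)
  show "{\<nu> \<in> tight_set a. normalize_law \<nu> \<in> C} \<subseteq> W1_space" by (auto dest: tight_setD)
  fix \<sigma> :: "nat \<Rightarrow> real measure" assume \<sigma>: "range \<sigma> \<subseteq> {\<nu> \<in> tight_set a. normalize_law \<nu> \<in> C}"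
  then have \<sigma>t: "\<sigma> n \<in> tight_set a" and \<sigma>C: "normalize_law (\<sigma> n) \<in> C" for n by auto
  obtain r \<mu> where r: "strict_mono (r :: nat \<Rightarrow> nat)" "\<mu> \<in> tight_set a" "(\<lambda>n. W1_dist (\<sigma> (r n)) \<mu>) \<longlonglongrightarrow> 0"
    by (rule tight_set_sequentially_compact[OF \<sigma>t])
  let ?d = "1 / rate_const a"
  have d: "0 < ?d" using rate_const(1) by simp
  note W = tight_setD[OF \<sigma>t] tight_setD[OF r(2)]
  have mpos: "0 < mean \<mu>" by (rule less_le_trans[OF d tight_set_mean[OF r(2)]])
  have lim: "(\<lambda>n. W1_dist (normalize_law (\<sigma> (r n))) (normalize_law \<mu>)) \<longlonglongrightarrow> 0"
    by (rule tendsto_normalize_law[OF W(1) tight_set_mean[OF \<sigma>t] d W(2) mpos r(3)])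
  have CM: "C \<subseteq> M11" using closedin_subset[OF C] by simp
  have "limitin M11.mtopology (\<lambda>n. normalize_law (\<sigma> (r n))) (normalize_law \<mu>) sequentially"
    unfolding M11.limitin_metric_dist_null
    using lim subsetD[OF CM \<sigma>C] normalize_law_in_M11[OF W(2) mpos] by simp
  moreover have "range (\<lambda>n. normalize_law (\<sigma> (r n))) \<subseteq> C" using \<sigma>C by auto
  ultimately have "normalize_law \<mu> \<in> C"
    using C unfolding M11.metric_closedin_iff_sequentially_closed by blast
  moreover have "limitin W1.mtopology (\<sigma> \<circ> r) \<mu> sequentially"
    unfolding W1.limitin_metric_dist_null using W r(3) by (simp add: comp_def)
  ultimately show "\<exists>l r. l \<in> {\<nu> \<in> tight_set a. normalize_law \<nu> \<in> C} \<and> strict_mono r \<and> limitin W1.mtopology (\<sigma> \<circ> r) l sequentially"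
    using r by blast
qed

text \<open>Each law in the compact preimage has entropy above a, hence lies in an open half-space
  given by some bounded Lipschitz g. Finitely many of these cover, and Chernoff's inequality bounds
  the probability of each by exp (-n a).\<close>

lemma upper_bound_exponential:
  assumes C: "closedin M11.mtopology C" and a: "\<And>\<rho>. \<rho> \<in> C \<Longrightarrow> ereal a < rate_W \<xi> \<rho>"
  obtains K where "0 < K" 
    "\<And>n. 1 \<le> n \<Longrightarrow> emeasure (iid n \<xi>) (normalized_event n \<xi> C)
        \<le> ennreal (K * exp (- (real n * a)))"
proof -
  define Z where "Z g = (\<integral>x. exp (g x) \<partial>\<xi>)" for g :: "real \<Rightarrow> real"
  define Og where "Og g = {\<mu> \<in> W1_space. a + ln (Z g) < (\<integral>x. g x \<partial>\<mu>)}" for g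
  let ?C' = "{\<nu> \<in> tight_set a. normalize_law \<nu> \<in> C}"
  let ?U = "Og ` {g. Lipschitz_bdd g}"
  have "\<exists>F. finite F \<and> F \<subseteq> ?U \<and> ?C' \<subseteq> \<Union>F"
  proof (rule compactinD[OF compactin_tight_preimage[OF C]])
    show "openin W1.mtopology U" if "U \<in> ?U" for U
      using that openin_Lipschitz_halfspace by (auto simp: Og_def)
    show "?C' \<subseteq> \<Union>?U"
    proof
      fix \<nu> assume \<nu>: "\<nu> \<in> ?C'"
      then have W: "\<nu> \<in> W1_space" and t: "\<nu> \<in> tight_set a" by (auto dest: tight_setD)
      have "0 < 1 / rate_const a" using rate_const(1) by simp
      then have "0 < mean \<nu>" using tight_set_mean[OF t] by linarith
      have "ereal a < rate_W \<xi> (normalize_law \<nu>)" using a \<nu> by simp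
      also have "\<dots> \<le> rel_entropy \<nu> \<xi>" by (rule rate_W_normalize_law_le[OF W \<open>0 < mean \<nu>\<close>])
      finally obtain g where "Lipschitz_bdd g" "a + ln (\<integral>x. exp (g x) \<partial>\<xi>) < (\<integral>x. g x \<partial>\<nu>)"
        by (rule Lipschitz_witness[OF W])
      then show "\<nu> \<in> \<Union>?U" using W by (auto simp: Og_def Z_def)
    qed
  qed
  then obtain F where F: "finite F" "F \<subseteq> ?U" "?C' \<subseteq> \<Union>F" by blast
  then obtain G where G: "finite G" "G \<subseteq> {g. Lipschitz_bdd g}" "F = Og ` G"
    by (meson finite_subset_image)
  define E where "E n g = {y \<in> space (iid n \<xi>). real n * (a + ln (Z g)) \<le> (\<Sum>i=1..n. g (y i))}" for n g
  have Em: "E n g \<in> sets (iid n \<xi>)" and Ee: "emeasure (iid n \<xi>) (E n g) \<le> ennreal (exp (- (real n * a)))"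
    if "g \<in> G" for n g
  proof -
    have g: "Lipschitz_bdd g" using G that by auto
    note m = Lipschitz_bdd_measurable[OF g]
    obtain B where B: "\<And>x. \<bar>g x\<bar> \<le> B" using Lipschitz_bddD[OF g] by metis
    note pos = exp_bounded_integral(2)[OF prob meas[OF m] B, folded Z_def]
    note nn = exp_bounded_integral(3)[OF prob meas[OF m] B, folded Z_def]
    show "E n g \<in> sets (iid n \<xi>)" unfolding E_def by (rule sum_event_measurable[OF m])
    have "emeasure (iid n \<xi>) (E n g) \<le> ennreal ((Z g * exp (- (a + ln (Z g)))) ^ n)"
      unfolding E_def by (rule chernoff_sample[OF prob sets_xi m nn]) (use pos in simp)
    also have "Z g * exp (- (a + ln (Z g))) = exp (- a)" using pos by (simp add: exp_diff exp_minus)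
    also have "exp (- a) ^ n = exp (- (real n * a))" by (simp add: exp_of_nat_mult[symmetric])
    finally show "emeasure (iid n \<xi>) (E n g) \<le> ennreal (exp (- (real n * a)))" .
  qed
  show ?thesis
  \<comment> \<open>The 3 pays for samples outside \<open>tight_set\<close>, and each half-space of
    the cover adds 1.\<close>
  proof (rule that[of "3 + real (card G)"])
    fix n :: nat assume n: "1 \<le> n"
    let ?Q = "iid n \<xi>"
    obtain B where B: "B \<in> sets ?Q" "emeasure ?Q B \<le> ennreal (3 * exp (- (real n * a)))"
      "\<And>y. y \<in> space ?Q \<Longrightarrow> y \<notin> B \<Longrightarrow> empirical_measure n y \<in> tight_set a"
      using exponential_tightness[OF n, of a] by blast
    have "normalized_event n \<xi> C \<subseteq> B \<union> (\<Union>g\<in>G. E n g)"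
    proof
      fix y assume "y \<in> normalized_event n \<xi> C"
      then have y: "y \<in> space ?Q" "empirical_measure n (normalized n y) \<in> C" by auto
      show "y \<in> B \<union> (\<Union>g\<in>G. E n g)"
      proof (cases "y \<in> B")
        case False
        have nn: "y \<in> {1..n} \<rightarrow> {0..}" by (rule iid_nonneg[OF sets_xi y(1)])
        have "C \<subseteq> M11" using closedin_subset[OF C] by simp
        then have "0 < (\<Sum>i=1..n. y i)" using y(2) by (intro empirical_normalized_not_in_M11[OF n nn]) auto
        from empirical_normalized_in_M11(2)[OF n nn this]
        have "empirical_measure n y \<in> ?C'" using B(3)[OF y(1) False] y(2) by simp
        then obtain g where g: "g \<in> G" "empirical_measure n y \<in> Og g" using F(3) G(3) by auto
        have m: "g \<in> borel_measurable borel" using g(1) G(2) by (auto intro: Lipschitz_bdd_measurable)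
        have "a + ln (Z g) < (\<Sum>i=1..n. g (y i)) / real n"
          using g(2) by (simp add: Og_def integral_empirical_measure[OF n nn m])
        then have "y \<in> E n g" using y(1) n by (auto simp: E_def field_simps)
        then show ?thesis using g(1) by blast
      qed simp
    qed
    then have "emeasure ?Q (normalized_event n \<xi> C) \<le> emeasure ?Q (B \<union> (\<Union>g\<in>G. E n g))"
      using B(1) Em G(1) by (intro emeasure_mono) (auto intro!: sets.Un sets.finite_UN)
    also have "\<dots> \<le> emeasure ?Q B + emeasure ?Q (\<Union>g\<in>G. E n g)"
      using B(1) Em G(1) by (intro emeasure_subadditive) auto
    also have "emeasure ?Q (\<Union>g\<in>G. E n g) \<le> (\<Sum>g\<in>G. emeasure ?Q (E n g))"
      using Em G(1) by (intro emeasure_subadditive_finite) auto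
    also have "\<dots> \<le> (\<Sum>g\<in>G. ennreal (exp (- (real n * a))))" by (intro sum_mono Ee)
    also have "\<dots> = ennreal (real (card G) * exp (- (real n * a)))"
      by (simp add: ennreal_mult ennreal_of_nat_eq_real_of_nat)
    also have "emeasure ?Q B + ennreal (real (card G) * exp (- (real n * a)))
       \<le> ennreal (3 * exp (- (real n * a))) + ennreal (real (card G) * exp (- (real n * a)))"
      by (intro add_mono B(2) order_refl)
    also have "\<dots> = ennreal ((3 + real (card G)) * exp (- (real n * a)))"
      by (subst ennreal_plus[symmetric]) (auto simp: distrib_right)
    finally show "emeasure ?Q (normalized_event n \<xi> C)
       \<le> ennreal ((3 + real (card G)) * exp (- (real n * a)))" by (simp add: add_left_mono)
  qed simp
qed

theorem LDP_upper_bound: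
  assumes A: "A \<in> sets (borel_of M11.mtopology)"
  shows "limsup (\<lambda>n. ereal (1 / real n) * elog (emeasure (iid n \<xi>)
      (normalized_event n \<xi> A)))
    \<le> - (INF \<rho> \<in> M11.mtopology closure_of A. rate_W \<xi> \<rho>)" (is "?L \<le> - ?J")
proof (rule ccontr)
  assume "\<not> ?L \<le> - ?J"
  then have "- ?L < ?J" by (simp add: ereal_uminus_less_reorder not_le)
  \<comment> \<open>A real level strictly in between also covers an infinite infimum, in particular
    an empty closure.\<close>
  then obtain a where a: "- ?L < ereal a" "ereal a < ?J" using ereal_dense2 by blast
  let ?S = "\<lambda>n. normalized_event n \<xi>"
  let ?C = "M11.mtopology closure_of A"
  have C: "closedin M11.mtopology ?C" by simp
  have aC: "ereal a < rate_W \<xi> \<rho>" if "\<rho> \<in> ?C" for \<rho>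
    using less_le_trans[OF a(2) INF_lower[OF that]] .
  obtain K where K: "0 < K" "\<And>n. 1 \<le> n \<Longrightarrow> emeasure (iid n \<xi>) (?S n ?C) \<le> ennreal (K * exp (- (real n * a)))"
    using upper_bound_exponential[OF C, of a] aC by blast
  have "A \<subseteq> topspace M11.mtopology"
    using sets.sets_into_space[OF A] by (simp add: borel_of_def space_measure_of_conv)
  then have AC: "A \<subseteq> ?C" by (rule closure_of_subset)
  have Cb: "?C \<in> sets (borel_of M11.mtopology)"
  proof -
    have "topspace M11.mtopology - ?C \<in> sets (borel_of M11.mtopology)"
      using openin_subset[of M11.mtopology] C
      by (auto simp: borel_of_def sets_measure_of_conv Pow_def closedin_def intro!: sigma_sets.Basic)
    then have "space (borel_of M11.mtopology) - (topspace M11.mtopology - ?C) \<in> sets (borel_of M11.mtopology)"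
      by (rule sets.compl_sets)
    moreover have "space (borel_of M11.mtopology) - (topspace M11.mtopology - ?C) = ?C"
      using closedin_subset[OF C] by (auto simp: borel_of_def space_measure_of_conv)
    ultimately show ?thesis by simp
  qed
  have "?L \<le> ereal (- a)"
  proof (rule limsup_elog_le[OF _ K(1)])
    fix n :: nat assume n: "1 \<le> n"
    have "emeasure (iid n \<xi>) (?S n A) \<le> emeasure (iid n \<xi>) (?S n ?C)"
      using AC by (intro emeasure_mono sets_normalized_event[OF n sets_xi Cb]) auto
    then show "emeasure (iid n \<xi>) (?S n A) \<le> ennreal (K * exp (- (real n * a)))"
      using K(2)[OF n] by (rule order_trans)
  qed
  then show False using a(1) by (simp add: ereal_uminus_less_reorder flip: uminus_ereal.simps(1))
qed

section \<open>The lower bound by change of measure\<close>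

lemma lower_bound_at_law:
  assumes \<nu>: "\<nu> \<in> W1_space" and m: "0 < mean \<nu>" and h: "rel_entropy \<nu> \<xi> = ereal h"
    and A: "A \<in> sets (borel_of M11.mtopology)" and r: "0 < r" "M11.mball (normalize_law \<nu>) r \<subseteq> A"
  shows "ereal (- h) \<le> liminf (\<lambda>n. ereal (1 / real n) * elog (emeasure (iid n \<xi>)
      (normalized_event n \<xi> A)))"
proof -
  note D = W1_spaceD[OF \<nu>]
  have s: "sets \<nu> = sets \<xi>" using D(1) sets_xi by simp
  have sQ: "sets (iid n \<nu>) = sets (iid n \<xi>)" for n by (intro sets_PiM_cong refl s)
  have spQ: "space (iid n \<nu>) = space (iid n \<xi>)" for n by (rule sets_eq_imp_space_eq[OF sQ])
  interpret QN: prob_space "iid n \<nu>" for n by (rule prob_space_PiM) (rule D(3))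
  define E where "E n = normalized_event n \<xi> A" for n
  have Em: "E n \<in> sets (iid n \<xi>)" if "1 \<le> n" for n
    unfolding E_def by (rule sets_normalized_event[OF that sets_xi A])
  \<comment> \<open>The first entry keeps the mean of a nearby law above half of
    \<open>mean \<nu>\<close>; the second then makes the distance after normalization less than 2 (r
    mean / 4) / (mean / 2) = r.\<close>
  define d where "d = min (mean \<nu> / 2) (r * mean \<nu> / 4)"
  have d: "0 < d" using m r by (simp add: d_def)
  have near: "normalize_law \<mu> \<in> A \<and> 0 < mean \<mu>" if \<mu>: "\<mu> \<in> W1_space" "W1_dist \<mu> \<nu> < d" for \<mu>
  proof -
    have "\<bar>mean \<mu> - mean \<nu>\<bar> \<le> W1_dist \<mu> \<nu>" by (rule mean_diff_le[OF \<mu>(1) \<nu>])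
    then have half: "mean \<nu> / 2 < mean \<mu>" using \<mu>(2) by (auto simp: d_def)
    then have pos: "0 < mean \<mu>" using m by simp
    have "W1_dist (normalize_law \<mu>) (normalize_law \<nu>) \<le> 2 * W1_dist \<mu> \<nu> / mean \<mu>"
      by (rule W1_dist_normalize_law_le[OF \<mu>(1) \<nu> pos m])
    also have "\<dots> < r"
    proof -
      have "2 * W1_dist \<mu> \<nu> < r * (mean \<nu> / 2)" using \<mu>(2) by (simp add: d_def)
      also have "\<dots> \<le> r * mean \<mu>" using half r by (intro mult_left_mono) auto
      finally show ?thesis using pos by (simp add: pos_divide_less_eq)
    qed
    finally have "normalize_law \<mu> \<in> M11.mball (normalize_law \<nu>) r"
      using normalize_law_in_M11[OF \<mu>(1) pos] normalize_law_in_M11[OF \<nu> m] by (simp add: M11.mball_def W1_dist_commute)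
    then show ?thesis using r(2) pos by blast
  qed
  define p where "p n = measure (iid n \<nu>) (E n)" for n
  define u where "u n = (\<integral>\<^sup>+y. empirical_gap n \<nu> y \<partial>iid n \<nu>)" for n
  \<comment> \<open>Samples that miss the event have empirical measure at distance at least d from
    \<nu>, so this is Markov's inequality for the expected gap.\<close>
  have pl: "ennreal (1 - p n) \<le> ennreal (1 / d) * u n" if n: "1 \<le> n" for n
  proof -
    have En: "E n \<in> sets (iid n \<nu>)" using Em[OF n] sQ by simp
    have "ennreal (1 - p n) = emeasure (iid n \<nu>) (space (iid n \<nu>) - E n)"
      using QN.prob_compl[OF En] by (simp add: p_def QN.emeasure_eq_measure)
    also have "\<dots> \<le> emeasure (iid n \<nu>)
        ({y \<in> space (iid n \<nu>). 1 \<le> ennreal (1 / d) * empirical_gap n \<nu> y})"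
    proof (rule emeasure_mono)
      show "space (iid n \<nu>) - E n \<subseteq> {y \<in> space (iid n \<nu>). 1 \<le> ennreal (1 / d) * empirical_gap n \<nu> y}"
      proof
        fix y assume "y \<in> space (iid n \<nu>) - E n"
        then have y: "y \<in> space (iid n \<nu>)" "y \<notin> E n" by auto
        have nn: "y \<in> {1..n} \<rightarrow> {0..}" by (rule iid_nonneg[OF D(1) y(1)])
        have W: "empirical_measure n y \<in> W1_space" by (rule empirical_measure_in_W1_space[OF n nn])
        have "d \<le> W1_dist (empirical_measure n y) \<nu>"
        proof (rule ccontr)
          assume "\<not> ?thesis"
          then have "normalize_law (empirical_measure n y) \<in> A" "0 < mean (empirical_measure n y)"
            using near[OF W] by auto
          moreover have "0 < (\<Sum>i=1..n. y i)"
            using calculation(2) n by (simp add: mean_empirical_measure[OF n nn] zero_less_divide_iff)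
          ultimately have "y \<in> E n" using y(1) spQ empirical_normalized_in_M11(2)[OF n nn] by (simp add: E_def)
          with y(2) show False by simp
        qed
        then have "1 \<le> 1 / d * W1_dist (empirical_measure n y) \<nu>" using d by (simp add: field_simps)
        then have "1 \<le> ennreal (1 / d) * ennreal (W1_dist (empirical_measure n y) \<nu>)"
          using d by (simp add: ennreal_mult'[symmetric] W1_dist_nonneg)
        then show "y \<in> {y \<in> space (iid n \<nu>). 1 \<le> ennreal (1 / d) * empirical_gap n \<nu> y}"
          using y(1) by (simp add: empirical_gap_eq[OF n \<nu> nn])
      qed
      show "{y \<in> space (iid n \<nu>). 1 \<le> ennreal (1 / d) * empirical_gap n \<nu> y} \<in> sets (iid n \<nu>)"
        using measurable_empirical_gap[OF \<nu> D(1)] by measurable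
    qed
    also have "\<dots> \<le> ennreal (1 / d) * (\<integral>\<^sup>+y. empirical_gap n \<nu> y * indicator (space (iid n \<nu>)) y \<partial>iid n \<nu>)"
      by (rule nn_integral_Markov_inequality) (use measurable_empirical_gap[OF \<nu> D(1)] in measurable)
    also have "(\<integral>\<^sup>+y. empirical_gap n \<nu> y * indicator (space (iid n \<nu>)) y \<partial>iid n \<nu>) = u n"
      unfolding u_def by (intro nn_integral_cong) simp
    finally show ?thesis .
  qed
  have plim: "p \<longlonglongrightarrow> 1"
  proof -
    have "(\<lambda>n. ennreal (1 / d) * u n) \<longlonglongrightarrow> ennreal (1 / d) * 0"
      unfolding u_def by (intro tendsto_mult_ennreal tendsto_const empirical_measure_LLN[OF \<nu>]) simp
    then have "(\<lambda>n. ennreal (1 / d) * u n) \<longlonglongrightarrow> 0" by simp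
    then have "(\<lambda>n. ennreal (1 - p n)) \<longlonglongrightarrow> 0"
      by (rule tendsto_sandwich[OF _ _ tendsto_const, rotated 2])
         (auto intro!: eventually_sequentiallyI[of 1] pl)
    then have "(\<lambda>n. 1 - p n) \<longlonglongrightarrow> 0"
      by (subst (asm) tendsto_ennreal_iff[of _ _ 0, simplified]) (auto simp: p_def)
    from tendsto_diff[OF tendsto_const[of 1] this] show ?thesis by simp
  qed
  define q where "q n = measure (iid n \<xi>) (E n)" for n
  have bound: "l * p n \<le> real n * h + ln (1 + exp l * q n)" if "1 \<le> n" "0 \<le> l" for n l
    unfolding p_def q_def by (rule sample_entropy_lower_bound[OF prob D(3) s h Em[OF that(1)] that(2)])
  \<comment> \<open>For q = 0 the entropy bound would read l p \<le> n h for all l \<ge> 0, which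
    fails at l = (|n h| + 1) / p.\<close>
  have qpos: "0 < q n" if n: "1 \<le> n" "0 < p n" for n
  proof (rule ccontr)
    assume "\<not> 0 < q n"
    then have q0: "q n = 0" using measure_nonneg[of "iid n \<xi>" "E n"] by (simp add: q_def)
    have "(\<bar>real n * h\<bar> + 1) / p n * p n \<le> real n * h + ln (1 + exp ((\<bar>real n * h\<bar> + 1) / p n) * q n)"
      using n by (intro bound) auto
    then show False using n q0 by simp
  qed
  have q1: "q n \<le> 1" for n by (simp add: q_def)
  have key: "ereal (- (h + ln 2 / real n) / p n) \<le> ereal (1 / real n) * elog (emeasure (iid n \<xi>) (E n))"
    if n: "1 \<le> n" "0 < p n" for n
  proof -
    note q = qpos[OF n]
    \<comment> \<open>The choice l = - ln q makes exp l * q equal to 1, so the logarithmic term is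
      ln 2 and is lost after division by n.\<close>
    have "- ln (q n) * p n \<le> real n * h + ln (1 + exp (- ln (q n)) * q n)"
      using q q1[of n] n by (intro bound) (auto simp: ln_le_zero_iff)
    also have "1 + exp (- ln (q n)) * q n = 2" using q by (simp add: exp_minus)
    finally have "- (real n * h + ln 2) / p n \<le> ln (q n)"
      using n by (simp add: pos_divide_le_eq)
    then have "1 / real n * (- (real n * h + ln 2) / p n) \<le> 1 / real n * ln (q n)"
      by (rule mult_left_mono) simp
    also have "1 / real n * (- (real n * h + ln 2) / p n) = - (h + ln 2 / real n) / p n"
      using n by (simp add: field_simps)
    finally have "ereal (- (h + ln 2 / real n) / p n) \<le> ereal (1 / real n * ln (q n))" by simp
    also have "\<dots> = ereal (1 / real n) * elog (emeasure (iid n \<xi>) (E n))"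
      using q by (simp add: Q.emeasure_eq_measure elog_ennreal flip: q_def)
    finally show ?thesis .
  qed
  have "(\<lambda>n. - (h + ln 2 / real n) / p n) \<longlonglongrightarrow> - (h + 0) / 1"
  proof (rule tendsto_divide[OF _ plim])
    show "(\<lambda>n. - (h + ln 2 / real n)) \<longlonglongrightarrow> - (h + 0)" by real_asymp
  qed simp
  then have lim: "(\<lambda>n. ereal (- (h + ln 2 / real n) / p n)) \<longlonglongrightarrow> ereal (- h)" by simp
  have "ereal (- h) = liminf (\<lambda>n. ereal (- (h + ln 2 / real n) / p n))"
    by (rule lim_imp_Liminf[OF _ lim, symmetric]) simp
  also have "\<dots> \<le> liminf (\<lambda>n. ereal (1 / real n) * elog (emeasure (iid n \<xi>) (E n)))"
  proof (rule Liminf_mono)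
    have "eventually (\<lambda>n. 0 < p n) sequentially" using plim by (rule order_tendstoD) simp
    then show "eventually (\<lambda>n. ereal (- (h + ln 2 / real n) / p n)
       \<le> ereal (1 / real n) * elog (emeasure (iid n \<xi>) (E n))) sequentially"
      using eventually_ge_at_top[of 1] by eventually_elim (rule key)
  qed
  finally show ?thesis unfolding E_def .
qed

text \<open>For an interior point \<rho> every scale m gives a law that normalizes to \<rho>, hence
  a lower bound of its own; the infimum over m and \<rho> is taken only at the end. Scales of
  infinite entropy ask for nothing.\<close>

theorem LDP_lower_bound:
  assumes A: "A \<in> sets (borel_of M11.mtopology)"
  shows "- (INF \<rho> \<in> M11.mtopology interior_of A. rate_W \<xi> \<rho>)
    \<le> liminf (\<lambda>n. ereal (1 / real n) * elog (emeasure (iid n \<xi>)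
      (normalized_event n \<xi> A)))" (is "_ \<le> ?L")
proof -
  have "- ?L \<le> rel_entropy (G_scale \<rho> (1 / m)) \<xi>"
    if \<rho>: "\<rho> \<in> M11.mtopology interior_of A" and m: "0 < m" for \<rho> m
  proof (cases "rel_entropy (G_scale \<rho> (1 / m)) \<xi> = \<infinity>")
    case False
    obtain r where r: "0 < r" "M11.mball \<rho> r \<subseteq> M11.mtopology interior_of A"
      using \<rho> openin_interior_of[of M11.mtopology A] unfolding M11.openin_mtopology by blast
    have \<rho>M: "\<rho> \<in> M11" using \<rho> interior_of_subset_topspace[of M11.mtopology A] by auto
    have W: "G_scale \<rho> (1 / m) \<in> W1_space"
      using \<rho>M M11_subset m by (intro G_scale_in_W1_space) auto
    have mean: "0 < mean (G_scale \<rho> (1 / m))"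
      using mean_G_scale[of \<rho> "1 / m"] \<rho>M m by (simp add: M11_def)
    have nn: "0 \<le> rel_entropy (G_scale \<rho> (1 / m)) \<xi>"
      by (rule rel_entropy_nonneg[OF W1_spaceD(3)[OF W] prob]) (simp add: W1_spaceD(1)[OF W] sets_xi)
    then obtain h where h: "rel_entropy (G_scale \<rho> (1 / m)) \<xi> = ereal h"
      using False by (cases "rel_entropy (G_scale \<rho> (1 / m)) \<xi>") auto
    have "ereal (- h) \<le> ?L"
      by (rule lower_bound_at_law[OF W mean h A r(1)])
         (use r(2) interior_of_subset[of M11.mtopology A] normalize_law_G_scale[OF \<rho>M m] in auto)
    then show ?thesis unfolding h by (simp add: ereal_uminus_le_reorder)
  qed simp
  then have "- ?L \<le> (INF \<rho> \<in> M11.mtopology interior_of A. rate_W \<xi> \<rho>)"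
    unfolding rate_W_def by (intro INF_greatest) auto
  then show ?thesis by (simp add: ereal_uminus_le_reorder)
qed

end

section \<open>From the hypotheses on the cumulants to the law of the sample\<close>

lemma exp_momentsI:
  assumes "prob_space \<xi>" "sets \<xi> = sets Rplus"
    and fin: "\<And>\<alpha>. \<alpha> > 0 \<Longrightarrow> cumulant \<xi> \<alpha> < \<infinity>"
    and conj: "cumulant_conj \<xi> 0 = \<infinity>"
  shows "exp_moments \<xi>"
proof (rule exp_moments.intro)
  interpret X: prob_space \<xi> by fact
  show "prob_space \<xi>" "sets \<xi> = sets Rplus" by fact+
  fix \<alpha> :: real assume "\<alpha> > 0"
  from fin[OF this] show "(\<integral>\<^sup>+x. ennreal (exp (\<alpha> * x)) \<partial>\<xi>) < \<infinity>"
    by (auto simp: cumulant_def elog_def less_top[symmetric])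
next
  interpret X: prob_space \<xi> by fact
  fix e :: real assume e: "e > 0"
  \<comment> \<open>The bound is kept below 1 because the exponential integral is at least 1 for
    \<alpha> \<ge> 0; this forces the \<alpha> found below to be negative.\<close>
  define e' where "e' = min e (1 / 2)"
  have e': "0 < e'" "e' \<le> e" "e' < 1" using e by (auto simp: e'_def)
  \<comment> \<open>At the point 0 the conjugate is the supremum of the negated cumulants, so its
    being infinite makes exponential integrals arbitrarily small.\<close>
  have "ereal (- ln e') < cumulant_conj \<xi> 0" using conj by simp
  then obtain \<alpha> where "ereal (- ln e') < ereal (\<alpha> * 0) - cumulant \<xi> \<alpha>"
    unfolding cumulant_conj_def less_SUP_iff by auto
  then have "cumulant \<xi> \<alpha> < ereal (ln e')" by (cases "cumulant \<xi> \<alpha>") auto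
  then have lt: "(\<integral>\<^sup>+x. ennreal (exp (\<alpha> * x)) \<partial>\<xi>) < ennreal e'"
    using less_exp_of_elog_less[of _ "ln e'"] e'(1) by (simp add: cumulant_def)
  have "\<alpha> < 0"
  proof (rule ccontr)
    assume "\<not> \<alpha> < 0"
    then have "(\<integral>\<^sup>+x. 1 \<partial>\<xi>) \<le> (\<integral>\<^sup>+x. ennreal (exp (\<alpha> * x)) \<partial>\<xi>)"
      using space_Rplus_cong[OF assms(2)] by (intro nn_integral_mono) auto
    then have "1 \<le> (\<integral>\<^sup>+x. ennreal (exp (\<alpha> * x)) \<partial>\<xi>)" by (simp add: X.emeasure_space_1)
    from le_less_trans[OF this lt] have "1 < ennreal e'" .
    then show False using e' by simp
  qed
  then show "\<exists>l>0. (\<integral>\<^sup>+x. ennreal (exp (- (l * x))) \<partial>\<xi>) \<le> ennreal e"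
    using lt e'(2) by (intro exI[of _ "- \<alpha>"]) (auto intro: less_imp_le order_trans[OF less_imp_le ennreal_leI])
qed

text \<open>The atom at 0 contributes its full mass to every integral of exp (-l x), and these
  become arbitrarily small.\<close>

lemma (in exp_moments) AE_positive: "AE x in \<xi>. 0 < x"
proof -
  have sp: "space \<xi> = {0..}" by (rule space_Rplus_cong[OF sets_xi])
  have z: "{0} \<in> sets \<xi>" by (simp add: sets_xi sets_restrict_space_iff)
  have "emeasure \<xi> {0} \<le> ennreal e" if e: "0 < e" for e
  proof -
    obtain l where l: "(\<integral>\<^sup>+x. ennreal (exp (- (l * x))) \<partial>\<xi>) \<le> ennreal e" using exp_small[OF e] by blast
    have "emeasure \<xi> {0} = (\<integral>\<^sup>+x. indicator {0} x \<partial>\<xi>)" using z by simp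
    also have "\<dots> \<le> (\<integral>\<^sup>+x. ennreal (exp (- (l * x))) \<partial>\<xi>)" by (intro nn_integral_mono) (auto simp: indicator_def)
    finally show ?thesis using l by (rule order_trans)
  qed
  then have "emeasure \<xi> {0} \<le> 0" by (intro ennreal_le_epsilon[of 0]) simp
  then have "emeasure \<xi> {0} = 0" by simp
  then have "AE x in \<xi>. x \<notin> {0}" using z by (intro AE_not_in null_setsI)
  then show ?thesis using AE_space by eventually_elim (auto simp: sp)
qed

theorem theorem2p2:
  fixes M :: "'b measure" and Y :: "nat \<Rightarrow> 'b \<Rightarrow> real" and \<xi> :: "real measure"
  assumes "prob_space M"
    and "prob_space.indep_vars M (\<lambda>_. Rplus) Y {1..}"
    and "\<And>i. i \<ge> 1 \<Longrightarrow> distr M Rplus (Y i) = \<xi>"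
    and "\<And>\<alpha>. \<alpha> > 0 \<Longrightarrow> cumulant \<xi> \<alpha> < \<infinity>"
    and "cumulant_conj \<xi> 0 = \<infinity>"
  shows "LDP_rv M M11_topology
           (\<lambda>n \<omega>. empirical_measure n (\<lambda>i. normalized_sample Y n i \<omega>)) (rate_W \<xi>) \<and>
         good_rate_function M11_topology (rate_W \<xi>)"
proof -
  interpret M: prob_space M by fact
  have mY: "Y i \<in> measurable M Rplus" if "1 \<le> i" for i
    using assms(2) that by (auto simp: M.indep_vars_def)
  have \<xi>: "prob_space \<xi>" "sets \<xi> = sets Rplus"
    using M.prob_space_distr[OF mY[of 1]] assms(3)[of 1] by auto
  interpret exp_moments \<xi> by (rule exp_momentsI[OF \<xi> assms(4,5)])
  define S where "S n \<omega> = empirical_measure n (\<lambda>i. normalized_sample Y n i \<omega>)" for n \<omega>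
  \<comment> \<open>Restriction to the first n variables gives a point of the finite product space;
    independence makes its law the product of copies of \<xi>, and \<open>S n\<close> depends on
    \<omega> only through it.\<close>
  define T where "T n \<omega> = (\<lambda>i\<in>{1..n}. Y i \<omega>)" for n \<omega>
  have ST: "S n \<omega> = empirical_measure n (normalized n (T n \<omega>))" for n \<omega>
    unfolding S_def by (rule empirical_measure_cong) (auto simp: normalized_sample_def normalized_def T_def)
  have mT: "T n \<in> measurable M (iid n Rplus)" for n
    unfolding T_def[abs_def] by (intro measurable_restrict mY) auto
  have law: "distr M (iid n Rplus) (T n) = iid n \<xi>" if n: "1 \<le> n" for n
  proof -
    have "M.indep_vars (\<lambda>_. Rplus) Y {1..n}" by (rule M.indep_vars_subset[OF assms(2)]) auto
    then have "distr M (iid n Rplus) (T n) = PiM {1..n} (\<lambda>i. distr M Rplus (Y i))"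
      unfolding T_def[abs_def] using n by (subst (asm) M.indep_vars_iff_distr_eq_PiM') (auto intro: mY)
    also have "\<dots> = iid n \<xi>" by (intro PiM_cong refl assms(3)) auto
    finally show ?thesis .
  qed
  have sps: "space (iid n Rplus) = space (iid n \<xi>)"
    "sets (iid n Rplus) = sets (iid n \<xi>)" for n
    using \<xi>(2) by (auto intro!: sets_PiM_cong sets_eq_imp_space_eq)
  let ?E = "\<lambda>n. normalized_event n \<xi>"
  have pre: "S n -` A \<inter> space M = T n -` ?E n A \<inter> space M" for n A
    using measurable_space[OF mT] by (auto simp: ST sps)
  have pos: "AE \<omega> in M. S n \<omega> \<in> M11" if n: "1 \<le> n" for n
  proof -
    have "distr M Rplus (Y 1) = \<xi>" by (rule assms(3)) simp
    then have "AE x in distr M Rplus (Y 1). 0 < x" using AE_positive by metis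
    then have "AE \<omega> in M. 0 < Y 1 \<omega>" by (rule AE_distrD[OF mY[OF order_refl]])
    with AE_space show ?thesis
    proof eventually_elim
      case (elim \<omega>)
      have nn: "T n \<omega> \<in> {1..n} \<rightarrow> {0..}"
        using measurable_space[OF mY elim(1)] by (auto simp: T_def space_restrict_space)
      \<comment> \<open>Positivity of the first variable alone makes the sum positive.\<close>
      have "T n \<omega> 1 \<le> (\<Sum>i=1..n. T n \<omega> i)" using nn n by (intro member_le_sum) (auto simp: Pi_iff)
      then have "0 < (\<Sum>i=1..n. T n \<omega> i)" using elim(2) n by (simp add: T_def)
      then show ?case unfolding ST by (rule empirical_normalized_in_M11(1)[OF n nn])
    qed
  qed
  have re: "random_element M M11.mtopology (S n)" if n: "1 \<le> n" for n
    unfolding random_element_def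
  proof (intro conjI ballI)
    show "AE \<omega> in M. S n \<omega> \<in> topspace M11.mtopology" using pos[OF n] by simp
    fix A assume "A \<in> sets (borel_of M11.mtopology)"
    from sets_normalized_event[OF n sets_xi this] show "S n -` A \<inter> space M \<in> sets M"
      unfolding pre by (intro measurable_sets[OF mT]) (simp add: sps)
  qed
  have eE: "emeasure (distr M (borel_of M11.mtopology) (S n)) A = emeasure (iid n \<xi>) (?E n A)"
    if n: "1 \<le> n" and A: "A \<in> sets (borel_of M11.mtopology)" for n A
  proof -
    have "emeasure (distr M (borel_of M11.mtopology) (S n)) A = emeasure M {\<omega> \<in> space M. S n \<omega> \<in> A}"
      by (rule emeasure_law_random_element[OF re[OF n] A])
    also have "{\<omega> \<in> space M. S n \<omega> \<in> A} = T n -` ?E n A \<inter> space M" using pre[of n A] by auto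
    also have "emeasure M \<dots> = emeasure (distr M (iid n Rplus) (T n)) (?E n A)"
      using sets_normalized_event[OF n sets_xi A] by (intro emeasure_distr[OF mT, symmetric]) (simp add: sps)
    finally show ?thesis by (simp add: law[OF n])
  qed
  have ps: "prob_space (distr M (borel_of M11.mtopology) (S n))" if n: "1 \<le> n" for n
  proof (rule prob_spaceI)
    let ?P = "distr M (borel_of M11.mtopology) (S n)"
    have sp: "space ?P = M11" by (simp add: borel_of_def space_measure_of_conv)
    have "emeasure ?P (space ?P) = emeasure M {\<omega> \<in> space M. S n \<omega> \<in> space ?P}"
      by (rule emeasure_law_random_element[OF re[OF n]]) (use sets.top[of ?P] in simp)
    also have "\<dots> = 1"
    proof (rule M.emeasure_eq_1_AE)
      have "space ?P \<in> sets (borel_of M11.mtopology)" using sets.top[of ?P] by simp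
      then have "S n -` space ?P \<inter> space M \<in> sets M" using re[OF n] by (simp add: random_element_def)
      moreover have "S n -` space ?P \<inter> space M = {\<omega> \<in> space M. S n \<omega> \<in> space ?P}" by auto
      ultimately show "{\<omega> \<in> space M. S n \<omega> \<in> space ?P} \<in> sets M" by simp
      show "AE \<omega> in M. \<omega> \<in> {\<omega> \<in> space M. S n \<omega> \<in> space ?P}"
        unfolding sp using pos[OF n] AE_space by eventually_elim simp
    qed
    finally show "emeasure ?P (space ?P) = 1" .
  qed
  note good = good_rate_function_rate_W
  \<comment> \<open>The identification of laws needs n \<ge> 1; eventual equality is enough for the
    limits.\<close>
  have ev: "eventually (\<lambda>n. ereal (1 / real n) * elog (emeasure (distr M (borel_of M11.mtopology) (S n)) A)
       = ereal (1 / real n) * elog (emeasure (iid n \<xi>) (?E n A))) sequentially"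
    if "A \<in> sets (borel_of M11.mtopology)" for A
    using eventually_ge_at_top[of 1] by eventually_elim (simp add: eE that)
  have "LDP M11.mtopology (\<lambda>n. distr M (borel_of M11.mtopology) (S n)) (rate_W \<xi>)"
    unfolding LDP_def
  proof (intro conjI allI impI ballI)
    show "rate_function M11.mtopology (rate_W \<xi>)" using good by (simp add: good_rate_function_def)
    fix A assume A: "A \<in> sets (borel_of M11.mtopology)"
    show "liminf (\<lambda>n. ereal (1 / real n) * elog (emeasure (distr M (borel_of M11.mtopology) (S n)) A))
       \<le> limsup (\<lambda>n. ereal (1 / real n) * elog (emeasure (distr M (borel_of M11.mtopology) (S n)) A))"
      by (rule Liminf_le_Limsup) simp
    show "- (INF x \<in> M11.mtopology interior_of A. rate_W \<xi> x)
       \<le> liminf (\<lambda>n. ereal (1 / real n) * elog (emeasure (distr M (borel_of M11.mtopology) (S n)) A))"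
      unfolding Liminf_eq[OF ev[OF A]] by (rule LDP_lower_bound[OF A])
    show "limsup (\<lambda>n. ereal (1 / real n) * elog (emeasure (distr M (borel_of M11.mtopology) (S n)) A))
       \<le> - (INF x \<in> M11.mtopology closure_of A. rate_W \<xi> x)"
      unfolding Limsup_eq[OF ev[OF A]] by (rule LDP_upper_bound[OF A])
  qed (use ps in auto)
  then have "LDP_rv M M11.mtopology S (rate_W \<xi>)" using re by (simp add: LDP_rv_def)
  then show ?thesis using good by (simp add: S_def[abs_def])
qed

end
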